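(* Let $M$ be a finitely generated commutative binoid. There is a homotopy equivalence $$\mathbb{R}\mathrm{Spec}(M)\simeq \coprod_{\mathfrak r\in \mathrm{Adm}(M)}\mathbb{R}\mathrm{Spec}\big((C_2^\circ)^{n_{\mathfrak r}}\big)\simeq \coprod_{\mathfrak r\in \mathrm{Adm}(M)}\big(\mathbb{R}\mathrm{Spec}(C_2^\circ)\big)^{n_{\mathfrak r}},$$ where $n_{\mathfrak r}$ is the number of minimal generators of $M(\mathfrak r)^{\times\circ}\otimes C_2^\circ$. In particular, there is an equivalence of groupoids $$\Pi_1(\mathbb{R}\mathrm{Spec}(M))\simeq \coprod_{\mathfrak r\in\mathrm{Adm}(M)}\mathcal{D}^{n_{\mathfrak r}},$$ where $\mathcal{D}^{n_{\mathfrak r}}$ is the discrete groupoid with $2^{n_{\mathfrak r}}$ objects. The coproduct is taken in the 2-category of groupoids, and it is equivalent to the 2-coproduct of these groupoids.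
   Context: A (commutative) binoid is a set $M$ with a commutative associative multiplication, an identity $1$ and an absorbing element $0$. Homomorphisms preserve products, $1$ and $0$. An ideal is a subset $I\ni 0$ with $IM\subseteq I$; an ideal $\mathfrak p\neq M$ is prime if $xy\in\mathfrak p$ implies $x\in\mathfrak p$ or $y\in\mathfrak p$. $\mathbb{R}\mathrm{Spec}(M)=\mathrm{Hom}(M,\mathbb{R})$ is the set of binoid homomorphisms to $(\mathbb{R},\cdot)$, embedded in $\mathbb{R}^n$ by evaluation on generators $e_1,\dots,e_n$ of $M$ and given the subspace topology. $\mathrm{Idem}(M)$ is the binoid of idempotents of $M$ and $\mathrm{Adm}(M)$ is the set of prime ideals of $\mathrm{Idem}(M)$. For $\mathfrak r\in\mathrm{Adm}(M)$, $M(\mathfrak r)$ is the quotient of $M$ by the smallest congruence identifying $\mathfrak rM$ with $0$ and every element of $\mathrm{Idem}(M)\setminus\mathfrak r$ with $1$. For a binoid $N$, $N^{\times\circ}$ is the binoid of all invertible elements of $N$ together with $0$. A binoid is grouplike if it is a group with an absorbing element added. $C_2^\circ=\langle x\mid x^2=1\rangle$ is the grouplike binoid of the group of order 2, and $(C_2^\circ)^{n}$ is the grouplike binoid of the group $(\mathbb{Z}/2)^n$. For a grouplike binoid $G$, $G\otimes C_2^\circ$ is the grouplike binoid obtained from $G$ by imposing $g^2=1$ for all $g\ne 0$; the number of minimal generators refers to the minimal number of generators of its group of nonzero elements. $\Pi_1$ denotes the fundamental groupoid (objects: points; morphisms: homotopy classes of paths relative to endpoints). The discrete groupoid with $k$ objects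 is the groupoid with $k$ objects whose only morphisms are identities. *)

theory Defs
  imports "HOL-Analysis.Analysis" "HOL-Algebra.Elementary_Groups" "HOL-Algebra.Product_Groups"
begin

section \<open>Commutative binoids\<close>

record 'a binoid = "'a monoid" +
  absorb :: 'a

locale comm_binoid = comm_monoid M for M :: "('a, 'b) binoid_scheme" (structure) +
  assumes absorb_closed: "absorb M \<in> carrier M"
    and absorb_mult: "x \<in> carrier M \<Longrightarrow> x \<otimes> absorb M = absorb M"

inductive_set binoid_span :: "'a binoid \<Rightarrow> 'a set \<Rightarrow> 'a set" for M and A where
  one: "\<one>\<^bsub>M\<^esub> \<in> binoid_span M A"
| absorb: "absorb M \<in> binoid_span M A"
| incl: "x \<in> A \<Longrightarrow> x \<in> binoid_span M A"
| mult: "x \<in> binoid_span M A \<Longrightarrow> y \<in> binoid_span M A \<Longrightarrow> x \<otimes>\<^bsub>M\<^esub> y \<in> binoid_span M A"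

definition generated_by :: "'a binoid \<Rightarrow> 'a list \<Rightarrow> bool" where
  "generated_by M es \<longleftrightarrow> set es \<subseteq> carrier M \<and> binoid_span M (set es) = carrier M"

text \<open>Homomorphisms are taken extensional, so that two homomorphisms that agree on the carrier
  are equal and the set below is really the set of homomorphisms.\<close>

definition binoid_hom :: "'a binoid \<Rightarrow> 'b binoid \<Rightarrow> ('a \<Rightarrow> 'b) set" where
  "binoid_hom M N = {f \<in> hom M N \<inter> extensional (carrier M).
     f \<one>\<^bsub>M\<^esub> = \<one>\<^bsub>N\<^esub> \<and> f (absorb M) = absorb N}"

definition binoid_ideal :: "'a binoid \<Rightarrow> 'a set \<Rightarrow> bool" where
  "binoid_ideal M I \<longleftrightarrow> I \<subseteq> carrier M \<and> absorb M \<in> I \<and>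
     (\<forall>x\<in>I. \<forall>m\<in>carrier M. x \<otimes>\<^bsub>M\<^esub> m \<in> I)"

definition binoid_prime :: "'a binoid \<Rightarrow> 'a set \<Rightarrow> bool" where
  "binoid_prime M P \<longleftrightarrow> binoid_ideal M P \<and> P \<noteq> carrier M \<and>
     (\<forall>x\<in>carrier M. \<forall>y\<in>carrier M. x \<otimes>\<^bsub>M\<^esub> y \<in> P \<longrightarrow> x \<in> P \<or> y \<in> P)"

definition idem_binoid :: "'a binoid \<Rightarrow> 'a binoid" where
  "idem_binoid M = M\<lparr>carrier := {x \<in> carrier M. x \<otimes>\<^bsub>M\<^esub> x = x}\<rparr>"

definition Adm :: "'a binoid \<Rightarrow> 'a set set" where
  "Adm M = {r. binoid_prime (idem_binoid M) r}"

definition units_binoid :: "'a binoid \<Rightarrow> 'a binoid" where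
  "units_binoid M = M\<lparr>carrier := insert (absorb M) (Units M)\<rparr>"


section \<open>Congruences and quotients\<close>

definition binoid_congruence :: "'a binoid \<Rightarrow> ('a \<times> 'a) set \<Rightarrow> bool" where
  "binoid_congruence M R \<longleftrightarrow> equiv (carrier M) R \<and>
     (\<forall>x y z. (x, y) \<in> R \<longrightarrow> z \<in> carrier M \<longrightarrow> (x \<otimes>\<^bsub>M\<^esub> z, y \<otimes>\<^bsub>M\<^esub> z) \<in> R)"

definition generated_congruence :: "'a binoid \<Rightarrow> ('a \<times> 'a) set \<Rightarrow> ('a \<times> 'a) set" where
  "generated_congruence M S = \<Inter>{R. binoid_congruence M R \<and> S \<subseteq> R}"

definition binoid_quotient :: "'a binoid \<Rightarrow> ('a \<times> 'a) set \<Rightarrow> 'a set binoid" where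
  "binoid_quotient M R =
     \<lparr>carrier = carrier M // R,
      monoid.mult = (\<lambda>X Y. \<Union>x\<in>X. \<Union>y\<in>Y. R `` {x \<otimes>\<^bsub>M\<^esub> y}),
      one = R `` {\<one>\<^bsub>M\<^esub>},
      absorb = R `` {absorb M}\<rparr>"

definition adm_quotient :: "'a binoid \<Rightarrow> 'a set \<Rightarrow> 'a set binoid" where
  "adm_quotient M r = binoid_quotient M (generated_congruence M
     ({(e \<otimes>\<^bsub>M\<^esub> m, absorb M) | e m. e \<in> r \<and> m \<in> carrier M} \<union>
      {(e, \<one>\<^bsub>M\<^esub>) | e. e \<in> carrier (idem_binoid M) - r}))"


section \<open>Grouplike binoids\<close>

definition nonzero_group :: "'a binoid \<Rightarrow> 'a monoid" where
  "nonzero_group G = \<lparr>carrier = carrier G - {absorb G}, monoid.mult = mult G, one = one G\<rparr>"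

text \<open>The tensor product of a grouplike binoid with the grouplike binoid of the group of order 2,
  in the form in which it is used here: the relations \<open>g\<^sup>2 = 1\<close> are imposed for all nonzero \<open>g\<close>.\<close>

definition tensor_C2 :: "'a binoid \<Rightarrow> 'a set binoid" where
  "tensor_C2 G = binoid_quotient G (generated_congruence G
     {(g \<otimes>\<^bsub>G\<^esub> g, \<one>\<^bsub>G\<^esub>) | g. g \<in> carrier G - {absorb G}})"

definition min_generators :: "('a, 'b) monoid_scheme \<Rightarrow> nat" where
  "min_generators G = (LEAST k. \<exists>S. S \<subseteq> carrier G \<and> finite S \<and> card S = k \<and> generate G S = carrier G)"

definition adm_rank :: "'a binoid \<Rightarrow> 'a set \<Rightarrow> nat" where
  "adm_rank M r = min_generators (nonzero_group (tensor_C2 (units_binoid (adm_quotient M r))))"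

definition adjoin_zero :: "('a, 'b) monoid_scheme \<Rightarrow> 'a option binoid" where
  "adjoin_zero G =
     \<lparr>carrier = insert None (Some ` carrier G),
      monoid.mult = (\<lambda>x y. case (x, y) of (Some a, Some b) \<Rightarrow> Some (a \<otimes>\<^bsub>G\<^esub> b) | _ \<Rightarrow> None),
      one = Some \<one>\<^bsub>G\<^esub>,
      absorb = None\<rparr>"

definition C2 :: "int option binoid" where
  "C2 = adjoin_zero (integer_mod_group 2)"

definition C2_gens :: "int option list" where
  "C2_gens = [Some 1]"

definition C2_power :: "nat \<Rightarrow> (nat \<Rightarrow> int) option binoid" where
  "C2_power n = adjoin_zero (product_group {..<n} (\<lambda>_. integer_mod_group 2))"

definition C2_power_gens :: "nat \<Rightarrow> (nat \<Rightarrow> int) option list" where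
  "C2_power_gens n = map (\<lambda>i. Some (\<lambda>j\<in>{..<n}. if j = i then 1 else 0)) [0..<n]"


lemma generated_by_C2: "generated_by C2 C2_gens"
proof -
  have "x \<in> {None, Some 0, Some 1}" if "x \<in> binoid_span C2 (set C2_gens)" for x
    using that
    by induction (auto simp: C2_def C2_gens_def adjoin_zero_def integer_mod_group_def)
  moreover have "x \<in> binoid_span C2 (set C2_gens)" if "x \<in> {None, Some 0, Some 1}" for x
    using that binoid_span.one[of C2] binoid_span.absorb[of C2] binoid_span.incl[of "Some 1" "set C2_gens"]
    by (auto simp: C2_def C2_gens_def adjoin_zero_def integer_mod_group_def)
  moreover have "carrier C2 = {None, Some 0, Some 1}"
    by (auto simp: C2_def adjoin_zero_def integer_mod_group_def)
  ultimately show ?thesis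
    by (auto simp: generated_by_def C2_gens_def)
qed

lemma generated_by_C2_power: "generated_by (C2_power n) (C2_power_gens n)"
proof -
  let ?A = "set (C2_power_gens n)" and ?c = "carrier (product_group {..<n} (\<lambda>_. integer_mod_group 2))"
  have A: "?A \<subseteq> carrier (C2_power n)"
    by (auto simp: C2_power_def C2_power_gens_def adjoin_zero_def integer_mod_group_def)
  have car: "?c = ({..<n} \<rightarrow>\<^sub>E {0..<2})"
    by (simp add: carrier_integer_mod_group)
  have mult: "Some a \<otimes>\<^bsub>C2_power n\<^esub> Some b = Some (\<lambda>i\<in>{..<n}. (a i + b i) mod 2)" for a b
    by (simp add: C2_power_def adjoin_zero_def product_group_def integer_mod_group_def)
  have one: "\<one>\<^bsub>C2_power n\<^esub> = Some (\<lambda>i\<in>{..<n}. 0)"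
    by (simp add: C2_power_def adjoin_zero_def product_group_def integer_mod_group_def)
  have "x \<in> carrier (C2_power n)" if "x \<in> binoid_span (C2_power n) ?A" for x
    using that
  proof induction
    case (mult x y)
    then show ?case
      by (cases x; cases y)
        (auto simp: C2_power_def adjoin_zero_def product_group_def integer_mod_group_def)
  qed (use A in \<open>auto simp: C2_power_def adjoin_zero_def product_group_def integer_mod_group_def\<close>)
  moreover have "x \<in> binoid_span (C2_power n) ?A" if x: "x \<in> carrier (C2_power n)" for x
  proof (cases x)
    case None
    then show ?thesis
      using binoid_span.absorb[of "C2_power n" ?A] by (simp add: C2_power_def adjoin_zero_def)
  next
    case (Some v)
    then have v: "v \<in> {..<n} \<rightarrow>\<^sub>E {0..<2}"
      using x unfolding C2_power_def adjoin_zero_def car by auto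
    have "Some (\<lambda>i\<in>{..<n}. if i < k then v i else 0) \<in> binoid_span (C2_power n) ?A" if "k \<le> n" for k
      using that
    proof (induction k)
      case 0
      then show ?case
        using binoid_span.one[of "C2_power n" ?A] by (simp add: one restrict_def)
    next
      case (Suc k)
      let ?w = "\<lambda>k. \<lambda>i\<in>{..<n}. if i < k then v i else 0"
      have "v k \<in> {0..<2}"
        using v Suc.prems by (auto simp: PiE_iff)
      then have "v k = 0 \<or> v k = 1"
        by auto
      then show ?case
      proof
        assume "v k = 0"
        then have "?w (Suc k) = ?w k"
          by (auto simp: less_Suc_eq)
        then show ?case
          using Suc by simp
      next
        assume 1: "v k = 1"
        let ?e = "\<lambda>j\<in>{..<n}. if j = k then 1 else (0::int)"
        have "Some ?e \<in> ?A"
          using Suc.prems by (auto simp: C2_power_gens_def)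
        then have "Some (?w k) \<otimes>\<^bsub>C2_power n\<^esub> Some ?e \<in> binoid_span (C2_power n) ?A"
          by (intro binoid_span.mult[OF Suc.IH binoid_span.incl] Suc_leD[OF Suc.prems])
        moreover have "(?w k i + ?e i) mod 2 = ?w (Suc k) i" if "i < n" for i
          using that 1 v by (cases "i < k") (auto simp: less_Suc_eq PiE_iff)
        then have "(\<lambda>i\<in>{..<n}. (?w k i + ?e i) mod 2) = ?w (Suc k)"
          by (intro restrict_ext) simp
        ultimately show ?case
          unfolding mult by (simp only:)
      qed
    qed
    from this[OF order_refl]
    have "Some (\<lambda>i\<in>{..<n}. if i < n then v i else 0) \<in> binoid_span (C2_power n) ?A" .
    moreover have "(\<lambda>i\<in>{..<n}. if i < n then v i else 0) = v"
      using v by (auto simp: PiE_iff extensional_def fun_eq_iff)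
    ultimately show ?thesis
      using Some by (simp only:)
  qed
  ultimately show ?thesis
    using A by (auto simp: generated_by_def)
qed


section \<open>The real spectrum\<close>

definition real_binoid :: "real binoid" where
  "real_binoid = \<lparr>carrier = UNIV, monoid.mult = (*), one = 1, absorb = 0\<rparr>"

text \<open>The points are the homomorphisms to the reals; the topology is the one that makes evaluation
  on the generators an embedding into \<open>\<real>\<^sup>n\<close>. By \<open>RSpec_independent\<close> below it does not
  depend on the generators.\<close>

definition RSpec :: "'a binoid \<Rightarrow> 'a list \<Rightarrow> ('a \<Rightarrow> real) topology" where
  "RSpec M es = pullback_topology (binoid_hom M real_binoid)
     (\<lambda>f. \<lambda>i\<in>{..<length es}. f (es ! i)) (powertop_real {..<length es})"

lemma topspace_RSpec: "topspace (RSpec M es) = binoid_hom M real_binoid"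
  by (auto simp: RSpec_def topspace_pullback_topology)

lemma continuous_map_RSpec_eval:
  assumes "generated_by M es" "x \<in> carrier M"
  shows "continuous_map (RSpec M es) euclideanreal (\<lambda>f. f x)"
proof -
  have sub: "binoid_span M (set es) = carrier M" "set es \<subseteq> carrier M"
    using assms(1) by (auto simp: generated_by_def)
  have "x \<in> binoid_span M (set es)"
    using assms(2) sub by simp
  then show ?thesis
  proof induction
    case one
    have "continuous_map (RSpec M es) euclideanreal (\<lambda>f. 1)" by simp
    then show ?case
      by (rule continuous_map_eq) (simp add: topspace_RSpec binoid_hom_def real_binoid_def)
  next
    case absorb
    have "continuous_map (RSpec M es) euclideanreal (\<lambda>f. 0)" by simp
    then show ?case
      by (rule continuous_map_eq) (simp add: topspace_RSpec binoid_hom_def real_binoid_def)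
  next
    case (incl x)
    then obtain i where i: "i < length es" "x = es ! i"
      by (metis in_set_conv_nth)
    have "continuous_map (RSpec M es) euclideanreal ((\<lambda>g. g i) \<circ> (\<lambda>f. \<lambda>i\<in>{..<length es}. f (es ! i)))"
      unfolding RSpec_def
      by (rule continuous_map_pullback, rule continuous_map_product_projection) (use i in auto)
    then show ?case
      by (rule continuous_map_eq) (use i in simp)
  next
    case (mult x y)
    have "continuous_map (RSpec M es) euclideanreal (\<lambda>f. f x * f y)"
      using mult.IH by (rule continuous_map_real_mult)
    then show ?case
      by (rule continuous_map_eq)
        (use mult.hyps sub in \<open>auto simp: topspace_RSpec binoid_hom_def real_binoid_def hom_def\<close>)
  qed
qed

lemma RSpec_independent:
  assumes "generated_by M es" "generated_by M es'"
  shows "RSpec M es = RSpec M es'"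
proof -
  have "openin (RSpec M es) U" if es: "generated_by M es" "generated_by M es'"
    and U: "openin (RSpec M es') U" for es es' U
  proof -
    let ?ev = "\<lambda>f. \<lambda>i\<in>{..<length es'}. f (es' ! i)"
    obtain V where V: "openin (powertop_real {..<length es'}) V"
      "U = ?ev -` V \<inter> binoid_hom M real_binoid"
      using U unfolding RSpec_def openin_pullback_topology by blast
    have "continuous_map (RSpec M es) (powertop_real {..<length es'}) ?ev"
      unfolding continuous_map_componentwise
    proof (intro conjI ballI)
      fix k assume "k \<in> {..<length es'}"
      then have "es' ! k \<in> carrier M"
        using es by (auto simp: generated_by_def subset_iff)
      then have "continuous_map (RSpec M es) euclideanreal (\<lambda>f. f (es' ! k))"
        by (rule continuous_map_RSpec_eval[OF es(1)])
      then show "continuous_map (RSpec M es) euclideanreal (\<lambda>x. ?ev x k)"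
        using \<open>k \<in> {..<length es'}\<close> by simp
    qed auto
    from openin_continuous_map_preimage[OF this V(1)]
    have "openin (RSpec M es) {f \<in> binoid_hom M real_binoid. ?ev f \<in> V}"
      by (simp add: topspace_RSpec)
    moreover have "{f \<in> binoid_hom M real_binoid. ?ev f \<in> V} = U"
      using V(2) by auto
    ultimately show ?thesis by simp
  qed
  then show ?thesis
    using assms by (metis topology_eq)
qed


section \<open>Groupoids\<close>

record ('o, 'm) groupoid =
  Obj :: "'o set"
  Hom :: "'o \<Rightarrow> 'o \<Rightarrow> 'm set"
  Ident :: "'o \<Rightarrow> 'm"
  Comp :: "'m \<Rightarrow> 'm \<Rightarrow> 'm"

text \<open>\<open>Comp G g f\<close> is \<open>g\<close> after \<open>f\<close>. Different hom-sets are disjoint, so that an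
  arrow determines its source and target.\<close>

locale groupoid =
  fixes G :: "('o, 'm) groupoid"
  assumes Hom_disjoint: "\<lbrakk>x \<in> Obj G; y \<in> Obj G; x' \<in> Obj G; y' \<in> Obj G;
      f \<in> Hom G x y; f \<in> Hom G x' y'\<rbrakk> \<Longrightarrow> x = x' \<and> y = y'"
    and Ident_Hom: "x \<in> Obj G \<Longrightarrow> Ident G x \<in> Hom G x x"
    and Comp_Hom: "\<lbrakk>x \<in> Obj G; y \<in> Obj G; z \<in> Obj G; f \<in> Hom G x y; g \<in> Hom G y z\<rbrakk>
      \<Longrightarrow> Comp G g f \<in> Hom G x z"
    and Comp_Ident_right: "\<lbrakk>x \<in> Obj G; y \<in> Obj G; f \<in> Hom G x y\<rbrakk> \<Longrightarrow> Comp G f (Ident G x) = f"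
    and Comp_Ident_left: "\<lbrakk>x \<in> Obj G; y \<in> Obj G; f \<in> Hom G x y\<rbrakk> \<Longrightarrow> Comp G (Ident G y) f = f"
    and Comp_assoc: "\<lbrakk>w \<in> Obj G; x \<in> Obj G; y \<in> Obj G; z \<in> Obj G;
      f \<in> Hom G w x; g \<in> Hom G x y; h \<in> Hom G y z\<rbrakk>
      \<Longrightarrow> Comp G h (Comp G g f) = Comp G (Comp G h g) f"
    and ex_inverse: "\<lbrakk>x \<in> Obj G; y \<in> Obj G; f \<in> Hom G x y\<rbrakk>
      \<Longrightarrow> \<exists>g\<in>Hom G y x. Comp G g f = Ident G x \<and> Comp G f g = Ident G y"

record ('o, 'm, 'p, 'q) groupoid_map =
  on_obj :: "'o \<Rightarrow> 'p"
  on_hom :: "'m \<Rightarrow> 'q"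

definition map_id :: "('o, 'm, 'o, 'm) groupoid_map" where
  "map_id = \<lparr>on_obj = id, on_hom = id\<rparr>"

definition map_comp ::
  "('p, 'q, 's, 't) groupoid_map \<Rightarrow> ('o, 'm, 'p, 'q) groupoid_map \<Rightarrow> ('o, 'm, 's, 't) groupoid_map"
  where "map_comp K F = \<lparr>on_obj = on_obj K \<circ> on_obj F, on_hom = on_hom K \<circ> on_hom F\<rparr>"

definition groupoid_functor ::
  "('o, 'm) groupoid \<Rightarrow> ('p, 'q) groupoid \<Rightarrow> ('o, 'm, 'p, 'q) groupoid_map \<Rightarrow> bool" where
  "groupoid_functor G H F \<longleftrightarrow>
     (\<forall>x\<in>Obj G. on_obj F x \<in> Obj H) \<and>
     (\<forall>x\<in>Obj G. \<forall>y\<in>Obj G. \<forall>f\<in>Hom G x y. on_hom F f \<in> Hom H (on_obj F x) (on_obj F y)) \<and>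
     (\<forall>x\<in>Obj G. on_hom F (Ident G x) = Ident H (on_obj F x)) \<and>
     (\<forall>x\<in>Obj G. \<forall>y\<in>Obj G. \<forall>z\<in>Obj G. \<forall>f\<in>Hom G x y. \<forall>g\<in>Hom G y z.
        on_hom F (Comp G g f) = Comp H (on_hom F g) (on_hom F f))"

definition functor_eq ::
  "('o, 'm) groupoid \<Rightarrow> ('o, 'm, 'p, 'q) groupoid_map \<Rightarrow> ('o, 'm, 'p, 'q) groupoid_map \<Rightarrow> bool" where
  "functor_eq G F F' \<longleftrightarrow>
     (\<forall>x\<in>Obj G. on_obj F x = on_obj F' x) \<and>
     (\<forall>x\<in>Obj G. \<forall>y\<in>Obj G. \<forall>f\<in>Hom G x y. on_hom F f = on_hom F' f)"

text \<open>Natural transformations; between functors of groupoids they are all invertible.\<close>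

definition nat_trans ::
  "('o, 'm) groupoid \<Rightarrow> ('p, 'q) groupoid \<Rightarrow> ('o, 'm, 'p, 'q) groupoid_map \<Rightarrow>
   ('o, 'm, 'p, 'q) groupoid_map \<Rightarrow> ('o \<Rightarrow> 'q) \<Rightarrow> bool" where
  "nat_trans G H F F' \<alpha> \<longleftrightarrow>
     (\<forall>x\<in>Obj G. \<alpha> x \<in> Hom H (on_obj F x) (on_obj F' x)) \<and>
     (\<forall>x\<in>Obj G. \<forall>y\<in>Obj G. \<forall>f\<in>Hom G x y.
        Comp H (\<alpha> y) (on_hom F f) = Comp H (on_hom F' f) (\<alpha> x))"

definition groupoid_equivalent :: "('o, 'm) groupoid \<Rightarrow> ('p, 'q) groupoid \<Rightarrow> bool" where
  "groupoid_equivalent G H \<longleftrightarrow> groupoid G \<and> groupoid H \<and>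
     (\<exists>F K. groupoid_functor G H F \<and> groupoid_functor H G K \<and>
        (\<exists>\<alpha>. nat_trans G G (map_comp K F) map_id \<alpha>) \<and>
        (\<exists>\<beta>. nat_trans H H (map_comp F K) map_id \<beta>))"

definition path_class :: "'a topology \<Rightarrow> (real \<Rightarrow> 'a) \<Rightarrow> (real \<Rightarrow> 'a) set" where
  "path_class X p =
     {q. homotopic_with (\<lambda>r. r 0 = p 0 \<and> r 1 = p 1) (top_of_set {0..1}) X p q}"

definition fundamental_groupoid :: "'a topology \<Rightarrow> ('a, (real \<Rightarrow> 'a) set) groupoid" where
  "fundamental_groupoid X =
     \<lparr>Obj = topspace X,
      Hom = (\<lambda>x y. {path_class X p | p. pathin X p \<and> p 0 = x \<and> p 1 = y}),
      Ident = (\<lambda>x. path_class X (\<lambda>_. x)),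
      Comp = (\<lambda>b a. \<Union>q\<in>b. \<Union>p\<in>a.
        path_class X (\<lambda>t. if t \<le> 1/2 then p (2 * t) else q (2 * t - 1)))\<rparr>"

definition discrete_groupoid :: "nat \<Rightarrow> (nat, nat) groupoid" where
  "discrete_groupoid k =
     \<lparr>Obj = {..<k}, Hom = (\<lambda>x y. if x = y then {x} else {}), Ident = (\<lambda>x. x), Comp = (\<lambda>g f. f)\<rparr>"

definition groupoid_coproduct ::
  "'i set \<Rightarrow> ('i \<Rightarrow> ('o, 'm) groupoid) \<Rightarrow> ('i \<times> 'o, 'i \<times> 'm) groupoid" where
  "groupoid_coproduct I G =
     \<lparr>Obj = (SIGMA i:I. Obj (G i)),
      Hom = (\<lambda>x y. if fst x = fst y then Pair (fst x) ` Hom (G (fst x)) (snd x) (snd y) else {}),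
      Ident = (\<lambda>x. (fst x, Ident (G (fst x)) (snd x))),
      Comp = (\<lambda>g f. (fst g, Comp (G (fst g)) (snd g) (snd f)))\<rparr>"

definition coproduct_incl :: "'i \<Rightarrow> ('o, 'm, 'i \<times> 'o, 'i \<times> 'm) groupoid_map" where
  "coproduct_incl i = \<lparr>on_obj = Pair i, on_hom = Pair i\<rparr>"

text \<open>Universal properties of a cocone \<open>J i : G i \<rightarrow> C\<close>, tested against one groupoid \<open>H\<close>. They say
  that restriction along \<open>J\<close>, from the functor category \<open>[C, H]\<close> to the product of the
  \<open>[G i, H]\<close>, is an isomorphism of categories (for the coproduct in the 2-category), respectively
  an equivalence of categories (for the 2-coproduct). The first definition is full faithfulness
  of the restriction.\<close>

definition restriction_ff ::
  "'i set \<Rightarrow> ('i \<Rightarrow> ('o, 'm) groupoid) \<Rightarrow> ('c, 'd) groupoid \<Rightarrow>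
   ('i \<Rightarrow> ('o, 'm, 'c, 'd) groupoid_map) \<Rightarrow> ('h, 'k) groupoid \<Rightarrow> bool" where
  "restriction_ff I G C J H \<longleftrightarrow>
     (\<forall>K K' \<alpha>. groupoid_functor C H K \<and> groupoid_functor C H K' \<and>
        (\<forall>i\<in>I. nat_trans (G i) H (map_comp K (J i)) (map_comp K' (J i)) (\<alpha> i)) \<longrightarrow>
        (\<exists>\<beta>. nat_trans C H K K' \<beta> \<and> (\<forall>i\<in>I. \<forall>x\<in>Obj (G i). \<beta> (on_obj (J i) x) = \<alpha> i x) \<and>
          (\<forall>\<beta>'. nat_trans C H K K' \<beta>' \<and>
             (\<forall>i\<in>I. \<forall>x\<in>Obj (G i). \<beta>' (on_obj (J i) x) = \<alpha> i x) \<longrightarrow>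
             (\<forall>c\<in>Obj C. \<beta>' c = \<beta> c))))"

definition coproduct_for ::
  "'i set \<Rightarrow> ('i \<Rightarrow> ('o, 'm) groupoid) \<Rightarrow> ('c, 'd) groupoid \<Rightarrow>
   ('i \<Rightarrow> ('o, 'm, 'c, 'd) groupoid_map) \<Rightarrow> ('h, 'k) groupoid \<Rightarrow> bool" where
  "coproduct_for I G C J H \<longleftrightarrow>
     (\<forall>F. (\<forall>i\<in>I. groupoid_functor (G i) H (F i)) \<longrightarrow>
        (\<exists>K. groupoid_functor C H K \<and> (\<forall>i\<in>I. functor_eq (G i) (map_comp K (J i)) (F i)) \<and>
          (\<forall>K'. groupoid_functor C H K' \<and>
             (\<forall>i\<in>I. functor_eq (G i) (map_comp K' (J i)) (F i)) \<longrightarrow> functor_eq C K' K))) \<and>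
     restriction_ff I G C J H"

definition two_coproduct_for ::
  "'i set \<Rightarrow> ('i \<Rightarrow> ('o, 'm) groupoid) \<Rightarrow> ('c, 'd) groupoid \<Rightarrow>
   ('i \<Rightarrow> ('o, 'm, 'c, 'd) groupoid_map) \<Rightarrow> ('h, 'k) groupoid \<Rightarrow> bool" where
  "two_coproduct_for I G C J H \<longleftrightarrow>
     (\<forall>F. (\<forall>i\<in>I. groupoid_functor (G i) H (F i)) \<longrightarrow>
        (\<exists>K. groupoid_functor C H K \<and>
          (\<forall>i\<in>I. \<exists>\<alpha>. nat_trans (G i) H (map_comp K (J i)) (F i) \<alpha>))) \<and>
     restriction_ff I G C J H"

definition groupoid_cocone ::
  "'i set \<Rightarrow> ('i \<Rightarrow> ('o, 'm) groupoid) \<Rightarrow> ('c, 'd) groupoid \<Rightarrow>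
   ('i \<Rightarrow> ('o, 'm, 'c, 'd) groupoid_map) \<Rightarrow> bool" where
  "groupoid_cocone I G C J \<longleftrightarrow> groupoid C \<and> (\<forall>i\<in>I. groupoid_functor (G i) C (J i))"

definition adm_discrete :: "'a binoid \<Rightarrow> 'a set \<Rightarrow> (nat, nat) groupoid" where
  "adm_discrete M r = discrete_groupoid (2 ^ adm_rank M r)"

definition adm_coproduct :: "'a binoid \<Rightarrow> ('a set \<times> nat, 'a set \<times> nat) groupoid" where
  "adm_coproduct M = groupoid_coproduct (Adm M) (adm_discrete M)"

end

(*
  A point f of the real spectrum has a support, which is a face of M: a divisor-closed submonoid
  avoiding the absorbing element. There are finitely many faces, and they stratify the spectrum.

  The divisors of a nonzero idempotent e form a face, and these faces correspond to the prime ideals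
  of the idempotents. Any other face F carries a nontrivial additive function v >= 0, because by
  Gordan's alternative its absence would produce an idempotent whose divisors are exactly F.
  Multiplying f by exp(-s v) then pushes f out of the stratum as s tends to infinity. With finitely
  many such functions, one for each part of the boundary, and with speeds depending on f, the closure
  of the stratum retracts onto its boundary relative to the boundary. Removing the strata from the
  largest face downwards leaves the disjoint union of the strata of the idempotents. There, f is
  deformed to its sign, which leaves a finite discrete set. The signs supported on the divisors of e
  are the characters of an elementary abelian 2-group, by the universal properties of the quotients.

  A space with the homotopy type of a discrete space has a fundamental groupoid with at most one
  morphism between any two objects, which gives the statements on groupoids.
*)
theory Submission
  imports Defs "HOL-Algebra.FiniteProduct"
begin

section \<open>Coproducts of groupoids\<close>

text \<open>A retraction of a stratum onto its boundary must fix the boundary and still bring nearby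
  points onto it. Attenuation along a weight \<open>v\<close> leaves a point unchanged only if the
  point vanishes wherever \<open>v\<close> is positive, and one \<open>v\<close> need not do this
  for all boundary points. Gordan's alternative, applied to the generators on which a boundary point
  vanishes, yields a \<open>v\<close> for its support, hence finitely many in all. The speeds
  \<open>rate v f\<close> are ratios of distances: all are 0 on the boundary, and inside one of them
  is 1, which means infinite attenuation at time 1. They may be discontinuous where
  \<open>wdist v f = 0\<close>, harmlessly, because there \<open>f\<close> is already 0 on every
  element of positive \<open>v\<close>-weight. The closure of a stratum enters through the equations
  of \<open>closed_stratum\<close>; its cancellation equations tie boundary points to the relation
  lattice of the face. Openness of the stratum being removed is not automatic, as idempotent faces
  above it may remain; the values 0 and 1 on idempotents separate them.\<close>

lemma groupoid_functor_comp:
  assumes "groupoid_functor G H F" "groupoid_functor H L K"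
  shows "groupoid_functor G L (map_comp K F)"
  using assms unfolding groupoid_functor_def map_comp_def by simp blast

lemma groupoid_functor_id: "groupoid_functor G G map_id"
  by (simp add: groupoid_functor_def map_id_def)

lemma groupoid_coproduct_groupoid:
  assumes G: "\<And>i. i \<in> I \<Longrightarrow> groupoid (G i)"
  shows "groupoid (groupoid_coproduct I G)"
proof
  let ?C = "groupoid_coproduct I G"
  fix x y f
  assume xy: "x \<in> Obj ?C" "y \<in> Obj ?C" "f \<in> Hom ?C x y"
  obtain i u v m where e: "x = (i, u)" "y = (i, v)" "f = (i, m)" "m \<in> Hom (G i) u v"
      "i \<in> I" "u \<in> Obj (G i)" "v \<in> Obj (G i)"
    using xy by (cases x; cases y) (auto simp: groupoid_coproduct_def split: if_splits)
  obtain n where n: "n \<in> Hom (G i) v u" "Comp (G i) n m = Ident (G i) u" "Comp (G i) m n = Ident (G i) v"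
    using groupoid.ex_inverse[OF G] e by metis
  show "\<exists>g\<in>Hom ?C y x. Comp ?C g f = Ident ?C x \<and> Comp ?C f g = Ident ?C y"
    by (rule bexI[of _ "(i, n)"]) (use n e in \<open>auto simp: groupoid_coproduct_def\<close>)
qed (auto simp: groupoid_coproduct_def groupoid.Ident_Hom[OF G] groupoid.Comp_Hom[OF G]
      groupoid.Comp_Ident_right[OF G] groupoid.Comp_Ident_left[OF G] groupoid.Comp_assoc[OF G]
      split: if_splits dest: groupoid.Hom_disjoint[OF G])

lemma groupoid_cocone_coproduct:
  assumes "\<And>i. i \<in> I \<Longrightarrow> groupoid (G i)"
  shows "groupoid_cocone I G (groupoid_coproduct I G) coproduct_incl"
  using groupoid_coproduct_groupoid[of I G, OF assms]
  by (auto simp: groupoid_cocone_def groupoid_functor_def groupoid_coproduct_def coproduct_incl_def)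

text \<open>Every object and every arrow carries the index of its summand, so defining things
  summand by summand is the only choice, for functors as well as for transformations.\<close>

lemma coproduct_for_groupoid_coproduct:
  "coproduct_for I G (groupoid_coproduct I G) coproduct_incl H"
proof -
  let ?C = "groupoid_coproduct I G"
  have 1: "\<exists>K. groupoid_functor ?C H K \<and>
      (\<forall>i\<in>I. functor_eq (G i) (map_comp K (coproduct_incl i)) (F i)) \<and>
      (\<forall>K'. groupoid_functor ?C H K' \<and>
        (\<forall>i\<in>I. functor_eq (G i) (map_comp K' (coproduct_incl i)) (F i)) \<longrightarrow> functor_eq ?C K' K)"
    if F: "\<forall>i\<in>I. groupoid_functor (G i) H (F i)" for F
  proof (intro exI conjI allI impI)
    let ?K = "\<lparr>on_obj = (\<lambda>(i, x). on_obj (F i) x), on_hom = (\<lambda>(i, m). on_hom (F i) m)\<rparr>"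
    show "groupoid_functor ?C H ?K"
      using F by (auto simp: groupoid_functor_def groupoid_coproduct_def split: if_splits)
    show "\<forall>i\<in>I. functor_eq (G i) (map_comp ?K (coproduct_incl i)) (F i)"
      by (simp add: functor_eq_def map_comp_def coproduct_incl_def)
    fix K'
    assume K': "groupoid_functor ?C H K' \<and>
      (\<forall>i\<in>I. functor_eq (G i) (map_comp K' (coproduct_incl i)) (F i))"
    then show "functor_eq ?C K' ?K"
      by (auto simp: functor_eq_def map_comp_def coproduct_incl_def groupoid_coproduct_def
          split: if_splits)
  qed
  have 2: "restriction_ff I G ?C coproduct_incl H"
    unfolding restriction_ff_def
  proof (intro allI impI)
    fix K K' \<alpha>
    assume K: "groupoid_functor ?C H K \<and> groupoid_functor ?C H K' \<and>
      (\<forall>i\<in>I. nat_trans (G i) H (map_comp K (coproduct_incl i)) (map_comp K' (coproduct_incl i)) (\<alpha> i))"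
    show "\<exists>\<beta>. nat_trans ?C H K K' \<beta> \<and>
      (\<forall>i\<in>I. \<forall>x\<in>Obj (G i). \<beta> (on_obj (coproduct_incl i) x) = \<alpha> i x) \<and>
      (\<forall>\<beta>'. nat_trans ?C H K K' \<beta>' \<and>
        (\<forall>i\<in>I. \<forall>x\<in>Obj (G i). \<beta>' (on_obj (coproduct_incl i) x) = \<alpha> i x) \<longrightarrow>
        (\<forall>c\<in>Obj ?C. \<beta>' c = \<beta> c))"
      by (rule exI[of _ "\<lambda>(i, x). \<alpha> i x"])
        (use K in \<open>auto simp: nat_trans_def map_comp_def coproduct_incl_def groupoid_coproduct_def
          split: if_splits\<close>)
  qed
  show ?thesis
    unfolding coproduct_for_def using 1 2 by blast
qed

lemma nat_trans_of_functor_eq: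
  assumes "groupoid H" "groupoid_functor G H F'" "functor_eq G F F'"
  shows "nat_trans G H F F' (\<lambda>x. Ident H (on_obj F' x))"
  unfolding nat_trans_def
proof (intro conjI ballI)
  have obj: "on_obj F' x \<in> Obj H" "on_obj F x = on_obj F' x" if "x \<in> Obj G" for x
    using assms that by (auto simp: groupoid_functor_def functor_eq_def)
  show "Ident H (on_obj F' x) \<in> Hom H (on_obj F x) (on_obj F' x)" if "x \<in> Obj G" for x
    using obj[OF that] groupoid.Ident_Hom[OF assms(1)] by simp
  fix x y f
  assume xy: "x \<in> Obj G" "y \<in> Obj G" and f: "f \<in> Hom G x y"
  have "on_hom F' f \<in> Hom H (on_obj F' x) (on_obj F' y)" "on_hom F f = on_hom F' f"
    using assms xy f by (auto simp: groupoid_functor_def functor_eq_def)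
  then show "Comp H (Ident H (on_obj F' y)) (on_hom F f) = Comp H (on_hom F' f) (Ident H (on_obj F' x))"
    using obj(1)[OF xy(1)] obj(1)[OF xy(2)]
    by (simp add: groupoid.Comp_Ident_left[OF assms(1)] groupoid.Comp_Ident_right[OF assms(1)])
qed

text \<open>An equality of functors becomes a natural transformation through the identities of
  \<open>H\<close>; the condition on transformations is common to both notions.\<close>

lemma two_coproduct_for_of_coproduct_for:
  assumes H: "groupoid H" and C: "coproduct_for I G C J H"
  shows "two_coproduct_for I G C J H"
  unfolding two_coproduct_for_def
proof (intro conjI allI impI)
  show "restriction_ff I G C J H"
    using C by (simp add: coproduct_for_def)
  fix F assume F: "\<forall>i\<in>I. groupoid_functor (G i) H (F i)"
  then obtain K where "groupoid_functor C H K"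
      "\<forall>i\<in>I. functor_eq (G i) (map_comp K (J i)) (F i)"
    using C unfolding coproduct_for_def by blast
  then show "\<exists>K. groupoid_functor C H K \<and>
      (\<forall>i\<in>I. \<exists>\<alpha>. nat_trans (G i) H (map_comp K (J i)) (F i) \<alpha>)"
    using F by (metis nat_trans_of_functor_eq[OF H])
qed

section \<open>Uniqueness of 2-coproducts up to equivalence\<close>

lemma nat_trans_comp:
  assumes H: "groupoid H" and F: "groupoid_functor G H F" "groupoid_functor G H F'"
    "groupoid_functor G H F''"
    and \<alpha>: "nat_trans G H F F' \<alpha>" and \<beta>: "nat_trans G H F' F'' \<beta>"
  shows "nat_trans G H F F'' (\<lambda>x. Comp H (\<beta> x) (\<alpha> x))"
  unfolding nat_trans_def
proof (intro conjI ballI)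
  interpret groupoid H by fact
  have obj: "on_obj F x \<in> Obj H" "on_obj F' x \<in> Obj H" "on_obj F'' x \<in> Obj H" if "x \<in> Obj G" for x
    using F that by (auto simp: groupoid_functor_def)
  have hom: "on_hom F f \<in> Hom H (on_obj F x) (on_obj F y)" "on_hom F' f \<in> Hom H (on_obj F' x) (on_obj F' y)"
    "on_hom F'' f \<in> Hom H (on_obj F'' x) (on_obj F'' y)"
    if "x \<in> Obj G" "y \<in> Obj G" "f \<in> Hom G x y" for x y f
    using F that by (auto simp: groupoid_functor_def)
  have a: "\<alpha> x \<in> Hom H (on_obj F x) (on_obj F' x)" and b: "\<beta> x \<in> Hom H (on_obj F' x) (on_obj F'' x)"
    if "x \<in> Obj G" for x
    using that \<alpha> \<beta> by (auto simp: nat_trans_def)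
  show "Comp H (\<beta> x) (\<alpha> x) \<in> Hom H (on_obj F x) (on_obj F'' x)" if "x \<in> Obj G" for x
    using that a b obj Comp_Hom by metis
  fix x y f
  assume xy: "x \<in> Obj G" "y \<in> Obj G" and f: "f \<in> Hom G x y"
  have "Comp H (Comp H (\<beta> y) (\<alpha> y)) (on_hom F f) = Comp H (\<beta> y) (Comp H (\<alpha> y) (on_hom F f))"
    using Comp_assoc[OF obj(1)[OF xy(1)] obj[OF xy(2)] hom(1)[OF xy f] a[OF xy(2)] b[OF xy(2)]]
    by (rule sym)
  also have "Comp H (\<alpha> y) (on_hom F f) = Comp H (on_hom F' f) (\<alpha> x)"
    using \<alpha> xy f by (auto simp: nat_trans_def)
  also have "Comp H (\<beta> y) (Comp H (on_hom F' f) (\<alpha> x)) = Comp H (Comp H (\<beta> y) (on_hom F' f)) (\<alpha> x)"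
    by (rule Comp_assoc[OF obj(1,2)[OF xy(1)] obj(2,3)[OF xy(2)] a[OF xy(1)] hom(2)[OF xy f] b[OF xy(2)]])
  also have "Comp H (\<beta> y) (on_hom F' f) = Comp H (on_hom F'' f) (\<beta> x)"
    using \<beta> xy f by (auto simp: nat_trans_def)
  also have "Comp H (Comp H (on_hom F'' f) (\<beta> x)) (\<alpha> x) = Comp H (on_hom F'' f) (Comp H (\<beta> x) (\<alpha> x))"
    using Comp_assoc[OF obj[OF xy(1)] obj(3)[OF xy(2)] a[OF xy(1)] b[OF xy(1)] hom(3)[OF xy f]]
    by (rule sym)
  finally show "Comp H (Comp H (\<beta> y) (\<alpha> y)) (on_hom F f)
      = Comp H (on_hom F'' f) (Comp H (\<beta> x) (\<alpha> x))" .
qed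

lemma nat_trans_whisker_left:
  assumes "groupoid_functor H L K" "groupoid_functor G H F" "groupoid_functor G H F'"
    and "nat_trans G H F F' \<alpha>"
  shows "nat_trans G L (map_comp K F) (map_comp K F') (\<lambda>x. on_hom K (\<alpha> x))"
  unfolding nat_trans_def map_comp_def
proof (intro conjI ballI)
  have obj: "on_obj F x \<in> Obj H" "on_obj F' x \<in> Obj H" if "x \<in> Obj G" for x
    using assms that by (auto simp: groupoid_functor_def)
  have a: "\<alpha> x \<in> Hom H (on_obj F x) (on_obj F' x)" if "x \<in> Obj G" for x
    using that assms(4) by (auto simp: nat_trans_def)
  have hom: "on_hom F f \<in> Hom H (on_obj F x) (on_obj F y)" "on_hom F' f \<in> Hom H (on_obj F' x) (on_obj F' y)"
    if "x \<in> Obj G" "y \<in> Obj G" "f \<in> Hom G x y" for x y f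
    using assms that by (auto simp: groupoid_functor_def)
  have K: "on_hom K (Comp H g f) = Comp L (on_hom K g) (on_hom K f)"
    if "x \<in> Obj H" "y \<in> Obj H" "z \<in> Obj H" "f \<in> Hom H x y" "g \<in> Hom H y z" for x y z f g
    using assms(1) that by (auto simp: groupoid_functor_def)
  show "on_hom K (\<alpha> x) \<in> Hom L (on_obj \<lparr>on_obj = on_obj K \<circ> on_obj F, on_hom = on_hom K \<circ> on_hom F\<rparr> x)
          (on_obj \<lparr>on_obj = on_obj K \<circ> on_obj F', on_hom = on_hom K \<circ> on_hom F'\<rparr> x)"
    if "x \<in> Obj G" for x
    using assms(1) obj[OF that] a[OF that] by (auto simp: groupoid_functor_def)
  fix x y f
  assume xy: "x \<in> Obj G" "y \<in> Obj G" and f: "f \<in> Hom G x y"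
  have "Comp H (\<alpha> y) (on_hom F f) = Comp H (on_hom F' f) (\<alpha> x)"
    using assms(4) xy f by (auto simp: nat_trans_def)
  moreover have "on_hom K (Comp H (\<alpha> y) (on_hom F f)) = Comp L (on_hom K (\<alpha> y)) (on_hom K (on_hom F f))"
    by (rule K[OF obj(1)[OF xy(1)] obj[OF xy(2)] hom(1)[OF xy f] a[OF xy(2)]])
  moreover have "on_hom K (Comp H (on_hom F' f) (\<alpha> x)) = Comp L (on_hom K (on_hom F' f)) (on_hom K (\<alpha> x))"
    by (rule K[OF obj[OF xy(1)] obj(2)[OF xy(2)] a[OF xy(1)] hom(2)[OF xy f]])
  ultimately show "Comp L (on_hom K (\<alpha> y))
      (on_hom \<lparr>on_obj = on_obj K \<circ> on_obj F, on_hom = on_hom K \<circ> on_hom F\<rparr> f) =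
    Comp L (on_hom \<lparr>on_obj = on_obj K \<circ> on_obj F', on_hom = on_hom K \<circ> on_hom F'\<rparr> f) (on_hom K (\<alpha> x))"
    by simp
qed

lemma map_comp_assoc: "map_comp (map_comp L K) F = map_comp L (map_comp K F)"
  by (simp add: map_comp_def comp_assoc)

lemma map_comp_id: "map_comp map_id F = F"
  by (simp add: map_comp_def map_id_def)

text \<open>Each universal property is tested at the two apexes: at the other one to obtain a
  comparison functor, at its own to compare a round trip with the identity.\<close>

lemma two_coproduct_unique:
  assumes C: "groupoid_cocone I G C J" "two_coproduct_for I G C J P" "two_coproduct_for I G C J C"
    and P: "groupoid_cocone I G P J'" "two_coproduct_for I G P J' C" "two_coproduct_for I G P J' P"
  shows "groupoid_equivalent C P"
proof -
  have Cg: "groupoid C" and Pg: "groupoid P"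
    and J: "\<And>i. i \<in> I \<Longrightarrow> groupoid_functor (G i) C (J i)"
    and J': "\<And>i. i \<in> I \<Longrightarrow> groupoid_functor (G i) P (J' i)"
    using C(1) P(1) by (auto simp: groupoid_cocone_def)
  obtain L where L: "groupoid_functor C P L"
      "\<forall>i\<in>I. \<exists>\<alpha>. nat_trans (G i) P (map_comp L (J i)) (J' i) \<alpha>"
    using C(2) J' unfolding two_coproduct_for_def by blast
  obtain K where K: "groupoid_functor P C K"
      "\<forall>i\<in>I. \<exists>\<alpha>. nat_trans (G i) C (map_comp K (J' i)) (J i) \<alpha>"
    using P(2) J unfolding two_coproduct_for_def by blast
  \<comment> \<open>On each summand the round trip is related to the identity by whiskering and
    composing; full faithfulness of the restriction glues these transformations to one on the whole
    apex.\<close>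
  have *: "\<exists>\<beta>. nat_trans A A (map_comp S T) map_id \<beta>"
    if ff: "restriction_ff I G A JA A" and A: "groupoid A"
      and JA: "\<And>i. i \<in> I \<Longrightarrow> groupoid_functor (G i) A (JA i)"
      and JB: "\<And>i. i \<in> I \<Longrightarrow> groupoid_functor (G i) B (JB i)"
      and T: "groupoid_functor A B T" "\<forall>i\<in>I. \<exists>\<alpha>. nat_trans (G i) B (map_comp T (JA i)) (JB i) \<alpha>"
      and S: "groupoid_functor B A S" "\<forall>i\<in>I. \<exists>\<alpha>. nat_trans (G i) A (map_comp S (JB i)) (JA i) \<alpha>"
    for A :: "('x, 'y) groupoid" and B :: "('z, 'w) groupoid" and JA JB S T
  proof -
    have "\<exists>\<alpha>. nat_trans (G i) A (map_comp (map_comp S T) (JA i)) (map_comp map_id (JA i)) \<alpha>"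
      if i: "i \<in> I" for i
    proof -
      obtain \<alpha> \<beta> where ab: "nat_trans (G i) B (map_comp T (JA i)) (JB i) \<alpha>"
          "nat_trans (G i) A (map_comp S (JB i)) (JA i) \<beta>"
        using T(2) S(2) i by blast
      have "nat_trans (G i) A (map_comp S (map_comp T (JA i))) (map_comp S (JB i)) (\<lambda>x. on_hom S (\<alpha> x))"
        by (rule nat_trans_whisker_left[OF S(1) _ JB[OF i] ab(1)])
          (rule groupoid_functor_comp[OF JA[OF i] T(1)])
      from nat_trans_comp[OF A _ _ JA[OF i] this ab(2)]
      show ?thesis
        unfolding map_comp_assoc map_comp_id
        using groupoid_functor_comp[OF groupoid_functor_comp[OF JA[OF i] T(1)] S(1)]
          groupoid_functor_comp[OF JB[OF i] S(1)] by blast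
    qed
    then obtain \<alpha> where
      "\<forall>i\<in>I. nat_trans (G i) A (map_comp (map_comp S T) (JA i)) (map_comp map_id (JA i)) (\<alpha> i)"
      by metis
    then show ?thesis
      using ff groupoid_functor_comp[OF T(1) S(1)] groupoid_functor_id
      unfolding restriction_ff_def by blast
  qed
  have "restriction_ff I G C J C" "restriction_ff I G P J' P"
    using C(3) P(3) by (auto simp: two_coproduct_for_def)
  then show ?thesis
    unfolding groupoid_equivalent_def
    using Cg Pg L(1) K(1) *[OF _ Cg J J' L K] *[OF _ Pg J' J K L] by blast
qed

section \<open>Fundamental groupoids of spaces with the homotopy type of a discrete space\<close>

definition thin :: "('o, 'm) groupoid \<Rightarrow> bool" where
  "thin G \<longleftrightarrow> (\<forall>x\<in>Obj G. \<forall>y\<in>Obj G. \<forall>f\<in>Hom G x y. \<forall>g\<in>Hom G x y. f = g)"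

text \<open>Functoriality is automatic in a thin target. Since \<open>on_hom\<close> sees only the
  arrow, its endpoints are recovered from the disjointness of the hom-sets of
  \<open>A\<close>.\<close>

lemma thin_functor_exists:
  assumes A: "groupoid A" and B: "groupoid B" "thin B" and c: "\<And>x. x \<in> Obj A \<Longrightarrow> c x \<in> Obj B"
    and c_hom: "\<And>x y. \<lbrakk>x \<in> Obj A; y \<in> Obj A; Hom A x y \<noteq> {}\<rbrakk> \<Longrightarrow> Hom B (c x) (c y) \<noteq> {}"
  obtains F where "groupoid_functor A B F" "on_obj F = c"
proof -
  let ?F = "\<lparr>on_obj = c, on_hom = (\<lambda>f. SOME h. \<exists>x\<in>Obj A. \<exists>y\<in>Obj A.
      f \<in> Hom A x y \<and> h \<in> Hom B (c x) (c y))\<rparr>"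
  have hom: "on_hom ?F f \<in> Hom B (c x) (c y)" if f: "x \<in> Obj A" "y \<in> Obj A" "f \<in> Hom A x y" for x y f
  proof -
    have "\<exists>h. \<exists>x\<in>Obj A. \<exists>y\<in>Obj A. f \<in> Hom A x y \<and> h \<in> Hom B (c x) (c y)"
      using c_hom[OF f(1,2)] f by blast
    then have "\<exists>x'\<in>Obj A. \<exists>y'\<in>Obj A. f \<in> Hom A x' y' \<and> on_hom ?F f \<in> Hom B (c x') (c y')"
      unfolding groupoid_map.simps by (rule someI_ex)
    then obtain x' y' where "x' \<in> Obj A" "y' \<in> Obj A" "f \<in> Hom A x' y'"
        "on_hom ?F f \<in> Hom B (c x') (c y')"
      by blast
    with groupoid.Hom_disjoint[OF A f(1,2) this(1,2) f(3) this(3)] show ?thesis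
      by simp
  qed
  have eq: "g = h" if "x \<in> Obj A" "y \<in> Obj A" "g \<in> Hom B (c x) (c y)" "h \<in> Hom B (c x) (c y)"
    for x y g h
    using B(2) c that by (auto simp: thin_def)
  have obj: "on_obj ?F x = c x" for x
    by simp
  have "groupoid_functor A B ?F"
    unfolding groupoid_functor_def obj
  proof (intro conjI ballI)
    fix x assume x: "x \<in> Obj A"
    show "on_hom ?F (Ident A x) = Ident B (c x)"
      by (rule eq[OF x x hom[OF x x groupoid.Ident_Hom[OF A x]] groupoid.Ident_Hom[OF B(1) c[OF x]]])
    fix y z f g
    assume yz: "y \<in> Obj A" "z \<in> Obj A" and f: "f \<in> Hom A x y" and g: "g \<in> Hom A y z"
    show "on_hom ?F (Comp A g f) = Comp B (on_hom ?F g) (on_hom ?F f)"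
      by (rule eq[OF x yz(2) hom[OF x yz(2) groupoid.Comp_Hom[OF A x yz f g]]
          groupoid.Comp_Hom[OF B(1) c[OF x] c[OF yz(1)] c[OF yz(2)] hom[OF x yz(1) f] hom[OF yz g]]])
  qed (use c hom in blast)+
  then show ?thesis
    by (rule that) simp
qed

lemma thin_nat_trans_id:
  assumes A: "groupoid A" "thin A" and F: "groupoid_functor A A F"
    and e: "\<And>x. x \<in> Obj A \<Longrightarrow> Hom A (on_obj F x) x \<noteq> {}"
  shows "\<exists>\<alpha>. nat_trans A A F map_id \<alpha>"
proof -
  obtain \<alpha> where \<alpha>: "\<And>x. x \<in> Obj A \<Longrightarrow> \<alpha> x \<in> Hom A (on_obj F x) x"
    using e that[of "\<lambda>x. SOME h. h \<in> Hom A (on_obj F x) x"] some_in_eq by blast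
  have "Comp A (\<alpha> y) (on_hom F f) = Comp A f (\<alpha> x)"
    if x: "x \<in> Obj A" and y: "y \<in> Obj A" and f: "f \<in> Hom A x y" for x y f
  proof -
    have Fx: "on_obj F x \<in> Obj A" "on_obj F y \<in> Obj A"
      "on_hom F f \<in> Hom A (on_obj F x) (on_obj F y)"
      using F x y f by (auto simp: groupoid_functor_def)
    show ?thesis
      using groupoid.Comp_Hom[OF A(1) Fx(1,2) y Fx(3) \<alpha>[OF y]]
        groupoid.Comp_Hom[OF A(1) Fx(1) x y \<alpha>[OF x] f] A(2) Fx(1) y
      unfolding thin_def by blast
  qed
  then have "nat_trans A A F map_id \<alpha>"
    using \<alpha> by (simp add: nat_trans_def map_id_def)
  then show ?thesis by blast
qed

lemma thin_groupoids_equivalent: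
  assumes G: "groupoid G" "thin G" and H: "groupoid H" "thin H"
    and a: "\<And>x. x \<in> Obj G \<Longrightarrow> a x \<in> Obj H" and b: "\<And>y. y \<in> Obj H \<Longrightarrow> b y \<in> Obj G"
    and a_hom: "\<And>x y. \<lbrakk>x \<in> Obj G; y \<in> Obj G; Hom G x y \<noteq> {}\<rbrakk> \<Longrightarrow> Hom H (a x) (a y) \<noteq> {}"
    and b_hom: "\<And>x y. \<lbrakk>x \<in> Obj H; y \<in> Obj H; Hom H x y \<noteq> {}\<rbrakk> \<Longrightarrow> Hom G (b x) (b y) \<noteq> {}"
    and ba: "\<And>x. x \<in> Obj G \<Longrightarrow> Hom G (b (a x)) x \<noteq> {}"
    and ab: "\<And>y. y \<in> Obj H \<Longrightarrow> Hom H (a (b y)) y \<noteq> {}"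
  shows "groupoid_equivalent G H"
proof -
  obtain F where F: "groupoid_functor G H F" "on_obj F = a"
    using thin_functor_exists[of G H a] G(1) H a a_hom by metis
  obtain K where K: "groupoid_functor H G K" "on_obj K = b"
    using thin_functor_exists[of H G b] H(1) G b b_hom by metis
  have "\<exists>\<alpha>. nat_trans G G (map_comp K F) map_id \<alpha>"
    by (rule thin_nat_trans_id[OF G groupoid_functor_comp[OF F(1) K(1)]])
      (simp add: map_comp_def F K ba)
  moreover have "\<exists>\<alpha>. nat_trans H H (map_comp F K) map_id \<alpha>"
    by (rule thin_nat_trans_id[OF H groupoid_functor_comp[OF K(1) F(1)]])
      (simp add: map_comp_def F K ab)
  ultimately show ?thesis
    unfolding groupoid_equivalent_def using F(1) K(1) G(1) H(1) by blast
qed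

lemma path_class_top_of_set: "path_class (top_of_set S) p = {q. homotopic_paths S p q}"
  by (simp add: path_class_def homotopic_paths_def pathstart_def pathfinish_def)

lemma pathin_top_of_set: "pathin (top_of_set S) p \<longleftrightarrow> path p \<and> path_image p \<subseteq> S"
  by (auto simp: pathin_def path_def path_image_def image_subset_iff)

text \<open>The class of a path is then the set \<open>P x y\<close> of all paths with the same
  endpoints. The groupoid laws reduce to the uniqueness of arrows, so no homotopies for
  associativity or inverses have to be constructed.\<close>

lemma fundamental_groupoid_thin:
  fixes S :: "'a::topological_space set"
  assumes uniq: "\<And>p q. \<lbrakk>path p; path_image p \<subseteq> S; path q; path_image q \<subseteq> S;
      pathstart p = pathstart q; pathfinish p = pathfinish q\<rbrakk> \<Longrightarrow> homotopic_paths S p q"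
  shows "groupoid (fundamental_groupoid (top_of_set S))" "thin (fundamental_groupoid (top_of_set S))"
proof -
  let ?G = "fundamental_groupoid (top_of_set S)"
  define P where "P x y = {p. path p \<and> path_image p \<subseteq> S \<and> pathstart p = x \<and> pathfinish p = y}" for x y
  have cls: "path_class (top_of_set S) p = P (pathstart p) (pathfinish p)"
    if "path p" "path_image p \<subseteq> S" for p
    using that uniq
    by (auto simp: path_class_top_of_set P_def homotopic_paths_imp_pathstart
        homotopic_paths_imp_pathfinish dest: homotopic_paths_imp_path homotopic_paths_imp_subset)
  have Hom: "Hom ?G x y = (if P x y = {} then {} else {P x y})" for x y
    using cls by (auto simp: fundamental_groupoid_def pathin_top_of_set P_def pathstart_def pathfinish_def)
  have Obj: "Obj ?G = S"
    by (simp add: fundamental_groupoid_def)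
  have Ident: "Ident ?G x = P x x" "Ident ?G x \<in> Hom ?G x x" if "x \<in> S" for x
  proof -
    have "path (\<lambda>_::real. x)" "path_image (\<lambda>_::real. x) \<subseteq> S"
      using that by (auto simp: path_def path_image_def)
    then have "(\<lambda>_. x) \<in> P x x"
      by (simp add: P_def pathstart_def pathfinish_def)
    moreover show "Ident ?G x = P x x"
      using cls[of "\<lambda>_. x"] \<open>path _\<close> \<open>path_image _ \<subseteq> S\<close>
      by (simp add: fundamental_groupoid_def pathstart_def pathfinish_def)
    ultimately show "Ident ?G x \<in> Hom ?G x x"
      by (auto simp: Hom)
  qed
  have Comp: "Comp ?G (P y z) (P x y) = P x z \<and> P x z \<noteq> {}" if ne: "P x y \<noteq> {}" "P y z \<noteq> {}" for x y z
  proof -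
    have join: "(\<lambda>t. if t \<le> 1/2 then p (2 * t) else q (2 * t - 1)) = p +++ q" for p q :: "real \<Rightarrow> 'a"
      by (simp add: joinpaths_def)
    have "path_class (top_of_set S) (p +++ q) = P x z" "P x z \<noteq> {}" if "p \<in> P x y" "q \<in> P y z" for p q
    proof -
      have pq: "p +++ q \<in> P x z"
        using that by (auto simp: P_def path_image_join)
      then show "P x z \<noteq> {}" by blast
      show "path_class (top_of_set S) (p +++ q) = P x z"
        using cls[of "p +++ q"] pq by (auto simp: P_def)
    qed
    note pq = this
    have "Comp ?G (P y z) (P x y) = (\<Union>q\<in>P y z. \<Union>p\<in>P x y. path_class (top_of_set S) (p +++ q))"
      by (simp only: fundamental_groupoid_def groupoid.select_convs join)
    also have "\<dots> = (\<Union>q\<in>P y z. \<Union>p\<in>P x y. P x z)"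
      using pq(1) by (intro SUP_cong refl)
    also have "\<dots> = P x z"
      using ne by simp
    finally show ?thesis
      using pq(2) ne by blast
  qed
  have Comp_in: "Comp ?G g f \<in> Hom ?G x z" if "f \<in> Hom ?G x y" "g \<in> Hom ?G y z" for x y z f g
    using that Comp[of x y z] by (auto simp: Hom split: if_splits)
  show thin: "thin ?G"
    by (auto simp: thin_def Hom)
  have eq: "f = g" if "f \<in> Hom ?G x y" "g \<in> Hom ?G x y" for x y f g
    using that by (auto simp: Hom split: if_splits)
  show "groupoid ?G"
  proof
    fix x y f assume xy: "x \<in> Obj ?G" "y \<in> Obj ?G" "f \<in> Hom ?G x y"
    then obtain p where p: "p \<in> P x y"
      by (auto simp: Hom split: if_splits)
    then have "reversepath p \<in> P y x"
      by (auto simp: P_def)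
    then have r: "P y x \<in> Hom ?G y x"
      by (auto simp: Hom)
    show "\<exists>g\<in>Hom ?G y x. Comp ?G g f = Ident ?G x \<and> Comp ?G f g = Ident ?G y"
      using r Ident xy Comp_in eq unfolding Obj by metis
  next
    fix x y x' y' f
    assume "f \<in> Hom ?G x y" "f \<in> Hom ?G x' y'"
    then show "x = x' \<and> y = y'"
      by (auto simp: Hom P_def split: if_splits)
  next
    fix x y f assume "x \<in> Obj ?G" "y \<in> Obj ?G" "f \<in> Hom ?G x y"
    then show "Comp ?G f (Ident ?G x) = f" "Comp ?G (Ident ?G y) f = f"
      using Ident(2) Comp_in eq unfolding Obj by metis+
  next
    fix w x y z f g h
    assume f: "f \<in> Hom ?G w x" and g: "g \<in> Hom ?G x y" and h: "h \<in> Hom ?G y z"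
    show "Comp ?G h (Comp ?G g f) = Comp ?G (Comp ?G h g) f"
      by (rule eq[OF Comp_in[OF Comp_in[OF f g] h] Comp_in[OF f Comp_in[OF g h]]])
  next
    show "Ident ?G x \<in> Hom ?G x x" if "x \<in> Obj ?G" for x
      using Ident(2) that by (simp only: Obj)
    show "Comp ?G g f \<in> Hom ?G x z" if "f \<in> Hom ?G x y" "g \<in> Hom ?G y z" for x y z f g
      using that by (rule Comp_in)
  qed
qed

text \<open>The interval is connected, and connected subsets of a discrete space have at most one
  point.\<close>

lemma path_constant_discrete:
  assumes "path p" "path_image p \<subseteq> S" "continuous_map (top_of_set S) (discrete_topology D) r"
    "s \<in> {0..1}" "t \<in> {0..1}"
  shows "r (p s) = r (p t)"
proof -
  have "continuous_map (top_of_set {0..1}) (discrete_topology D) (r \<circ> p)"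
    by (rule continuous_map_compose[of _ "top_of_set S"])
      (use assms in \<open>auto simp: path_def path_image_def\<close>)
  then have "connectedin (discrete_topology D) ((r \<circ> p) ` {0..1})"
    by (rule connectedin_continuous_map_image) (simp add: connectedin_subtopology)
  then obtain a where "(r \<circ> p) ` {0..1} \<subseteq> {a}"
    by (auto simp: connectedin_discrete_topology)
  then have "r (p s) = a" "r (p t) = a"
    using assms(4,5) by (auto simp: image_subset_iff)
  then show ?thesis by simp
qed

text \<open>The homotopy from \<open>i \<circ> r\<close> to the identity makes any two paths with
  common endpoints homotopic. The fundamental groupoid is therefore thin, and an equivalence is
  determined by its maps on objects.\<close>

lemma fundamental_groupoid_equivalent_discrete:
  fixes S :: "'a::topological_space set"
  assumes hom: "top_of_set S homotopy_equivalent_space discrete_topology D"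
    and H: "groupoid H" "thin H" "\<And>x y. \<lbrakk>x \<in> Obj H; y \<in> Obj H; Hom H x y \<noteq> {}\<rbrakk> \<Longrightarrow> x = y"
    and bij: "bij_betw \<phi> D (Obj H)"
  shows "groupoid_equivalent (fundamental_groupoid (top_of_set S)) H"
proof -
  let ?G = "fundamental_groupoid (top_of_set S)"
  obtain r i where r: "continuous_map (top_of_set S) (discrete_topology D) r"
    and i: "continuous_map (discrete_topology D) (top_of_set S) i"
    and ir: "homotopic_with (\<lambda>x. True) (top_of_set S) (top_of_set S) (i \<circ> r) id"
    and ri: "homotopic_with (\<lambda>x. True) (discrete_topology D) (discrete_topology D) (r \<circ> i) id"
    using hom unfolding homotopy_equivalent_space_def by blast
  have rD: "r x \<in> D" if "x \<in> S" for x
    using r that by (auto simp: continuous_map_def)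
  have iS: "i d \<in> S" if "d \<in> D" for d
    using i that by (auto simp: continuous_map_def)
  obtain h where h: "continuous_on ({0..1::real} \<times> S) h" "h ` ({0..1} \<times> S) \<subseteq> S"
      "\<And>x. h (0, x) = i (r x)" "\<And>x. h (1, x) = x"
    using ir by (auto simp: homotopic_with_def image_subset_iff)
  have uniq: "homotopic_paths S p q"
    if p: "path p" "path_image p \<subseteq> S" and q: "path q" "path_image q \<subseteq> S"
      and pq: "pathstart p = pathstart q" "pathfinish p = pathfinish q" for p q
  proof -
    txt \<open>The homotopy \<open>h\<close> along \<open>p\<close> is a map of the unit square that is constant on its left side
      and is \<open>p\<close> on its right side; on the other two sides it only depends on the end points of \<open>p\<close>.\<close>
    let ?A = "linepath (1::real, 0::real) (1, 1)"
      and ?B = "linepath (1::real, 0::real) (0, 0) +++ linepath (0, 0) (0, 1) +++ linepath (0, 1) (1, 1)"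
      and ?Q = "\<lambda>p. \<lambda>(s, t). h (s, p t)"
    have convex: "convex ({0..1::real} \<times> {0..1::real})"
      by (intro convex_Times) auto
    have B: "path_image ?B \<subseteq> {0..1} \<times> {0..1} \<inter> {(s, t). s = 0 \<or> t = 0 \<or> t = 1}"
      by (auto simp: path_image_join closed_segment_def)
    have AB: "homotopic_paths ({0..1} \<times> {0..1}) ?A ?B"
    proof (rule homotopic_paths_linear)
      show "closed_segment (?A t) (?B t) \<subseteq> {0..1} \<times> {0..1}" if "t \<in> {0..1}" for t
      proof (rule closed_segment_subset[OF _ _ convex])
        show "?A t \<in> {0..1} \<times> {0..1}"
          using that by (auto simp: linepath_def)
        show "?B t \<in> {0..1} \<times> {0..1}"
          using B that unfolding path_image_def by blast
      qed
    qed auto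
    have homQ: "homotopic_paths S p (?Q p \<circ> ?B)" if p: "path p" "path_image p \<subseteq> S" for p
    proof -
      have "homotopic_paths S (?Q p \<circ> ?A) (?Q p \<circ> ?B)"
      proof (rule homotopic_paths_continuous_image[OF AB])
        have pS: "p t \<in> S" if "t \<in> {0..1}" for t
          using p(2) that unfolding path_image_def by blast
        then show "?Q p \<in> {0..1} \<times> {0..1} \<rightarrow> S"
          using h(2) by auto
        show "continuous_on ({0..1} \<times> {0..1}) (?Q p)"
          unfolding case_prod_beta
          by (rule continuous_on_compose2[OF h(1)])
            (use p(1) pS in \<open>auto simp: path_def intro!: continuous_intros continuous_on_compose2[of _ p _ snd]\<close>)
      qed
      moreover have "homotopic_paths S p (?Q p \<circ> ?A)"
        by (rule homotopic_paths_eq[OF p]) (simp add: linepath_def h(4))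
      ultimately show ?thesis
        by (rule homotopic_paths_trans[rotated])
    qed
    have "?Q p (?B t) = ?Q q (?B t)" if t: "t \<in> {0..1}" for t
    proof -
      obtain s u where su: "?B t = (s, u)"
        by (cases "?B t")
      have "?B t \<in> path_image ?B"
        using t unfolding path_image_def by (rule imageI)
      then have "u \<in> {0..1}" "s = 0 \<or> u = 0 \<or> u = 1"
        using B su by auto
      then show ?thesis
        using path_constant_discrete[OF p r, of u 0] path_constant_discrete[OF q r, of u 0] pq
        by (auto simp: su h(3) pathstart_def pathfinish_def)
    qed
    then have "homotopic_paths S (?Q p \<circ> ?B) (?Q q \<circ> ?B)"
      using homotopic_paths_imp_path[OF homQ[OF p]] homotopic_paths_imp_subset[OF homQ[OF p]]
      by (intro homotopic_paths_eq) simp_all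
    then show ?thesis
      using homQ[OF p] homQ[OF q] homotopic_paths_trans homotopic_paths_sym by meson
  qed
  have Hom_ne: "Hom ?G x y \<noteq> {}" if "path p" "path_image p \<subseteq> S" "pathstart p = x" "pathfinish p = y" for x y p
    using that by (auto simp: fundamental_groupoid_def pathin_top_of_set pathstart_def pathfinish_def)
  have G: "groupoid ?G" "thin ?G"
    by (rule fundamental_groupoid_thin, rule uniq, assumption+)+
  have Obj: "Obj ?G = S"
    by (simp add: fundamental_groupoid_def)
  have Hom_r: "r x = r y" if "Hom ?G x y \<noteq> {}" for x y
  proof -
    obtain p where "path p" "path_image p \<subseteq> S" "p 0 = x" "p 1 = y"
      using \<open>Hom ?G x y \<noteq> {}\<close>
      unfolding fundamental_groupoid_def pathin_top_of_set groupoid.select_convs by blast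
    then show ?thesis
      using path_constant_discrete[OF _ _ r, of p 0 1] by auto
  qed
  have ident: "Hom ?G x x \<noteq> {}" if "x \<in> S" for x
    using groupoid.Ident_Hom[OF G(1), of x] that by (metis Obj empty_iff)
  \<comment> \<open>A homotopy into a discrete space is constant in time, so
    \<open>r \<circ> i\<close> equals the identity on \<open>D\<close> and is not merely homotopic
    to it.\<close>
  have ri_id: "r (i d) = d" if d: "d \<in> D" for d
  proof -
    obtain k where k: "continuous_map (prod_topology (top_of_set {0..1::real}) (discrete_topology D))
        (discrete_topology D) k" "\<And>x. k (0, x) = r (i x)" "\<And>x. k (1, x) = x"
      using ri by (auto simp: homotopic_with_def)
    have "continuous_map (top_of_set {0..1}) (discrete_topology D) (k \<circ> (\<lambda>t. (t, d)))"
      by (rule continuous_map_compose[OF _ k(1)]) (use d in \<open>auto simp: continuous_map_pairwise comp_def\<close>)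
    then have "connectedin (discrete_topology D) ((k \<circ> (\<lambda>t. (t, d))) ` {0..1})"
      by (rule connectedin_continuous_map_image) (simp add: connectedin_subtopology)
    then obtain a where "(k \<circ> (\<lambda>t. (t, d))) ` {0..1} \<subseteq> {a}"
      by (auto simp: connectedin_discrete_topology)
    then have "k (0, d) = a" "k (1, d) = a"
      by (auto simp: image_subset_iff)
    then have "k (0, d) = k (1, d)" by simp
    then show ?thesis by (simp add: k)
  qed
  let ?\<psi> = "inv_into D \<phi>"
  have \<psi>: "?\<psi> y \<in> D" "\<phi> (?\<psi> y) = y" if "y \<in> Obj H" for y
    using bij that by (auto simp: bij_betw_def inv_into_into f_inv_into_f)
  have \<phi>: "\<phi> d \<in> Obj H" "?\<psi> (\<phi> d) = d" if "d \<in> D" for d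
    using bij that by (auto simp: bij_betw_def)
  show ?thesis
  proof (rule thin_groupoids_equivalent[OF G H(1,2), of "\<lambda>x. \<phi> (r x)" "\<lambda>y. i (?\<psi> y)"])
    show "\<phi> (r x) \<in> Obj H" if "x \<in> Obj ?G" for x
      using that \<phi> rD by (simp add: Obj)
    show "i (?\<psi> y) \<in> Obj ?G" if "y \<in> Obj H" for y
      using that \<psi> iS by (simp add: Obj)
    show "Hom H (\<phi> (r x)) (\<phi> (r y)) \<noteq> {}" if "x \<in> Obj ?G" "y \<in> Obj ?G" "Hom ?G x y \<noteq> {}" for x y
      using Hom_r[OF that(3)] groupoid.Ident_Hom[OF H(1) \<phi>(1)[OF rD[of y]]] that(2) by (auto simp: Obj)
    show "Hom ?G (i (?\<psi> x)) (i (?\<psi> y)) \<noteq> {}" if "x \<in> Obj H" "y \<in> Obj H" "Hom H x y \<noteq> {}" for x y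
      using H(3)[OF that] ident iS \<psi> that by simp
    show "Hom ?G (i (?\<psi> (\<phi> (r x)))) x \<noteq> {}" if "x \<in> Obj ?G" for x
    proof -
      have x: "x \<in> S" using that by (simp add: Obj)
      have "continuous_on {0..1} (\<lambda>t. h (t, x))"
        by (rule continuous_on_compose2[OF h(1)]) (use x in \<open>auto intro!: continuous_intros\<close>)
      then have "Hom ?G (i (r x)) x \<noteq> {}"
        using h x by (intro Hom_ne[of "\<lambda>t. h (t, x)"])
          (auto simp: path_def path_image_def pathstart_def pathfinish_def)
      then show ?thesis
        using \<phi> rD x by simp
    qed
    show "Hom H (\<phi> (r (i (?\<psi> y)))) y \<noteq> {}" if "y \<in> Obj H" for y
      using that \<psi>[OF that] ri_id groupoid.Ident_Hom[OF H(1) that] by auto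
  qed
qed

section \<open>Real-valued homomorphisms and quotients\<close>

lemma binoid_hom_real_iff:
  "f \<in> binoid_hom M real_binoid \<longleftrightarrow> f \<in> extensional (carrier M) \<and>
     (\<forall>x\<in>carrier M. \<forall>y\<in>carrier M. f (x \<otimes>\<^bsub>M\<^esub> y) = f x * f y) \<and> f \<one>\<^bsub>M\<^esub> = 1 \<and> f (absorb M) = 0"
  by (auto simp: binoid_hom_def real_binoid_def hom_def)

lemma binoid_hom_realD:
  assumes "f \<in> binoid_hom M real_binoid"
  shows "f \<one>\<^bsub>M\<^esub> = 1" "f (absorb M) = 0"
    "\<lbrakk>x \<in> carrier M; y \<in> carrier M\<rbrakk> \<Longrightarrow> f (x \<otimes>\<^bsub>M\<^esub> y) = f x * f y"
    "x \<notin> carrier M \<Longrightarrow> f x = undefined"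
  using assms by (auto simp: binoid_hom_real_iff extensional_def)

lemma binoid_hom_real_eqI:
  assumes "f \<in> binoid_hom M real_binoid" "g \<in> binoid_hom M real_binoid"
    "\<And>x. x \<in> carrier M \<Longrightarrow> f x = g x"
  shows "f = g"
  using assms by (auto simp: binoid_hom_real_iff intro: extensionalityI)

lemma comm_binoidI:
  fixes M (structure)
  assumes "\<And>x y. \<lbrakk>x \<in> carrier M; y \<in> carrier M\<rbrakk> \<Longrightarrow> x \<otimes> y \<in> carrier M"
    and "\<one> \<in> carrier M" and "absorb M \<in> carrier M"
    and "\<And>x y z. \<lbrakk>x \<in> carrier M; y \<in> carrier M; z \<in> carrier M\<rbrakk> \<Longrightarrow> (x \<otimes> y) \<otimes> z = x \<otimes> (y \<otimes> z)"
    and "\<And>x y. \<lbrakk>x \<in> carrier M; y \<in> carrier M\<rbrakk> \<Longrightarrow> x \<otimes> y = y \<otimes> x"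
    and "\<And>x. x \<in> carrier M \<Longrightarrow> \<one> \<otimes> x = x"
    and "\<And>x. x \<in> carrier M \<Longrightarrow> x \<otimes> absorb M = absorb M"
  shows "comm_binoid M"
proof -
  interpret comm_monoid M
    by (rule comm_monoidI) (use assms in auto)
  show ?thesis
    by unfold_locales (use assms in auto)
qed

lemma comm_binoid_units_binoid:
  assumes "comm_binoid N"
  shows "comm_binoid (units_binoid N)"
proof -
  interpret comm_binoid N by fact
  have 0: "absorb N \<otimes>\<^bsub>N\<^esub> x = absorb N" if "x \<in> carrier N" for x
    using that absorb_mult absorb_closed m_comm by simp
  have sub: "insert (absorb N) (Units N) \<subseteq> carrier N"
    using absorb_closed by auto
  show ?thesis
    unfolding units_binoid_def
  proof (rule comm_binoidI, goal_cases)
    case (1 x y)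
    then show ?case
      using 0 absorb_mult Units_m_closed sub by auto
  next
    case (4 x y z)
    then have "x \<in> carrier N" "y \<in> carrier N" "z \<in> carrier N" using sub by auto
    then show ?case by (simp add: m_assoc)
  next
    case (5 x y)
    then have "x \<in> carrier N" "y \<in> carrier N" using sub by auto
    then show ?case by (simp add: m_comm)
  next
    case (6 x)
    then show ?case using sub by auto
  next
    case (7 x)
    then show ?case using sub absorb_mult by auto
  qed simp_all
qed

section \<open>Quotients by generated congruences\<close>

lemma binoid_congruence_generated:
  assumes "comm_binoid M" "S \<subseteq> carrier M \<times> carrier M"
  shows "binoid_congruence M (generated_congruence M S)" "S \<subseteq> generated_congruence M S"
proof -
  interpret comm_binoid M by fact
  let ?\<R> = "{R. binoid_congruence M R \<and> S \<subseteq> R}"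
  have "binoid_congruence M (carrier M \<times> carrier M)"
    unfolding binoid_congruence_def equiv_def refl_on_def sym_def trans_def by auto
  \<comment> \<open>The total relation belongs to the family, so the intersection is a relation on
    the carrier.\<close>
  then have tot: "carrier M \<times> carrier M \<in> ?\<R>"
    using assms(2) by simp
  have *: "R \<subseteq> carrier M \<times> carrier M" "refl_on (carrier M) R" "sym R" "trans R" if "R \<in> ?\<R>" for R
    using that by (auto simp: binoid_congruence_def equiv_def)
  have "refl_on (carrier M) (\<Inter> ?\<R>)"
    using * by (simp add: refl_on_def)
  moreover have "\<Inter> ?\<R> \<subseteq> carrier M \<times> carrier M"
    using tot by blast
  moreover have "sym (\<Inter> ?\<R>)"
    by (rule symI) (use * in \<open>meson InterE InterI symD\<close>)
  moreover have "trans (\<Inter> ?\<R>)"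
    by (rule transI) (use * in \<open>meson InterE InterI transD\<close>)
  ultimately have "equiv (carrier M) (\<Inter> ?\<R>)"
    by (simp add: equiv_def)
  then show "binoid_congruence M (generated_congruence M S)"
    unfolding generated_congruence_def binoid_congruence_def[of M "\<Inter> ?\<R>"]
    by (simp add: binoid_congruence_def)
  show "S \<subseteq> generated_congruence M S"
    by (auto simp: generated_congruence_def)
qed

text \<open>The kernel relation of \<open>f\<close> is a congruence containing \<open>S\<close>, so
  it contains the generated one.\<close>

lemma binoid_hom_respects_generated:
  assumes M: "comm_binoid M" and f: "f \<in> binoid_hom M real_binoid"
    and S: "S \<subseteq> carrier M \<times> carrier M" "\<And>x y. (x, y) \<in> S \<Longrightarrow> f x = f y"
    and xy: "(x, y) \<in> generated_congruence M S"
  shows "f x = f y"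
proof -
  interpret comm_binoid M by fact
  let ?R = "{(x, y). x \<in> carrier M \<and> y \<in> carrier M \<and> f x = f y}"
  have "binoid_congruence M ?R"
    unfolding binoid_congruence_def equiv_def refl_on_def sym_def trans_def
    using binoid_hom_realD(3)[OF f] by auto
  moreover have "S \<subseteq> ?R"
    using S by auto
  ultimately show ?thesis
    using xy unfolding generated_congruence_def by blast
qed

text \<open>Instantiated twice below: for \<open>adm_quotient\<close> and for
  \<open>tensor_C2\<close> of its units.\<close>

locale binoid_quot = comm_binoid M for M :: "'a binoid" (structure) +
  fixes S
  assumes rel: "S \<subseteq> carrier M \<times> carrier M"
begin

abbreviation "R \<equiv> generated_congruence M S"
abbreviation "Q \<equiv> binoid_quotient M R"
definition cls where "cls x = R `` {x}"

lemma M: "comm_binoid M" by unfold_locales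

lemma equiv: "equiv (carrier M) R" and
  cong: "\<lbrakk>(x, y) \<in> R; z \<in> carrier M\<rbrakk> \<Longrightarrow> (x \<otimes> z, y \<otimes> z) \<in> R"
  using binoid_congruence_generated(1)[OF M rel] by (auto simp: binoid_congruence_def)

lemma R_carrier: "(x, y) \<in> R \<Longrightarrow> x \<in> carrier M \<and> y \<in> carrier M"
  using equiv by (auto simp: equiv_def)

lemma cls_eq_iff: "\<lbrakk>x \<in> carrier M; y \<in> carrier M\<rbrakk> \<Longrightarrow> cls x = cls y \<longleftrightarrow> (x, y) \<in> R"
  unfolding cls_def using eq_equiv_class_iff[OF equiv] by blast

lemma cls_eq_rel: "(x, y) \<in> S \<Longrightarrow> cls x = cls y"
  using binoid_congruence_generated(2)[OF M rel] rel cls_eq_iff by blast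

lemma carrier_quot: "carrier Q = cls ` carrier M"
  by (auto simp: binoid_quotient_def cls_def quotient_def)

lemma cls_closed: "x \<in> carrier M \<Longrightarrow> cls x \<in> carrier Q"
  by (simp add: carrier_quot)

lemma one_quot: "\<one>\<^bsub>Q\<^esub> = cls \<one>" and absorb_quot: "absorb Q = cls (absorb M)"
  by (simp_all add: binoid_quotient_def cls_def)

text \<open>The product in the quotient is a union over representatives. All members of this union
  coincide, and the classes over which it ranges are nonempty.\<close>

lemma mult_quot:
  assumes "x \<in> carrier M" "y \<in> carrier M"
  shows "cls x \<otimes>\<^bsub>Q\<^esub> cls y = cls (x \<otimes> y)"
proof -
  have "cls (a \<otimes> b) = cls (x \<otimes> y)" if "a \<in> cls x" "b \<in> cls y" for a b
  proof -
    have ab: "(x, a) \<in> R" "(y, b) \<in> R" "a \<in> carrier M" "b \<in> carrier M"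
      using that R_carrier by (auto simp: cls_def)
    have "(x \<otimes> y, a \<otimes> y) \<in> R" "(y \<otimes> a, b \<otimes> a) \<in> R"
      using cong ab assms by auto
    then have "(x \<otimes> y, a \<otimes> y) \<in> R" "(a \<otimes> y, a \<otimes> b) \<in> R"
      using ab assms by (simp_all add: m_comm)
    then have "(x \<otimes> y, a \<otimes> b) \<in> R"
      using equiv by (meson equivE transD)
    then show ?thesis
      using cls_eq_iff[of "x \<otimes> y" "a \<otimes> b"] ab assms by simp
  qed
  moreover have "x \<in> cls x" "y \<in> cls y"
    using assms equiv by (auto simp: cls_def equiv_def refl_on_def)
  ultimately show ?thesis
    unfolding binoid_quotient_def monoid.simps partial_object.simps cls_def[symmetric] by blast
qed

lemma comm_binoid_quot: "comm_binoid Q"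
  by (rule comm_binoidI)
    (auto simp: carrier_quot one_quot absorb_quot mult_quot absorb_closed absorb_mult m_ac)

lemma binoid_hom_factor:
  assumes f: "f \<in> binoid_hom M real_binoid" and S: "\<And>x y. (x, y) \<in> S \<Longrightarrow> f x = f y"
  obtains h where "h \<in> binoid_hom Q real_binoid" "\<And>x. x \<in> carrier M \<Longrightarrow> h (cls x) = f x"
proof -
  let ?h = "\<lambda>X\<in>carrier Q. f (SOME x. x \<in> carrier M \<and> X = cls x)"
  have h: "?h (cls x) = f x" if x: "x \<in> carrier M" for x
  proof -
    let ?y = "SOME y. y \<in> carrier M \<and> cls x = cls y"
    have "?y \<in> carrier M \<and> cls x = cls ?y"
      by (rule someI[of _ x]) (use x in auto)
    then have "(x, ?y) \<in> R"
      using cls_eq_iff[OF x] by blast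
    then have "f x = f ?y"
      by (rule binoid_hom_respects_generated[OF M f rel S, rotated])
    then show ?thesis
      using x by (simp add: cls_closed)
  qed
  have "?h \<in> binoid_hom Q real_binoid"
    unfolding binoid_hom_real_iff
  proof (intro conjI ballI)
    show "?h \<one>\<^bsub>Q\<^esub> = 1" "?h (absorb Q) = 0"
      unfolding one_quot absorb_quot
      using h[OF one_closed] h[OF absorb_closed] binoid_hom_realD(1,2)[OF f] by auto
    fix X Y assume "X \<in> carrier Q" "Y \<in> carrier Q"
    then obtain x y where xy: "x \<in> carrier M" "y \<in> carrier M" "X = cls x" "Y = cls y"
      by (auto simp: carrier_quot)
    then show "?h (X \<otimes>\<^bsub>Q\<^esub> Y) = ?h X * ?h Y"
      unfolding xy(3,4) mult_quot[OF xy(1,2)]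
      using h[OF xy(1)] h[OF xy(2)] h[OF m_closed[OF xy(1,2)]] binoid_hom_realD(3)[OF f xy(1,2)] by simp
  qed simp
  then show ?thesis
    using h by (rule that)
qed

end

section \<open>Characters of elementary abelian 2-groups\<close>

text \<open>Apart from the absorbing element this is a vector space over the field with two
  elements; generation, independence and characters below are linear algebra in this sense.\<close>

locale elementary_binoid = comm_binoid T for T :: "'a binoid" (structure) +
  assumes nontrivial: "absorb T \<noteq> \<one>"
    and square: "\<lbrakk>x \<in> carrier T; x \<noteq> absorb T\<rbrakk> \<Longrightarrow> x \<otimes> x = \<one>"
begin

abbreviation "E \<equiv> nonzero_group T"

lemma E_simps [simp]: "carrier E = carrier T - {absorb T}" "x \<otimes>\<^bsub>E\<^esub> y = x \<otimes> y" "\<one>\<^bsub>E\<^esub> = \<one>"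
  by (simp_all add: nonzero_group_def)

lemma mult_nonzero:
  assumes "x \<in> carrier T" "y \<in> carrier T" "x \<noteq> absorb T" "y \<noteq> absorb T"
  shows "x \<otimes> y \<noteq> absorb T"
proof
  assume "x \<otimes> y = absorb T"
  then have "x \<otimes> (x \<otimes> y) = absorb T"
    using assms absorb_mult by simp
  moreover have "x \<otimes> (x \<otimes> y) = y"
    using assms square[of x] by (simp add: m_assoc[symmetric])
  ultimately show False
    using assms by simp
qed

lemma comm_group_E: "comm_group E"
  by (rule comm_groupI) (use nontrivial square in \<open>auto simp: mult_nonzero m_ac\<close>)

lemma inv_E:
  assumes "x \<in> carrier E"
  shows "inv\<^bsub>E\<^esub> x = x"
proof -
  interpret E: comm_group E by (rule comm_group_E)
  show ?thesis
    by (rule E.inv_equality) (use assms square in auto)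
qed

abbreviation prd where "prd A \<equiv> finprod T (\<lambda>x. x) A"

lemma prd_closed: "A \<subseteq> carrier E \<Longrightarrow> prd A \<in> carrier T"
  by (rule finprod_closed) auto

lemma prd_Un:
  assumes "finite A" "finite B" "A \<inter> B = {}" "A \<subseteq> carrier E" "B \<subseteq> carrier E"
  shows "prd (A \<union> B) = prd A \<otimes> prd B"
  by (rule finprod_Un_disjoint) (use assms in auto)

lemma prd_nonzero:
  assumes "finite A" "A \<subseteq> carrier E"
  shows "prd A \<noteq> absorb T"
  using assms
proof (induction A)
  case (insert x A)
  then have "prd (insert x A) = x \<otimes> prd A"
    by (intro finprod_insert) auto
  then show ?case
    using insert mult_nonzero[of x "prd A"] prd_closed[of A] by auto
qed (use nontrivial in auto)

text \<open>Factors in the intersection occur squared and cancel. With subsets read as 0-1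
  coefficient vectors, the symmetric difference is their sum.\<close>

lemma prd_symdiff:
  assumes "finite A" "finite B" "A \<subseteq> carrier E" "B \<subseteq> carrier E"
  shows "prd A \<otimes> prd B = prd (sym_diff A B)"
proof -
  have sub: "A - B \<subseteq> carrier E" "B - A \<subseteq> carrier E" "A \<inter> B \<subseteq> carrier E"
    using assms by auto
  note cl = sub[THEN prd_closed]
  have "prd A = prd (A - B) \<otimes> prd (A \<inter> B)"
    using prd_Un[of "A - B" "A \<inter> B"] assms(1,2) sub by (simp add: Un_Diff_Int Diff_Int_distrib2)
  moreover have "prd B = prd (A \<inter> B) \<otimes> prd (B - A)"
  proof -
    have "A \<inter> B \<inter> (B - A) = {}" "A \<inter> B \<union> (B - A) = B" by auto
    then show ?thesis
      using prd_Un[of "A \<inter> B" "B - A"] assms(1,2) sub by simp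
  qed
  ultimately have "prd A \<otimes> prd B = prd (A - B) \<otimes> (prd (A \<inter> B) \<otimes> prd (A \<inter> B)) \<otimes> prd (B - A)"
    using cl by (simp add: m_assoc)
  also have "prd (A \<inter> B) \<otimes> prd (A \<inter> B) = \<one>"
    using square prd_nonzero cl sub assms by auto
  moreover have "(A - B) \<inter> (B - A) = {}" by auto
  ultimately show ?thesis
    using prd_Un[of "A - B" "B - A"] assms sub cl by simp
qed

text \<open>Elements are their own inverses and squares are trivial, so every word in
  \<open>S\<close> reduces to a product over a subset.\<close>

lemma generate_eq_prd:
  assumes "finite S" "S \<subseteq> carrier E"
  shows "generate E S = prd ` Pow S"
proof
  show "generate E S \<subseteq> prd ` Pow S"
  proof
    fix x assume "x \<in> generate E S"
    then show "x \<in> prd ` Pow S"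
    proof induction
      case one
      then show ?case by (auto intro!: image_eqI[of _ _ "{}"])
    next
      case (incl h)
      moreover from this have "prd {h} = h"
        using assms by (subst finprod_insert) auto
      ultimately show ?case by (auto intro!: image_eqI[of _ _ "{h}"])
    next
      case (inv h)
      moreover from this have "prd {h} = h"
        using assms by (subst finprod_insert) auto
      moreover have "inv\<^bsub>E\<^esub> h = h"
        using inv assms by (intro inv_E) auto
      ultimately show ?case by (auto intro!: image_eqI[of _ _ "{h}"])
    next
      case (eng x y)
      then obtain A B where AB: "A \<subseteq> S" "B \<subseteq> S" "x = prd A" "y = prd B" by auto
      then have "finite A" "finite B" "A \<subseteq> carrier E" "B \<subseteq> carrier E"
        using assms finite_subset by auto
      then have "x \<otimes>\<^bsub>E\<^esub> y = prd (sym_diff A B)"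
        using prd_symdiff AB by simp
      then show ?case
        using AB by (intro image_eqI[of _ _ "sym_diff A B"]) auto
    qed
  qed
  have "prd A \<in> generate E S" if "A \<subseteq> S" for A
  proof -
    have "finite A" using that assms finite_subset by blast
    then show ?thesis using that
    proof (induction A)
      case empty
      show ?case using generate.one[of E S] by simp
    next
      case (insert x A)
      then have "prd (insert x A) = x \<otimes>\<^bsub>E\<^esub> prd A"
        using assms by (subst finprod_insert) auto
      moreover have "x \<in> generate E S"
        using insert generate.incl by fastforce
      ultimately show ?case
        using insert generate.eng[of x E S "prd A"] by simp
    qed
  qed
  then show "prd ` Pow S \<subseteq> generate E S" by blast
qed

text \<open>If two subsets have equal products, their symmetric difference has product one; any
  \<open>s\<close> in it would be the product of the other members, against independence.\<close>

lemma prd_inj: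
  assumes S: "finite S" "S \<subseteq> carrier E" and indep: "\<And>s. s \<in> S \<Longrightarrow> s \<notin> generate E (S - {s})"
  shows "inj_on prd (Pow S)"
proof (rule inj_onI)
  fix A B assume AB: "A \<in> Pow S" "B \<in> Pow S" and eq: "prd A = prd B"
  have fin: "finite A" "finite B" "A \<subseteq> carrier E" "B \<subseteq> carrier E"
    using AB S finite_subset by auto
  have "prd (sym_diff A B) = prd B \<otimes> prd B"
    using prd_symdiff[OF fin] eq by simp
  also have "\<dots> = \<one>"
    using square prd_nonzero prd_closed fin by auto
  finally have one: "prd (sym_diff A B) = \<one>" .
  have "False" if s: "s \<in> sym_diff A B" for s
  proof -
    let ?D = "sym_diff A B - {s}"
    have D: "?D \<subseteq> S - {s}" "finite ?D" "?D \<subseteq> carrier E" "s \<in> carrier E" "s \<in> S"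
      using AB S fin s by auto
    have "insert s ?D = sym_diff A B" using s by auto
    then have "s \<otimes> prd ?D = \<one>"
      using one finprod_insert[of ?D s "\<lambda>x. x"] D(2-4) by (simp add: Pi_def subset_iff)
    then have "s \<otimes> (s \<otimes> prd ?D) = s"
      using D by auto
    moreover have "s \<otimes> (s \<otimes> prd ?D) = prd ?D"
      using square[of s] prd_closed[OF D(3)] D(4) by (simp add: m_assoc[symmetric])
    ultimately have "s = prd ?D" by simp
    moreover have "prd ?D \<in> generate E (S - {s})"
      using generate_eq_prd[of "S - {s}"] S D(1) by auto
    ultimately show False
      using indep[OF D(5)] by simp
  qed
  then show "A = B" by blast
qed

text \<open>\<open>S\<close> is a basis, and a character amounts to a free choice of signs on a
  basis.\<close>

lemma card_characters:
  assumes S: "finite S" "S \<subseteq> carrier E" "generate E S = carrier E"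
    and indep: "\<And>s. s \<in> S \<Longrightarrow> s \<notin> generate E (S - {s})"
  shows "finite (binoid_hom T real_binoid)" "card (binoid_hom T real_binoid) = 2 ^ card S"
proof -
  have onto: "prd ` Pow S = carrier E"
    using generate_eq_prd S by simp
  have fin: "finite A" "A \<subseteq> carrier E" "A \<subseteq> S" if "A \<in> Pow S" for A
    using that S finite_subset by auto
  have f_prd: "f (prd A) = (\<Prod>s\<in>A. f s)" if f: "f \<in> binoid_hom T real_binoid"
    and A: "finite A" "A \<subseteq> carrier E" for f A
    using A
  proof (induction A)
    case empty
    then show ?case using binoid_hom_realD(1)[OF f] by simp
  next
    case (insert x A)
    then have "prd (insert x A) = x \<otimes> prd A"
      by (subst finprod_insert) auto
    then show ?case
      using insert binoid_hom_realD(3)[OF f, of x "prd A"] prd_closed[of A] by simp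
  qed
  let ?res = "\<lambda>f. restrict f S"
  have bij: "bij_betw ?res (binoid_hom T real_binoid) (S \<rightarrow>\<^sub>E {1, -1})"
    unfolding bij_betw_def
  proof
    show "inj_on ?res (binoid_hom T real_binoid)"
    proof (rule inj_onI, rule binoid_hom_real_eqI)
      fix f g x
      assume f: "f \<in> binoid_hom T real_binoid" and g: "g \<in> binoid_hom T real_binoid"
        and eq: "?res f = ?res g" and x: "x \<in> carrier T"
      have eqS: "f s = g s" if "s \<in> S" for s
        using fun_cong[OF eq, of s] that by simp
      show "f x = g x"
      proof (cases "x = absorb T")
        case True
        then show ?thesis using binoid_hom_realD(2)[OF f] binoid_hom_realD(2)[OF g] by simp
      next
        case False
        then have "x \<in> prd ` Pow S" using x by (simp only: onto E_simps) simp
        then obtain A where A: "A \<in> Pow S" "x = prd A" by (rule imageE)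
        have "(\<Prod>s\<in>A. f s) = (\<Prod>s\<in>A. g s)"
          by (rule prod.cong) (use eqS A(1) in auto)
        then show ?thesis
          unfolding A(2) f_prd[OF f fin(1,2)[OF A(1)]] f_prd[OF g fin(1,2)[OF A(1)]] .
      qed
    qed
    show "?res ` binoid_hom T real_binoid = S \<rightarrow>\<^sub>E {1, -1}"
    proof (intro equalityI subsetI)
      fix \<sigma> assume "\<sigma> \<in> ?res ` binoid_hom T real_binoid"
      then obtain f where f: "f \<in> binoid_hom T real_binoid" "\<sigma> = ?res f" by auto
      have "f s \<in> {1, -1}" if "s \<in> S" for s
      proof -
        have "s \<in> carrier T" "s \<noteq> absorb T"
          using S(2) that by auto
        then have "f s * f s = 1"
          using binoid_hom_realD(3)[OF f(1), of s s] square[of s] binoid_hom_realD(1)[OF f(1)] by simp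
        then show ?thesis by (simp add: square_eq_1_iff)
      qed
      then show "\<sigma> \<in> S \<rightarrow>\<^sub>E {1, -1}" using f by auto
    next
      fix \<sigma> :: "'a \<Rightarrow> real" assume \<sigma>: "\<sigma> \<in> S \<rightarrow>\<^sub>E {1, -1}"
      \<comment> \<open>Each nonzero element has exactly one coefficient set \<open>?i x\<close>;
        the prescribed signs are multiplied over it.\<close>
      let ?i = "inv_into (Pow S) prd"
      have i: "?i (prd A) = A" if "A \<in> Pow S" for A
        using prd_inj[OF S(1,2) indep] that by simp
      let ?f = "\<lambda>x\<in>carrier T. if x = absorb T then 0 else \<Prod>s\<in>?i x. \<sigma> s"
      have f: "?f (prd A) = (\<Prod>s\<in>A. \<sigma> s)" if "A \<in> Pow S" for A
        using i[OF that] fin[OF that] prd_nonzero prd_closed by auto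
      have sq: "\<sigma> s * \<sigma> s = 1" if "s \<in> S" for s
        using \<sigma> that by (auto simp: PiE_iff)
      have hom: "?f \<in> binoid_hom T real_binoid"
        unfolding binoid_hom_real_iff
      proof (intro conjI ballI)
        show "?f \<one> = 1"
          using f[of "{}"] by simp
        show "?f (absorb T) = 0"
          by (simp add: absorb_closed)
        fix x y assume xy: "x \<in> carrier T" "y \<in> carrier T"
        show "?f (x \<otimes> y) = ?f x * ?f y"
        proof (cases "x = absorb T \<or> y = absorb T")
          case True
          then have "x \<otimes> y = absorb T"
            using xy absorb_mult m_comm by auto
          then show ?thesis using True by (auto simp: absorb_closed)
        next
          case False
          obtain A B where AB: "A \<in> Pow S" "B \<in> Pow S" "x = prd A" "y = prd B"
          proof -
            have "x \<in> prd ` Pow S" "y \<in> prd ` Pow S"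
              using xy False by (simp_all only: onto E_simps) simp_all
            then show ?thesis using that by (elim imageE) blast
          qed
          have "sym_diff A B \<in> Pow S" using AB by auto
          then have "?f (x \<otimes> y) = (\<Prod>s\<in>sym_diff A B. \<sigma> s)"
            using f prd_symdiff[OF fin(1)[OF AB(1)] fin(1)[OF AB(2)] fin(2)[OF AB(1)] fin(2)[OF AB(2)]] AB(3,4)
            by simp
          also have "\<dots> = (\<Prod>s\<in>A - B. \<sigma> s) * (\<Prod>s\<in>B - A. \<sigma> s)"
            by (rule prod.union_disjoint) (use fin AB in auto)
          \<comment> \<open>The signs over the intersection are inserted twice, and their squares
            are 1.\<close>
          also have "\<dots> = ((\<Prod>s\<in>A - B. \<sigma> s) * (\<Prod>s\<in>A \<inter> B. \<sigma> s)) * ((\<Prod>s\<in>A \<inter> B. \<sigma> s) * (\<Prod>s\<in>B - A. \<sigma> s))"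
          proof -
            have "(\<Prod>s\<in>A \<inter> B. \<sigma> s) * (\<Prod>s\<in>A \<inter> B. \<sigma> s) = (\<Prod>s\<in>A \<inter> B. \<sigma> s * \<sigma> s)"
              by (rule prod.distrib[symmetric])
            also have "\<dots> = 1"
              by (rule prod.neutral) (use sq AB in auto)
            finally show ?thesis by (metis (no_types) mult.assoc mult_1)
          qed
          also have "(\<Prod>s\<in>A - B. \<sigma> s) * (\<Prod>s\<in>A \<inter> B. \<sigma> s) = (\<Prod>s\<in>A. \<sigma> s)"
            using fin(1)[OF AB(1)] by (metis Int_commute mult.commute prod.Int_Diff)
          also have "(\<Prod>s\<in>A \<inter> B. \<sigma> s) * (\<Prod>s\<in>B - A. \<sigma> s) = (\<Prod>s\<in>B. \<sigma> s)"
            using fin(1)[OF AB(2)] by (metis Int_commute prod.Int_Diff)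
          finally show ?thesis
            using f AB by simp
        qed
      qed simp
      have "?res ?f = \<sigma>"
      proof (rule extensionalityI[of _ S])
        show "?res ?f s = \<sigma> s" if s: "s \<in> S" for s
        proof -
          have "prd {s} = s"
            using s S by (subst finprod_insert) auto
          then show ?thesis
            using f[of "{s}"] s by simp
        qed
      qed (use \<sigma> in \<open>auto simp: PiE_iff\<close>)
      then show "\<sigma> \<in> ?res ` binoid_hom T real_binoid"
        by (intro image_eqI[where f = ?res, OF _ hom]) (rule sym)
    qed
  qed
  show "finite (binoid_hom T real_binoid)"
    using bij_betw_finite[OF bij] S(1) by (simp add: finite_PiE)
  show "card (binoid_hom T real_binoid) = 2 ^ card S"
    using bij_betw_same_card[OF bij] S(1) by (simp add: card_PiE numeral_2_eq_2)
qed

text \<open>A finite generating set guarantees that the minimum in \<open>min_generators\<close> is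
  attained. A generating set of least size has no redundant member, so it is a basis.\<close>

lemma card_characters_min_generators:
  assumes "finite S" "S \<subseteq> carrier E" "generate E S = carrier E"
  shows "finite (binoid_hom T real_binoid)" "card (binoid_hom T real_binoid) = 2 ^ min_generators E"
proof -
  let ?P = "\<lambda>k. \<exists>S. S \<subseteq> carrier E \<and> finite S \<and> card S = k \<and> generate E S = carrier E"
  have "?P (card S)" using assms by blast
  then have "?P (min_generators E)"
    unfolding min_generators_def by (rule LeastI)
  then obtain S where S: "S \<subseteq> carrier E" "finite S" "card S = min_generators E" "generate E S = carrier E"
    by blast
  have indep: "s \<notin> generate E (S - {s})" if s: "s \<in> S" for s
  proof
    assume gen: "s \<in> generate E (S - {s})"
    interpret E: comm_group E by (rule comm_group_E)
    have "S \<subseteq> generate E (S - {s})"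
      using gen generate.incl[of _ "S - {s}" E] by blast
    then have "generate E S \<subseteq> generate E (S - {s})"
      using S(1) E.generate_subgroup_incl[of S] E.generate_is_subgroup[of "S - {s}"] by blast
    then have "generate E (S - {s}) = carrier E"
      using S E.generate_incl[of "S - {s}"] by blast
    then have "?P (card (S - {s}))"
      using S(1,2) by blast
    then have "min_generators E \<le> card (S - {s})"
      unfolding min_generators_def by (rule Least_le)
    then show False
      using S(2,3) s by (metis card_Diff1_less leD)
  qed
  show "finite (binoid_hom T real_binoid)" "card (binoid_hom T real_binoid) = 2 ^ min_generators E"
    using card_characters[OF S(2,1,4) indep] S(3) by auto
qed

end

section \<open>Faces and idempotents\<close>

locale fg_binoid = comm_binoid M for M :: "'a binoid" (structure) +
  fixes es :: "'a list"
  assumes gen: "generated_by M es"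
begin

lemma es_carrier: "set es \<subseteq> carrier M"
  using gen by (simp add: generated_by_def)

lemma absorb_mult_left: "x \<in> carrier M \<Longrightarrow> absorb M \<otimes> x = absorb M"
  using absorb_mult absorb_closed m_comm by simp

lemma carrier_induct [consumes 1, case_names one absorb gen mult]:
  assumes "x \<in> carrier M" "P \<one>" "P (absorb M)" "\<And>x. x \<in> set es \<Longrightarrow> P x"
    "\<And>x y. \<lbrakk>x \<in> carrier M; y \<in> carrier M; P x; P y\<rbrakk> \<Longrightarrow> P (x \<otimes> y)"
  shows "P x"
proof -
  have span: "binoid_span M (set es) = carrier M"
    using gen by (simp add: generated_by_def)
  have "x \<in> binoid_span M (set es)"
    using assms(1) span by simp
  then show ?thesis
    by induction (use assms span in auto)
qed

text \<open>Faces are the complements of the prime ideals of \<open>M\<close>; they are also exactly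
  the supports of the real-valued homomorphisms.\<close>

definition face :: "'a set \<Rightarrow> bool" where
  "face F \<longleftrightarrow> F \<subseteq> carrier M \<and> \<one> \<in> F \<and> absorb M \<notin> F \<and>
     (\<forall>x\<in>carrier M. \<forall>y\<in>carrier M. x \<otimes> y \<in> F \<longleftrightarrow> x \<in> F \<and> y \<in> F)"

lemma faceD:
  assumes "face F"
  shows "F \<subseteq> carrier M" "\<one> \<in> F" "absorb M \<notin> F"
    "\<lbrakk>x \<in> carrier M; y \<in> carrier M\<rbrakk> \<Longrightarrow> x \<otimes> y \<in> F \<longleftrightarrow> x \<in> F \<and> y \<in> F"
  using assms by (auto simp: face_def)

text \<open>Whether a product lies in a face is decided by its factors, so a face is determined by
  the generators in it. This gives the finiteness of the stratification.\<close>

lemma face_subsetI: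
  assumes "face F" "face G" "F \<inter> set es \<subseteq> G"
  shows "F \<subseteq> G"
proof
  fix x assume "x \<in> F"
  moreover from this have "x \<in> carrier M" using faceD[OF assms(1)] by auto
  then have "x \<in> F \<longrightarrow> x \<in> G"
    by (induction rule: carrier_induct) (use faceD[OF assms(1)] faceD[OF assms(2)] assms(3) in auto)
  ultimately show "x \<in> G" by simp
qed

lemma finite_faces: "finite {F. face F}"
proof (rule finite_imageD[of "\<lambda>F. F \<inter> set es"])
  show "finite ((\<lambda>F. F \<inter> set es) ` {F. face F})"
    by (rule finite_subset[of _ "Pow (set es)"]) auto
  show "inj_on (\<lambda>F. F \<inter> set es) {F. face F}"
    by (rule inj_onI) (use face_subsetI in blast)
qed

definition divisors :: "'a \<Rightarrow> 'a set" where
  "divisors e = {x \<in> carrier M. \<exists>y\<in>carrier M. x \<otimes> y = e}"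

definition idems :: "'a set" where
  "idems = {e \<in> carrier M. e \<otimes> e = e}"

lemma carrier_idem_binoid: "carrier (idem_binoid M) = idems"
  by (simp add: idem_binoid_def idems_def)

lemma idems_closed: "e \<in> idems \<Longrightarrow> e \<in> carrier M"
  and one_idems: "\<one> \<in> idems" and absorb_idems: "absorb M \<in> idems"
  by (auto simp: idems_def absorb_closed absorb_mult)

lemma idems_mult:
  assumes "e \<in> idems" "g \<in> idems"
  shows "e \<otimes> g \<in> idems"
proof -
  have c: "e \<in> carrier M" "g \<in> carrier M" using assms idems_closed by auto
  then have "(e \<otimes> g) \<otimes> (e \<otimes> g) = (e \<otimes> e) \<otimes> (g \<otimes> g)"
    by (simp add: m_ac)
  then show ?thesis using assms c by (simp add: idems_def)
qed

lemma divisors_closed: "x \<in> divisors e \<Longrightarrow> x \<in> carrier M"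
  by (simp add: divisors_def)

text \<open>If an idempotent divides \<open>e\<close>, the cofactor can be taken to be
  \<open>e\<close> itself; among idempotents divisibility is thus the usual order.\<close>

lemma idem_divisors_iff:
  assumes "g \<in> idems" "e \<in> carrier M"
  shows "g \<in> divisors e \<longleftrightarrow> g \<otimes> e = e"
proof
  assume "g \<in> divisors e"
  then obtain y where y: "y \<in> carrier M" "g \<otimes> y = e" by (auto simp: divisors_def)
  have "g \<in> carrier M" "g \<otimes> g = g"
    using assms(1) by (auto simp: idems_def)
  then have "g \<otimes> (g \<otimes> y) = g \<otimes> y"
    using y(1) by (metis m_assoc)
  then show "g \<otimes> e = e" using y by simp
next
  assume "g \<otimes> e = e"
  then show "g \<in> divisors e"
    unfolding divisors_def using assms idems_closed by blast
qed

lemma face_divisors: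
  assumes e: "e \<in> idems" "e \<noteq> absorb M"
  shows "face (divisors e)"
  unfolding face_def
proof (intro conjI ballI)
  have ec: "e \<in> carrier M" "e \<otimes> e = e" using e by (auto simp: idems_def)
  show "divisors e \<subseteq> carrier M" using divisors_closed by blast
  show "\<one> \<in> divisors e" using ec by (auto simp: divisors_def)
  show "absorb M \<notin> divisors e" using e absorb_mult_left by (auto simp: divisors_def)
  fix x y assume xy: "x \<in> carrier M" "y \<in> carrier M"
  show "x \<otimes> y \<in> divisors e \<longleftrightarrow> x \<in> divisors e \<and> y \<in> divisors e"
  proof
    assume "x \<otimes> y \<in> divisors e"
    then obtain z where z: "z \<in> carrier M" "x \<otimes> y \<otimes> z = e" by (auto simp: divisors_def)
    then have "x \<otimes> (y \<otimes> z) = e" "y \<otimes> (x \<otimes> z) = e"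
      using xy by (auto simp: m_ac)
    then show "x \<in> divisors e \<and> y \<in> divisors e"
      using xy z by (auto simp: divisors_def)
  next
    assume "x \<in> divisors e \<and> y \<in> divisors e"
    then obtain a b where ab: "a \<in> carrier M" "b \<in> carrier M" "x \<otimes> a = e" "y \<otimes> b = e"
      by (auto simp: divisors_def)
    have "(x \<otimes> y) \<otimes> (a \<otimes> b) = (x \<otimes> a) \<otimes> (y \<otimes> b)"
      using xy ab(1,2) by (simp add: m_ac)
    also have "\<dots> = e" using ab ec by simp
    finally show "x \<otimes> y \<in> divisors e"
      using xy ab by (auto simp: divisors_def)
  qed
qed

text \<open>Idempotents that divide each other absorb each other, and commutativity makes them
  equal.\<close>

lemma divisors_inj:
  assumes e: "e \<in> idems" and g: "g \<in> idems" and eq: "divisors e = divisors g"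
  shows "e = g"
proof -
  have c: "e \<in> carrier M" "g \<in> carrier M" "e \<otimes> e = e" "g \<otimes> g = g" using e g by (auto simp: idems_def)
  then have "e \<in> divisors e" "g \<in> divisors g" by (auto simp: divisors_def)
  then have "e \<otimes> g = g" "g \<otimes> e = e"
    using eq idem_divisors_iff e g c by auto
  then show ?thesis using c m_comm by simp
qed

lemma finite_idems: "finite idems"
proof -
  have "finite (idems - {absorb M})"
  proof (rule inj_on_finite[OF _ _ finite_faces])
    show "inj_on divisors (idems - {absorb M})"
      by (rule inj_onI) (use divisors_inj in blast)
  qed (use face_divisors in auto)
  then show ?thesis by simp
qed

text \<open>A prime ideal \<open>r\<close> of the idempotents is determined by the product of the idempotents
  outside \<open>r\<close>, and \<open>M(r)\<close> is \<open>M\<close> localised at the divisors of this idempotent.\<close>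

lemma Adm_iff:
  "r \<in> Adm M \<longleftrightarrow> r \<subseteq> idems \<and> absorb M \<in> r \<and> (\<forall>x\<in>r. \<forall>m\<in>idems. x \<otimes> m \<in> r) \<and> r \<noteq> idems \<and>
    (\<forall>x\<in>idems. \<forall>y\<in>idems. x \<otimes> y \<in> r \<longrightarrow> x \<in> r \<or> y \<in> r)"
proof -
  have "absorb (idem_binoid M) = absorb M" "x \<otimes>\<^bsub>idem_binoid M\<^esub> y = x \<otimes> y" for x y
    by (simp_all add: idem_binoid_def)
  then show ?thesis
    by (auto simp: Adm_def binoid_prime_def binoid_ideal_def carrier_idem_binoid)
qed

lemma Adm_idem:
  assumes r: "r \<in> Adm M"
  obtains e where "e \<in> idems" "e \<noteq> absorb M" "r = idems - divisors e"
proof -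
  note R = r[unfolded Adm_iff]
  have one: "\<one> \<notin> r"
  proof
    assume "\<one> \<in> r"
    then have "x \<in> r" if "x \<in> idems" for x
      using R that idems_closed[OF that] by fastforce
    then show False using R by blast
  qed
  \<comment> \<open>By primeness, finite products of idempotents outside \<open>r\<close> stay
    outside \<open>r\<close>. The product of all of them is a multiple of each, the least idempotent
    outside \<open>r\<close>.\<close>
  have "\<exists>e\<in>idems - r. \<forall>g\<in>A. g \<otimes> e = e" if "finite A" "A \<subseteq> idems - r" for A
    using that
  proof (induction A)
    case empty
    show ?case using one one_idems by auto
  next
    case (insert a A)
    then obtain e where e: "e \<in> idems - r" "\<forall>g\<in>A. g \<otimes> e = e" by auto
    have c: "a \<in> carrier M" "e \<in> carrier M" "a \<otimes> a = a"
      using e insert by (auto simp: idems_def)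
    have "a \<otimes> e \<in> idems - r"
      using e insert R idems_mult by blast
    moreover have "a \<otimes> (a \<otimes> e) = a \<otimes> e"
      using c by (simp add: m_assoc[symmetric])
    moreover have "g \<otimes> (a \<otimes> e) = a \<otimes> e" if "g \<in> A" for g
    proof -
      have "g \<in> carrier M" using insert that idems_closed by auto
      then have "g \<otimes> (a \<otimes> e) = a \<otimes> (g \<otimes> e)" using c by (simp add: m_lcomm)
      then show ?thesis using e that by simp
    qed
    ultimately show ?case by blast
  qed
  from this[of "idems - r"] obtain e where e: "e \<in> idems - r" "\<forall>g\<in>idems - r. g \<otimes> e = e"
    using finite_idems by auto
  have "r = idems - divisors e"
  proof (intro equalityI subsetI)
    fix g assume g: "g \<in> r"
    then have "g \<in> idems" using R by auto
    moreover have "g \<otimes> e \<in> r" using R g e by blast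
    ultimately show "g \<in> idems - divisors e"
      using idem_divisors_iff[of g e] e idems_closed by auto
  next
    fix g assume "g \<in> idems - divisors e"
    then show "g \<in> r"
      using idem_divisors_iff[of g e] e idems_closed by blast
  qed
  moreover have "e \<noteq> absorb M"
    using e(1) R by blast
  ultimately show ?thesis
    using that e(1) by blast
qed

lemma idem_Adm:
  assumes e: "e \<in> idems" "e \<noteq> absorb M"
  shows "idems - divisors e \<in> Adm M"
proof -
  note F = faceD[OF face_divisors[OF e]]
  show ?thesis
    unfolding Adm_iff
  proof (intro conjI ballI impI)
    show "absorb M \<in> idems - divisors e" "idems - divisors e \<noteq> idems"
      using F(2,3) absorb_idems one_idems by blast+
    show "x \<otimes> m \<in> idems - divisors e" if "x \<in> idems - divisors e" "m \<in> idems" for x m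
      using that idems_mult[of x m] F(4)[of x m] idems_closed by blast
    show "x \<in> idems - divisors e \<or> y \<in> idems - divisors e"
      if "x \<in> idems" "y \<in> idems" "x \<otimes> y \<in> idems - divisors e" for x y
      using that F(4)[of x y] idems_closed by blast
  qed blast
qed

section \<open>Sign characters\<close>

abbreviation X :: "('a \<Rightarrow> real) set" where "X \<equiv> binoid_hom M real_binoid"

definition supp :: "('a \<Rightarrow> real) \<Rightarrow> 'a set" where
  "supp f = {x \<in> carrier M. f x \<noteq> 0}"

lemma face_supp: "f \<in> X \<Longrightarrow> face (supp f)"
  using binoid_hom_realD[of f M] by (auto simp: face_def supp_def)

lemma idem_value:
  assumes "f \<in> X" "e \<in> idems"
  shows "f e = 0 \<or> f e = 1"
proof -
  have "f e * f e = f e"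
    using binoid_hom_realD(3)[OF assms(1), of e e] assms(2) by (simp add: idems_def)
  then show ?thesis by auto
qed

definition sign_chars :: "'a set \<Rightarrow> ('a \<Rightarrow> real) set" where
  "sign_chars F = {f \<in> X. supp f = F \<and> (\<forall>x\<in>F. f x = 1 \<or> f x = -1)}"

text \<open>The witness that the quotients below do not collapse: it separates the elements of the
  face from the absorbing element.\<close>

lemma indicator_face:
  assumes "face F"
  shows "(\<lambda>x\<in>carrier M. if x \<in> F then 1 else 0) \<in> sign_chars F"
  using faceD[OF assms]
  by (auto simp: sign_chars_def binoid_hom_real_iff supp_def absorb_closed)

definition adm_rel :: "'a set \<Rightarrow> ('a \<times> 'a) set" where
  "adm_rel r = {(g \<otimes> m, absorb M) | g m. g \<in> r \<and> m \<in> carrier M} \<union>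
     {(g, \<one>) | g. g \<in> carrier (idem_binoid M) - r}"

end

definition square_rel :: "'a binoid \<Rightarrow> ('a \<times> 'a) set" where
  "square_rel U = {(g \<otimes>\<^bsub>U\<^esub> g, \<one>\<^bsub>U\<^esub>) | g. g \<in> carrier U - {absorb U}}"

section \<open>Units of the localisation at an idempotent and their characters\<close>

context fg_binoid
begin

context
  fixes r e
  assumes e: "e \<in> idems" "e \<noteq> absorb M" and r: "r = idems - divisors e"
begin

interpretation q: binoid_quot M "adm_rel r"
  by unfold_locales
    (use r idems_closed in \<open>auto simp: adm_rel_def absorb_closed carrier_idem_binoid\<close>)

abbreviation "N \<equiv> adm_quotient M r"
abbreviation "U \<equiv> units_binoid N"
abbreviation "T \<equiv> tensor_C2 U"

lemma N_def: "N = q.Q"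
  by (simp add: adm_quotient_def adm_rel_def)

lemma comm_binoid_N: "comm_binoid N" and comm_binoid_U: "comm_binoid U"
  using q.comm_binoid_quot comm_binoid_units_binoid by (auto simp: N_def)

lemma U_simps: "carrier U = insert (absorb N) (Units N)" "x \<otimes>\<^bsub>U\<^esub> y = x \<otimes>\<^bsub>N\<^esub> y"
    "\<one>\<^bsub>U\<^esub> = \<one>\<^bsub>N\<^esub>" "absorb U = absorb N"
  by (simp_all add: units_binoid_def)

interpretation N: comm_binoid N by (rule comm_binoid_N)
interpretation U: comm_binoid U by (rule comm_binoid_U)
interpretation t: binoid_quot U "square_rel U"
  by unfold_locales (auto simp: square_rel_def)

lemma T_def: "T = t.Q"
  by (simp add: tensor_C2_def square_rel_def)

lemma cls_mult_N:
    "\<lbrakk>x \<in> carrier M; y \<in> carrier M\<rbrakk> \<Longrightarrow> q.cls (x \<otimes> y) = q.cls x \<otimes>\<^bsub>N\<^esub> q.cls y"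
  and cls_one_N: "q.cls \<one> = \<one>\<^bsub>N\<^esub>"
  by (simp_all add: N_def q.mult_quot q.one_quot)

lemma cls_one: "t.cls (q.cls \<one>) = \<one>\<^bsub>T\<^esub>"
  by (simp only: T_def t.one_quot U_simps(3) cls_one_N)

lemma face_e: "face (divisors e)"
  using face_divisors[OF e] .

text \<open>Idempotents in \<open>r\<close> lie outside the support, so \<open>f\<close> kills the
  ideal they generate. The remaining idempotents have nonzero value, which can only be 1.\<close>

lemma sign_chars_respects:
  assumes f: "f \<in> sign_chars (divisors e)" and xy: "(x, y) \<in> adm_rel r"
  shows "f x = f y"
proof -
  have fX: "f \<in> X" and f0: "\<And>x. x \<in> carrier M \<Longrightarrow> f x \<noteq> 0 \<longleftrightarrow> x \<in> divisors e"
    using f by (auto simp: sign_chars_def supp_def)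
  from xy consider (a) g m where "x = g \<otimes> m" "y = absorb M" "g \<in> r" "m \<in> carrier M"
    | (b) "x \<in> idems - r" "y = \<one>"
    by (auto simp: adm_rel_def carrier_idem_binoid)
  then show ?thesis
  proof cases
    case a
    then have "f g = 0" using f0 r idems_closed by auto
    then show ?thesis
      using a binoid_hom_realD[OF fX] r idems_closed by auto
  next
    case b
    then have "f x \<noteq> 0" using f0 r idems_closed by auto
    then show ?thesis
      using b idem_value[OF fX, of x] binoid_hom_realD(1)[OF fX] by auto
  qed
qed

text \<open>In \<open>N\<close> the idempotent \<open>e\<close> becomes 1, so its divisors become
  units. Conversely the indicator of the face of \<open>e\<close> factors through \<open>N\<close>,
  and a unit cannot be sent to 0.\<close>

lemma unit_iff:
  assumes x: "x \<in> carrier M"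
  shows "q.cls x \<in> Units N \<longleftrightarrow> x \<in> divisors e"
proof
  let ?\<chi> = "\<lambda>x\<in>carrier M. if x \<in> divisors e then 1 else (0::real)"
  note \<chi> = indicator_face[OF face_e]
  then have \<chi>X: "?\<chi> \<in> X" by (simp add: sign_chars_def)
  obtain h where h: "h \<in> binoid_hom N real_binoid" "\<And>x. x \<in> carrier M \<Longrightarrow> h (q.cls x) = ?\<chi> x"
    using q.binoid_hom_factor[OF \<chi>X sign_chars_respects[OF \<chi>]] unfolding N_def by blast
  assume u: "q.cls x \<in> Units N"
  then obtain y where "y \<in> carrier N" "q.cls x \<otimes>\<^bsub>N\<^esub> y = \<one>\<^bsub>N\<^esub>"
    by (auto simp: Units_def)
  then have "h (q.cls x) * h y = 1"
    using binoid_hom_realD(1,3)[OF h(1)] u N.Units_closed by metis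
  then have "?\<chi> x \<noteq> 0" using h(2)[OF x] by auto
  then show "x \<in> divisors e" using x by (auto split: if_splits)
next
  assume "x \<in> divisors e"
  then obtain y where y: "y \<in> carrier M" "x \<otimes> y = e" by (auto simp: divisors_def)
  have "e \<in> divisors e" using e by (auto simp: divisors_def idems_def)
  then have "(e, \<one>) \<in> adm_rel r"
    using e r by (auto simp: adm_rel_def carrier_idem_binoid)
  then have "q.cls e = \<one>\<^bsub>N\<^esub>"
    unfolding N_def q.one_quot by (rule q.cls_eq_rel)
  then have "q.cls x \<otimes>\<^bsub>N\<^esub> q.cls y = \<one>\<^bsub>N\<^esub>" "q.cls y \<otimes>\<^bsub>N\<^esub> q.cls x = \<one>\<^bsub>N\<^esub>"
    using y x unfolding N_def by (simp_all add: q.mult_quot m_comm)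
  then show "q.cls x \<in> Units N"
    using q.cls_closed[OF x] q.cls_closed[OF y(1)] unfolding N_def Units_def by blast
qed

lemma absorb_not_unit: "absorb N \<notin> Units N"
  using unit_iff[OF absorb_closed] faceD(3)[OF face_e] by (simp add: N_def q.absorb_quot)

lemma unit_cls:
  assumes "u \<in> Units N"
  obtains x where "x \<in> divisors e" "u = q.cls x"
proof -
  obtain x where "x \<in> carrier M" "u = q.cls x"
    using N.Units_closed[OF assms] by (auto simp: N_def q.carrier_quot)
  then show ?thesis using that unit_iff assms by blast
qed

lemma cls_U: "x \<in> divisors e \<Longrightarrow> q.cls x \<in> carrier U"
  using unit_iff[of x] by (simp add: U_simps divisors_closed)

lemma cls_unit_mult:
  assumes "x \<in> divisors e" "y \<in> divisors e"
  shows "t.cls (q.cls (x \<otimes> y)) = t.cls (q.cls x) \<otimes>\<^bsub>T\<^esub> t.cls (q.cls y)"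
proof -
  have "q.cls (x \<otimes> y) = q.cls x \<otimes>\<^bsub>U\<^esub> q.cls y"
    using assms by (simp add: U_simps cls_mult_N divisors_closed)
  then show ?thesis
    using t.mult_quot[OF cls_U cls_U] assms by (simp add: T_def)
qed

lemma cls_square:
  assumes "u \<in> Units N"
  shows "t.cls (u \<otimes>\<^bsub>U\<^esub> u) = \<one>\<^bsub>T\<^esub>"
proof -
  have "u \<in> carrier U - {absorb U}"
    using assms absorb_not_unit by (auto simp: U_simps)
  then show ?thesis
    unfolding T_def t.one_quot by (intro t.cls_eq_rel) (auto simp: square_rel_def)
qed

text \<open>Two universal properties in turn: \<open>f\<close> descends to \<open>N\<close> since it
  respects \<open>adm_rel r\<close>, and its restriction to the units descends to \<open>T\<close>
  since signs have square 1.\<close>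

lemma sign_char_factor:
  assumes f: "f \<in> sign_chars (divisors e)"
  obtains h where "h \<in> binoid_hom T real_binoid" "\<And>x. x \<in> divisors e \<Longrightarrow> h (t.cls (q.cls x)) = f x"
proof -
  have fX: "f \<in> X" using f by (simp add: sign_chars_def)
  obtain g where g: "g \<in> binoid_hom N real_binoid" "\<And>x. x \<in> carrier M \<Longrightarrow> g (q.cls x) = f x"
    using q.binoid_hom_factor[OF fX sign_chars_respects[OF f]] unfolding N_def by blast
  let ?k = "restrict g (carrier U)"
  have UN: "carrier U \<subseteq> carrier N"
    using N.absorb_closed by (auto simp: U_simps)
  have k: "?k \<in> binoid_hom U real_binoid"
    unfolding binoid_hom_real_iff
    using binoid_hom_realD[OF g(1)] UN U.m_closed U.one_closed U.absorb_closed
    by (auto simp: U_simps(2-4) subset_iff)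
  have "?k x = ?k y" if xy: "(x, y) \<in> square_rel U" for x y
  proof -
    obtain u where u: "u \<in> Units N" "x = u \<otimes>\<^bsub>U\<^esub> u" "y = \<one>\<^bsub>U\<^esub>" "u \<in> carrier U"
      using xy by (auto simp: square_rel_def U_simps)
    obtain z where z: "z \<in> divisors e" "u = q.cls z" using unit_cls u by blast
    have "f z * f z = 1" using f z by (auto simp: sign_chars_def)
    then have "g u * g u = 1" using g(2) z divisors_closed by auto
    moreover have "?k x = ?k u * ?k u"
      unfolding u by (rule binoid_hom_realD(3)[OF k u(4) u(4)])
    ultimately show ?thesis
      unfolding u(3) binoid_hom_realD(1)[OF k] using u(4) by simp
  qed
  then obtain h where "h \<in> binoid_hom T real_binoid" "\<And>x. x \<in> carrier U \<Longrightarrow> h (t.cls x) = ?k x"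
    using t.binoid_hom_factor[OF k] unfolding T_def by blast
  then show ?thesis
    using that[of h] g(2) cls_U divisors_closed by auto
qed

lemma carrier_T:
  assumes "z \<in> carrier T"
  shows "z = absorb T \<or> (\<exists>x\<in>divisors e. z = t.cls (q.cls x))"
proof -
  obtain u where u: "u \<in> carrier U" "z = t.cls u"
    using assms unfolding T_def t.carrier_quot by (rule imageE)
  show ?thesis
  proof (cases "u = absorb N")
    case True
    then show ?thesis using u by (simp add: T_def t.absorb_quot U_simps)
  next
    case False
    then have "u \<in> Units N" using u by (simp add: U_simps)
    then show ?thesis using unit_cls u(2) by metis
  qed
qed

text \<open>The absorbing element of \<open>T\<close> differs from 1 because there is a homomorphism
  to the reals, induced by the indicator of the face of \<open>e\<close>.\<close>

lemma elementary_T: "elementary_binoid T"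
proof -
  interpret T: comm_binoid T unfolding T_def by (rule t.comm_binoid_quot)
  obtain h where h: "h \<in> binoid_hom T real_binoid"
    using sign_char_factor[OF indicator_face[OF face_e]] by blast
  show ?thesis
  proof
    show "absorb T \<noteq> \<one>\<^bsub>T\<^esub>"
      using binoid_hom_realD(1,2)[OF h] by auto
    fix z assume z: "z \<in> carrier T" "z \<noteq> absorb T"
    then obtain x where x: "x \<in> divisors e" "z = t.cls (q.cls x)"
      using carrier_T by blast
    have "q.cls x \<in> Units N" using unit_iff x divisors_closed by blast
    from cls_square[OF this] show "z \<otimes>\<^bsub>T\<^esub> z = \<one>\<^bsub>T\<^esub>"
      unfolding x T_def using t.mult_quot[OF cls_U[OF x(1)] cls_U[OF x(1)]] by simp
  qed
qed

interpretation T: elementary_binoid T by (rule elementary_T)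

lemma cls_nonzero:
  assumes "x \<in> divisors e"
  shows "t.cls (q.cls x) \<in> carrier T - {absorb T}"
proof -
  obtain h where h: "h \<in> binoid_hom T real_binoid"
      "\<And>x. x \<in> divisors e \<Longrightarrow> h (t.cls (q.cls x)) = (\<lambda>x\<in>carrier M. if x \<in> divisors e then 1 else 0) x"
    using sign_char_factor[OF indicator_face[OF face_e]] by blast
  have "h (t.cls (q.cls x)) = 1"
    using h(2)[OF assms] assms divisors_closed by auto
  then show ?thesis
    using binoid_hom_realD(2)[OF h(1)] t.cls_closed[OF cls_U[OF assms]] by (auto simp: T_def)
qed

text \<open>Supplies the finite generating set on which \<open>min_generators\<close> depends. Since
  \<open>divisors e\<close> is a face, only generators of \<open>M\<close> lying in it are
  involved.\<close>

lemma generate_T: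
  "generate T.E ((\<lambda>x. t.cls (q.cls x)) ` (set es \<inter> divisors e)) = carrier T.E"
proof
  let ?Q = "\<lambda>x. t.cls (q.cls x)"
  interpret E: comm_group T.E by (rule T.comm_group_E)
  show "generate T.E (?Q ` (set es \<inter> divisors e)) \<subseteq> carrier T.E"
    by (rule E.generate_incl) (use cls_nonzero in auto)
  have *: "x \<in> divisors e \<longrightarrow> ?Q x \<in> generate T.E (?Q ` (set es \<inter> divisors e))" if "x \<in> carrier M" for x
    using that
  proof (induction rule: carrier_induct)
    case one
    have "?Q \<one> = \<one>\<^bsub>T.E\<^esub>"
      using cls_one by simp
    then show ?case using generate.one by metis
  next
    case absorb
    then show ?case using faceD(3)[OF face_e] by simp
  next
    case (gen x)
    then show ?case by (auto intro!: generate.incl)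
  next
    case (mult x y)
    then show ?case
      using faceD(4)[OF face_e, of x y] cls_unit_mult[of x y] generate.eng[of "?Q x" T.E _ "?Q y"] by auto
  qed
  show "carrier T.E \<subseteq> generate T.E (?Q ` (set es \<inter> divisors e))"
    using carrier_T * divisors_closed by auto
qed

text \<open>Pulling back along both quotient maps and extending by zero identifies the characters of
  \<open>T\<close> with the sign characters of the face of \<open>e\<close>.\<close>

lemma card_sign_chars_aux:
  "finite (sign_chars (divisors e)) \<and> card (sign_chars (divisors e)) = 2 ^ adm_rank M r"
proof -
  let ?\<Phi> = "\<lambda>h. \<lambda>x\<in>carrier M. if x \<in> divisors e then h (t.cls (q.cls x)) else (0::real)"
  note F = faceD[OF face_e]
  have bij: "bij_betw ?\<Phi> (binoid_hom T real_binoid) (sign_chars (divisors e))"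
    unfolding bij_betw_def
  proof
    show "inj_on ?\<Phi> (binoid_hom T real_binoid)"
    proof (rule inj_onI, rule binoid_hom_real_eqI)
      fix h k z assume h: "h \<in> binoid_hom T real_binoid" and k: "k \<in> binoid_hom T real_binoid"
        and eq: "?\<Phi> h = ?\<Phi> k" and z: "z \<in> carrier T"
      have "h (t.cls (q.cls x)) = k (t.cls (q.cls x))" if "x \<in> divisors e" for x
        using fun_cong[OF eq, of x] that divisors_closed by simp
      then show "h z = k z"
        using carrier_T[OF z] binoid_hom_realD(2)[OF h] binoid_hom_realD(2)[OF k] by auto
    qed
    show "?\<Phi> ` binoid_hom T real_binoid = sign_chars (divisors e)"
    proof (intro equalityI subsetI)
      fix f assume "f \<in> ?\<Phi> ` binoid_hom T real_binoid"
      then obtain h where h: "h \<in> binoid_hom T real_binoid" "f = ?\<Phi> h" by blast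
      have pm: "h (t.cls (q.cls x)) = 1 \<or> h (t.cls (q.cls x)) = -1" if "x \<in> divisors e" for x
      proof -
        have "h (t.cls (q.cls x)) * h (t.cls (q.cls x)) = 1"
          using binoid_hom_realD(1)[OF h(1)] binoid_hom_realD(3)[OF h(1)] cls_nonzero[OF that]
            T.square[of "t.cls (q.cls x)"] by (metis DiffE singletonI)
        then show ?thesis by (simp add: square_eq_1_iff)
      qed
      have mult: "h (t.cls (q.cls (x \<otimes> y))) = h (t.cls (q.cls x)) * h (t.cls (q.cls y))"
        if "x \<in> divisors e" "y \<in> divisors e" for x y
        using cls_unit_mult[OF that] binoid_hom_realD(3)[OF h(1)] cls_nonzero that by auto
      have one: "h (t.cls (q.cls \<one>)) = 1"
        using binoid_hom_realD(1)[OF h(1)] by (simp add: cls_one)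
      have "f \<in> X"
        unfolding binoid_hom_real_iff h(2) using F(2,3) absorb_closed mult F(4) one by auto
      moreover have "supp f = divisors e"
        using pm divisors_closed by (force simp: supp_def h(2))
      ultimately show "f \<in> sign_chars (divisors e)"
        using pm divisors_closed by (auto simp: sign_chars_def h(2))
    next
      fix f assume f: "f \<in> sign_chars (divisors e)"
      obtain h where h: "h \<in> binoid_hom T real_binoid" "\<And>x. x \<in> divisors e \<Longrightarrow> h (t.cls (q.cls x)) = f x"
        using sign_char_factor[OF f] by blast
      have "f x = ?\<Phi> h x" for x
        using f h(2) binoid_hom_realD(4)[of f M x] by (auto simp: sign_chars_def supp_def)
      then have "f = ?\<Phi> h" by blast
      then show "f \<in> ?\<Phi> ` binoid_hom T real_binoid"
        using h(1) by blast
    qed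
  qed
  let ?S = "(\<lambda>x. t.cls (q.cls x)) ` (set es \<inter> divisors e)"
  have S: "finite ?S" "?S \<subseteq> carrier T.E"
    using cls_nonzero by auto
  note C = T.card_characters_min_generators[OF S generate_T]
  show ?thesis
    using C bij_betw_finite[OF bij] bij_betw_same_card[OF bij] by (simp add: adm_rank_def)
qed

end

lemma card_sign_chars:
  assumes "e \<in> idems" "e \<noteq> absorb M"
  shows "finite (sign_chars (divisors e))"
    "card (sign_chars (divisors e)) = 2 ^ adm_rank M (idems - divisors e)"
  using card_sign_chars_aux[OF assms refl] by auto

end

section \<open>Weights on faces\<close>

text \<open>Gordan's alternative for a subgroup of a finitely generated free abelian group, by induction
  on the number of coordinates: if no element of the subgroup with vanishing last coordinate is
  positive on the others, then the functional provided by the induction hypothesis is a multiple of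
  the last coordinate on the whole subgroup.\<close>

lemma gordan_alternative:
  fixes L :: "('i \<Rightarrow> int) set"
  assumes "finite J"
    and "(\<lambda>_. 0) \<in> L" and "\<And>a b. \<lbrakk>a \<in> L; b \<in> L\<rbrakk> \<Longrightarrow> (\<lambda>i. a i + b i) \<in> L"
    and "\<And>a k. a \<in> L \<Longrightarrow> (\<lambda>i. k * a i) \<in> L"
  shows "(\<exists>a\<in>L. \<forall>j\<in>J. a j > 0) \<or>
    (\<exists>v::'i \<Rightarrow> real. (\<forall>j\<in>J. v j \<ge> 0) \<and> (\<exists>j\<in>J. v j > 0) \<and> (\<forall>a\<in>L. (\<Sum>j\<in>J. v j * a j) = 0))"
  using assms
proof (induction J arbitrary: L)
  case empty
  then show ?case by auto
next
  case (insert k J)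
  note L = insert.prems
  have ext: "(\<Sum>j\<in>insert k J. (v(k := c)) j * a j) = c * a k + (\<Sum>j\<in>J. v j * a j)"
    for v :: "'i \<Rightarrow> real" and c and a :: "'i \<Rightarrow> int"
  proof -
    have "(\<Sum>j\<in>J. (v(k := c)) j * a j) = (\<Sum>j\<in>J. v j * a j)"
      by (rule sum.cong) (use insert.hyps in auto)
    then show ?thesis using insert.hyps by simp
  qed
  show ?case
  proof (cases "\<forall>a\<in>L. a k = 0")
    case True
    then have "(\<Sum>j\<in>insert k J. ((\<lambda>_. 0)(k := 1)) j * real_of_int (a j)) = 0" if "a \<in> L" for a
      unfolding ext using that by simp
    then show ?thesis by (intro disjI2 exI[of _ "(\<lambda>_. 0)(k := 1)"]) simp
  next
    case False
    then obtain m0 where m0: "m0 \<in> L" "m0 k \<noteq> 0" by blast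
    obtain m where m: "m \<in> L" "m k > 0"
    proof (cases "m0 k > 0")
      case False
      then show ?thesis using that[of "\<lambda>i. -1 * m0 i"] L(3)[OF m0(1), of "-1"] m0 by auto
    qed (use that m0 in blast)
    let ?L0 = "{a \<in> L. a k = 0}"
    have "(\<exists>a\<in>?L0. \<forall>j\<in>J. a j > 0) \<or>
      (\<exists>v::'i \<Rightarrow> real. (\<forall>j\<in>J. v j \<ge> 0) \<and> (\<exists>j\<in>J. v j > 0) \<and> (\<forall>a\<in>?L0. (\<Sum>j\<in>J. v j * a j) = 0))"
      by (rule insert.IH) (use L in auto)
    then show ?thesis
    proof
      assume "\<exists>a\<in>?L0. \<forall>j\<in>J. a j > 0"
      then obtain a where a: "a \<in> L" "a k = 0" "\<forall>j\<in>J. a j > 0" by auto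
      define B where "B = (\<Sum>j\<in>J. \<bar>m j\<bar>)"
      \<comment> \<open>This multiple of \<open>a\<close> outweighs every entry of \<open>m\<close>
        on \<open>J\<close>, while \<open>a k = 0\<close> leaves the positive entry
        \<open>m k\<close> untouched.\<close>
      let ?n = "1 + B"
      have "(\<lambda>i. ?n * a i + m i) \<in> L"
        using L a m by blast
      moreover have "?n * a j + m j > 0" if j: "j \<in> J" for j
      proof -
        have "0 \<le> B" unfolding B_def by (rule sum_nonneg) simp
        then have le: "?n \<le> ?n * a j"
          using mult_left_mono[of 1 "a j" ?n] a(3) j by force
        have "\<bar>m j\<bar> \<le> B"
          unfolding B_def by (rule member_le_sum) (use j insert.hyps in auto)
        then have "0 < ?n + m j"
          by linarith
        also have "\<dots> \<le> ?n * a j + m j"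
          by (rule add_right_mono) (rule le)
        finally show ?thesis .
      qed
      ultimately show ?thesis
        using a(2) m(2) by (intro disjI1 bexI[of _ "\<lambda>i. ?n * a i + m i"]) auto
    next
      assume "\<exists>v::'i \<Rightarrow> real. (\<forall>j\<in>J. v j \<ge> 0) \<and> (\<exists>j\<in>J. v j > 0) \<and> (\<forall>a\<in>?L0. (\<Sum>j\<in>J. v j * a j) = 0)"
      then obtain v :: "'i \<Rightarrow> real" where v: "\<forall>j\<in>J. v j \<ge> 0" "\<exists>j\<in>J. v j > 0"
          "\<And>a. \<lbrakk>a \<in> L; a k = 0\<rbrakk> \<Longrightarrow> (\<Sum>j\<in>J. v j * a j) = 0"
        by auto
      let ?c = "(\<Sum>j\<in>J. v j * m j) / m k"
      \<comment> \<open>Combining \<open>a\<close> with \<open>m\<close> so that coordinate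
        \<open>k\<close> cancels gives an element of \<open>?L0\<close>, on which \<open>v\<close>
        vanishes; hence \<open>v\<close> is \<open>?c\<close> times that coordinate on all of
        \<open>L\<close>.\<close>
      have c: "(\<Sum>j\<in>J. v j * a j) = ?c * a k" if a: "a \<in> L" for a
      proof -
        have "(\<lambda>i. m k * a i + (- a k) * m i) \<in> L"
          using L a m by blast
        then have "(\<Sum>j\<in>J. v j * of_int (m k * a j + (- a k) * m j)) = 0"
          using v(3) by fastforce
        then have "m k * (\<Sum>j\<in>J. v j * a j) - a k * (\<Sum>j\<in>J. v j * m j) = 0"
          by (simp add: sum_subtractf sum_distrib_left algebra_simps)
        then show ?thesis using m(2) by (simp add: field_simps)
      qed
      show ?thesis
      proof (cases "?c \<le> 0")
        case True
        have "(\<Sum>j\<in>insert k J. (v(k := - ?c)) j * a j) = 0" if "a \<in> L" for a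
          unfolding ext using c[OF that] by simp
        moreover have "\<forall>j\<in>insert k J. (v(k := - ?c)) j \<ge> 0"
          using v(1) True by auto
        moreover have "\<exists>j\<in>insert k J. (v(k := - ?c)) j > 0"
          using v(2) insert.hyps by auto
        ultimately show ?thesis by blast
      next
        \<comment> \<open>The coefficient \<open>- ?c\<close> now has the wrong sign, so the
          induction hypothesis is applied to \<open>L\<close> itself. If some \<open>a\<close> is
          positive on \<open>J\<close>, then \<open>?c * a k\<close> is positive, and so is
          \<open>a k\<close>.\<close>
        case pos: False
        have "(\<exists>a\<in>L. \<forall>j\<in>J. a j > 0) \<or>
          (\<exists>v::'i \<Rightarrow> real. (\<forall>j\<in>J. v j \<ge> 0) \<and> (\<exists>j\<in>J. v j > 0) \<and> (\<forall>a\<in>L. (\<Sum>j\<in>J. v j * a j) = 0))"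
          by (rule insert.IH) (use L in auto)
        then show ?thesis
        proof
          assume "\<exists>a\<in>L. \<forall>j\<in>J. a j > 0"
          then obtain a where a: "a \<in> L" "\<forall>j\<in>J. a j > 0" by blast
          obtain i where i: "i \<in> J" "v i > 0" using v(2) by blast
          have "0 < (\<Sum>j\<in>J. v j * a j)"
            by (rule sum_pos2[OF _ i(1)]) (use insert.hyps a v i in auto)
          then have "real_of_int (a k) > 0"
            using c[OF a(1)] pos zero_less_mult_pos[of ?c "real_of_int (a k)"] by linarith
          then have "a k > 0" by simp
          then show ?thesis using a by (intro disjI1 bexI[of _ a]) auto
        next
          assume "\<exists>v::'i \<Rightarrow> real. (\<forall>j\<in>J. v j \<ge> 0) \<and> (\<exists>j\<in>J. v j > 0) \<and> (\<forall>a\<in>L. (\<Sum>j\<in>J. v j * a j) = 0)"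
          then obtain w :: "'i \<Rightarrow> real" where w: "\<forall>j\<in>J. w j \<ge> 0" "\<exists>j\<in>J. w j > 0"
              "\<forall>a\<in>L. (\<Sum>j\<in>J. w j * a j) = 0" by blast
          have "(\<Sum>j\<in>insert k J. (w(k := 0)) j * a j) = 0" if "a \<in> L" for a
            unfolding ext using w(3) that by simp
          moreover have "\<forall>j\<in>insert k J. (w(k := 0)) j \<ge> 0" "\<exists>j\<in>insert k J. (w(k := 0)) j > 0"
            using w(1,2) insert.hyps by auto
          ultimately show ?thesis by blast
        qed
      qed
    qed
  qed
qed

context fg_binoid
begin

definition weight :: "'a set \<Rightarrow> ('a \<Rightarrow> real) \<Rightarrow> bool" where
  "weight F v \<longleftrightarrow> (\<forall>x\<in>F. \<forall>y\<in>F. v (x \<otimes> y) = v x + v y) \<and> (\<forall>x\<in>F. v x \<ge> 0)"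

text \<open>Such an \<open>f\<close> vanishes off \<open>F\<close> and factors on \<open>F\<close>
  through the cancellative quotient. These equations are closed conditions that hold wherever the
  support is \<open>F\<close>; the cancellation part makes boundary points compatible with
  \<open>relations\<close>.\<close>

definition closed_stratum :: "'a set \<Rightarrow> ('a \<Rightarrow> real) set" where
  "closed_stratum F = {f \<in> X. (\<forall>x\<in>carrier M - F. f x = 0) \<and>
     (\<forall>x\<in>F. \<forall>y\<in>F. \<forall>c\<in>F. x \<otimes> c = y \<otimes> c \<longrightarrow> f x = f y)}"

section \<open>Monomials in the generators of a face and their relations\<close>

context
  fixes F assumes F: "face F"
begin

abbreviation "gens \<equiv> set es \<inter> F"

definition mon :: "('a \<Rightarrow> nat) \<Rightarrow> 'a" where
  "mon \<alpha> = (\<Otimes>x\<in>gens. x [^] \<alpha> x)"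

lemma gens_carrier: "x \<in> gens \<Longrightarrow> x \<in> carrier M"
  using es_carrier by auto

lemma mon_closed: "mon \<alpha> \<in> carrier M"
  unfolding mon_def by (rule finprod_closed) (use gens_carrier in auto)

lemma mon_add: "mon (\<lambda>x. \<alpha> x + \<beta> x) = mon \<alpha> \<otimes> mon \<beta>"
proof -
  have "mon (\<lambda>x. \<alpha> x + \<beta> x) = (\<Otimes>x\<in>gens. x [^] \<alpha> x \<otimes> x [^] \<beta> x)"
    unfolding mon_def
    by (rule finprod_cong') (use gens_carrier in \<open>auto simp: nat_pow_mult\<close>)
  also have "\<dots> = mon \<alpha> \<otimes> mon \<beta>"
    unfolding mon_def by (rule finprod_multf) (use gens_carrier in auto)
  finally show ?thesis .
qed

lemma mon_cong: "(\<And>x. x \<in> gens \<Longrightarrow> \<alpha> x = \<beta> x) \<Longrightarrow> mon \<alpha> = mon \<beta>"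
  unfolding mon_def by (rule finprod_cong') (use gens_carrier in auto)

lemma mon_zero: "(\<And>x. x \<in> gens \<Longrightarrow> \<alpha> x = 0) \<Longrightarrow> mon \<alpha> = \<one>"
  using mon_cong[of \<alpha> "\<lambda>_. 0"] by (simp add: mon_def)

lemma mon_gen:
  assumes "g \<in> gens"
  shows "mon (\<lambda>x. if x = g then 1 else 0) = g"
proof -
  have "mon (\<lambda>x. if x = g then 1 else 0) = (\<Otimes>x\<in>gens. if g = x then x else \<one>)"
    unfolding mon_def by (rule finprod_cong') (use gens_carrier in auto)
  also have "\<dots> = g"
    by (rule finprod_singleton) (use assms gens_carrier in auto)
  finally show ?thesis .
qed

lemma mon_split:
  assumes g: "g \<in> gens" "\<alpha> g \<ge> 1"
  shows "\<exists>\<beta>. mon \<alpha> = g \<otimes> mon \<beta>"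
proof -
  have "mon \<alpha> = mon (\<lambda>x. (if x = g then 1 else 0) + (\<alpha>(g := \<alpha> g - 1)) x)"
    by (rule mon_cong) (use g in auto)
  then show ?thesis
    using mon_add mon_gen[OF g(1)] by metis
qed

lemma mon_in_face:
  assumes G: "face G"
  shows "mon \<alpha> \<in> G \<longleftrightarrow> (\<forall>g\<in>gens. \<alpha> g \<ge> 1 \<longrightarrow> g \<in> G)"
proof
  assume mon: "mon \<alpha> \<in> G"
  show "\<forall>g\<in>gens. \<alpha> g \<ge> 1 \<longrightarrow> g \<in> G"
  proof (intro ballI impI)
    fix g assume "g \<in> gens" "\<alpha> g \<ge> 1"
    then obtain \<beta> where "mon \<alpha> = g \<otimes> mon \<beta>" using mon_split by blast
    then show "g \<in> G"
      using mon faceD(4)[OF G gens_carrier[OF \<open>g \<in> gens\<close>] mon_closed] by simp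
  qed
next
  assume *: "\<forall>g\<in>gens. \<alpha> g \<ge> 1 \<longrightarrow> g \<in> G"
  have pow: "x [^] n \<in> G" if "x \<in> G" for x and n :: nat
    using that faceD[OF G] by (induction n) (auto simp: subset_iff)
  have "(\<Otimes>x\<in>A. x [^] \<alpha> x) \<in> G" if "finite A" "A \<subseteq> gens" for A
    using that
  proof (induction A)
    case empty
    then show ?case using faceD(2)[OF G] by simp
  next
    case (insert a A)
    then have c: "(\<lambda>x. x [^] \<alpha> x) \<in> A \<rightarrow> carrier M" "a [^] \<alpha> a \<in> carrier M"
      using gens_carrier by auto
    have "a [^] \<alpha> a \<in> G"
      using * insert.prems pow[of a "\<alpha> a"] faceD(2)[OF G] by (cases "\<alpha> a") auto
    then show ?case
      using insert c faceD(4)[OF G c(2) finprod_closed[OF c(1)]] by simp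
  qed
  then show "mon \<alpha> \<in> G" unfolding mon_def by simp
qed

lemma mon_in_F: "mon \<alpha> \<in> F"
  using mon_in_face[OF F] by simp

lemma mon_surj:
  assumes "x \<in> F"
  shows "\<exists>\<alpha>. x = mon \<alpha>"
proof -
  have "x \<in> carrier M" using assms faceD(1)[OF F] by blast
  then have "x \<in> F \<longrightarrow> (\<exists>\<alpha>. x = mon \<alpha>)"
  proof (induction rule: carrier_induct)
    case one
    then show ?case using mon_zero[of "\<lambda>_. 0"] by metis
  next
    case absorb
    then show ?case using faceD(3)[OF F] by simp
  next
    case (gen g)
    then show ?case using mon_gen[of g] by (metis IntI)
  next
    case (mult x y)
    then show ?case using faceD(4)[OF F, of x y] mon_add by metis
  qed
  then show ?thesis using assms by simp
qed

text \<open>On \<open>gens\<close> these are the exponent vectors that become trivial in the group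
  completion of \<open>F\<close>; the factor \<open>c\<close> compensates for missing
  cancellation.\<close>

definition relations :: "('a \<Rightarrow> int) set" where
  "relations = {l. \<exists>\<alpha> \<beta> c. c \<in> F \<and> mon \<alpha> \<otimes> c = mon \<beta> \<otimes> c \<and>
     (\<forall>x\<in>gens. l x = int (\<alpha> x) - int (\<beta> x))}"

lemma relations_zero: "(\<lambda>_. 0) \<in> relations"
  unfolding relations_def using faceD(2)[OF F] by (auto intro!: exI[of _ "\<lambda>_. 0"])

lemma relations_add:
  assumes "l \<in> relations" "k \<in> relations"
  shows "(\<lambda>i. l i + k i) \<in> relations"
proof -
  obtain \<alpha> \<beta> c where 1: "c \<in> F" "mon \<alpha> \<otimes> c = mon \<beta> \<otimes> c" "\<forall>x\<in>gens. l x = int (\<alpha> x) - int (\<beta> x)"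
    using assms(1) by (auto simp: relations_def)
  obtain \<alpha>' \<beta>' c' where 2: "c' \<in> F" "mon \<alpha>' \<otimes> c' = mon \<beta>' \<otimes> c'"
      "\<forall>x\<in>gens. k x = int (\<alpha>' x) - int (\<beta>' x)"
    using assms(2) by (auto simp: relations_def)
  have c: "c \<in> carrier M" "c' \<in> carrier M" using 1 2 faceD(1)[OF F] by auto
  have "mon (\<lambda>x. \<alpha> x + \<alpha>' x) \<otimes> (c \<otimes> c') = (mon \<alpha> \<otimes> c) \<otimes> (mon \<alpha>' \<otimes> c')"
    using c mon_closed by (simp add: mon_add m_ac)
  also have "\<dots> = mon (\<lambda>x. \<beta> x + \<beta>' x) \<otimes> (c \<otimes> c')"
    unfolding 1(2) 2(2) using c mon_closed by (simp add: mon_add m_ac)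
  finally show ?thesis
    unfolding relations_def using 1 2 c faceD(4)[OF F c]
    by (intro CollectI exI[of _ "\<lambda>x. \<alpha> x + \<alpha>' x"] exI[of _ "\<lambda>x. \<beta> x + \<beta>' x"] exI[of _ "c \<otimes> c'"]) auto
qed

lemma relations_scale:
  assumes l: "l \<in> relations"
  shows "(\<lambda>i. k * l i) \<in> relations"
proof -
  have nat: "(\<lambda>i. int n * l i) \<in> relations" if "l \<in> relations" for n l
  proof (induction n)
    case (Suc n)
    then have "(\<lambda>i. int n * l i + l i) \<in> relations"
      using that by (rule relations_add)
    then show ?case by (simp add: algebra_simps)
  qed (simp add: relations_zero)
  have neg: "(\<lambda>i. - l i) \<in> relations"
  proof -
    obtain \<alpha> \<beta> c where "c \<in> F" "mon \<alpha> \<otimes> c = mon \<beta> \<otimes> c" "\<forall>x\<in>gens. l x = int (\<alpha> x) - int (\<beta> x)"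
      using l by (auto simp: relations_def)
    then show ?thesis
      unfolding relations_def by (intro CollectI exI[of _ \<beta>] exI[of _ \<alpha>] exI[of _ c]) auto
  qed
  show ?thesis
  proof (cases "k \<ge> 0")
    case True
    then show ?thesis using nat[OF l, of "nat k"] by simp
  next
    case False
    then show ?thesis using nat[OF neg, of "nat (- k)"] by simp
  qed
qed

text \<open>Gordan's alternative for the relation lattice on the coordinates \<open>J\<close>: an
  orthogonal functional descends to a weight, a positive relation splits into exponents
  \<open>\<delta>\<close> and \<open>\<epsilon>\<close>. It is used for all generators, to detect
  idempotents, and for those killed by a boundary point.\<close>

lemma weight_or_relation:
  assumes J: "J \<subseteq> gens"
  shows "(\<exists>v. weight F v \<and> (\<exists>g\<in>gens. v g > 0) \<and> (\<forall>g\<in>gens - J. v g = 0)) \<or>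
    (\<exists>\<delta> \<epsilon> c. c \<in> F \<and> mon \<delta> \<otimes> c = mon \<epsilon> \<otimes> c \<and> (\<forall>j\<in>J. \<delta> j \<ge> 1 \<and> \<epsilon> j = 0))"
proof -
  have "finite J" using J finite_subset by blast
  from gordan_alternative[OF this relations_zero relations_add relations_scale]
  consider (pos) l where "l \<in> relations" "\<forall>j\<in>J. l j > 0"
    | (orth) v :: "'a \<Rightarrow> real" where "\<forall>j\<in>J. v j \<ge> 0" "\<exists>j\<in>J. v j > 0"
        "\<forall>l\<in>relations. (\<Sum>j\<in>J. v j * l j) = 0"
    by blast
  then show ?thesis
  proof cases
    case pos
    then obtain \<alpha> \<beta> c where c: "c \<in> F" "mon \<alpha> \<otimes> c = mon \<beta> \<otimes> c"
        "\<forall>x\<in>gens. l x = int (\<alpha> x) - int (\<beta> x)"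
      by (auto simp: relations_def)
    have cc: "c \<in> carrier M" using c faceD(1)[OF F] by auto
    \<comment> \<open>The positive and negative parts of \<open>l\<close>. Their difference agrees
      with that of \<open>\<alpha>\<close> and \<open>\<beta>\<close>, and the excess is absorbed by
      enlarging the factor \<open>c\<close> to \<open>mon \<beta> \<otimes> c\<close>.\<close>
    define \<delta> where "\<delta> = (\<lambda>x. nat (l x))"
    define \<epsilon> where "\<epsilon> = (\<lambda>x. nat (- l x))"
    have "mon (\<lambda>x. \<alpha> x + \<epsilon> x) = mon (\<lambda>x. \<beta> x + \<delta> x)"
      by (rule mon_cong) (use c(3) in \<open>force simp: \<delta>_def \<epsilon>_def\<close>)
    then have eq: "mon \<alpha> \<otimes> mon \<epsilon> = mon \<beta> \<otimes> mon \<delta>"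
      by (simp add: mon_add)
    have "mon \<delta> \<otimes> (mon \<beta> \<otimes> c) = (mon \<beta> \<otimes> mon \<delta>) \<otimes> c"
      using cc mon_closed by (simp add: m_ac)
    also have "\<dots> = mon \<epsilon> \<otimes> (mon \<alpha> \<otimes> c)"
      unfolding eq[symmetric] using cc mon_closed by (simp add: m_ac)
    also have "\<dots> = mon \<epsilon> \<otimes> (mon \<beta> \<otimes> c)"
      unfolding c(2) ..
    finally have "mon \<delta> \<otimes> (mon \<beta> \<otimes> c) = mon \<epsilon> \<otimes> (mon \<beta> \<otimes> c)" .
    moreover have "mon \<beta> \<otimes> c \<in> F"
      using faceD(4)[OF F mon_closed cc] c(1) mon_in_F by simp
    moreover have "\<forall>j\<in>J. \<delta> j \<ge> 1 \<and> \<epsilon> j = 0"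
      using pos(2) by (force simp: \<delta>_def \<epsilon>_def)
    ultimately show ?thesis by blast
  next
    case orth
    \<comment> \<open>Orthogonality to the relations, applied with the factor \<open>\<one>\<close>,
      makes \<open>w\<close> depend only on the monomial, so it descends to the function
      \<open>u\<close> on \<open>F\<close>.\<close>
    define w where "w \<alpha> = (\<Sum>j\<in>J. v j * real (\<alpha> j))" for \<alpha> :: "'a \<Rightarrow> nat"
    have w_eq: "w \<alpha> = w \<beta>" if "mon \<alpha> = mon \<beta>" for \<alpha> \<beta>
    proof -
      have "(\<lambda>x. int (\<alpha> x) - int (\<beta> x)) \<in> relations"
        unfolding relations_def using that faceD(2)[OF F]
        by (intro CollectI exI[of _ \<alpha>] exI[of _ \<beta>] exI[of _ \<one>]) simp
      then have "(\<Sum>j\<in>J. v j * real_of_int (int (\<alpha> j) - int (\<beta> j))) = 0"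
        using orth(3) by fast
      then show ?thesis
        by (simp add: w_def algebra_simps sum_subtractf)
    qed
    define u where "u x = w (SOME \<alpha>. x = mon \<alpha>)" for x
    have u: "u (mon \<alpha>) = w \<alpha>" for \<alpha>
    proof -
      have "mon \<alpha> = mon (SOME \<beta>. mon \<alpha> = mon \<beta>)"
        by (rule someI[of _ \<alpha>]) simp
      then show ?thesis unfolding u_def using w_eq by metis
    qed
    have "weight F u"
      unfolding weight_def
    proof (intro conjI ballI)
      fix x assume "x \<in> F"
      then obtain \<alpha> where \<alpha>: "x = mon \<alpha>" using mon_surj by blast
      show "u x \<ge> 0"
        unfolding \<alpha> u w_def by (rule sum_nonneg) (use orth(1) in auto)
      fix y assume "y \<in> F"
      then obtain \<beta> where \<beta>: "y = mon \<beta>" using mon_surj by blast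
      show "u (x \<otimes> y) = u x + u y"
        unfolding \<alpha> \<beta> mon_add[symmetric] u by (simp add: w_def algebra_simps sum.distrib)
    qed
    moreover have ug: "u g = (if g \<in> J then v g else 0)" if g: "g \<in> gens" for g
    proof -
      have "u g = w (\<lambda>x. if x = g then 1 else 0)"
        using u mon_gen[OF g] by metis
      also have "\<dots> = (\<Sum>j\<in>J. if j = g then v j else 0)"
        unfolding w_def by (rule sum.cong) auto
      finally show ?thesis using \<open>finite J\<close> by simp
    qed
    moreover have "\<exists>g\<in>gens. u g > 0"
      using orth(2) ug J by force
    moreover have "\<forall>g\<in>gens - J. u g = 0"
      using ug by simp
    ultimately show ?thesis by blast
  qed
qed

text \<open>The monomial \<open>d = mon \<delta>\<close> involves every generator, so each element
  of \<open>F\<close> divides a power of \<open>d\<close>. If \<open>c\<close> divides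
  \<open>d [^] m\<close>, then \<open>d \<otimes> c = c\<close> gives
  \<open>d \<otimes> d [^] m = d [^] m\<close>. So \<open>d [^] m\<close> is idempotent, and every
  element of \<open>F\<close> divides it.\<close>

lemma idem_face_of_relation:
  assumes c: "c \<in> F" "mon \<delta> \<otimes> c = c" and \<delta>: "\<forall>j\<in>gens. \<delta> j \<ge> 1"
  shows "\<exists>e\<in>idems. F = divisors e"
proof -
  define d where "d = mon \<delta>"
  have d: "d \<in> carrier M" "d \<in> F" by (simp_all add: d_def mon_closed mon_in_F)
  have cc: "c \<in> carrier M" using c faceD(1)[OF F] by auto
  have div: "x \<in> F \<longrightarrow> (\<exists>n::nat. x \<in> divisors (d [^] n))" if "x \<in> carrier M" for x
    using that
  proof (induction rule: carrier_induct)
    case one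
    have "\<one> \<in> divisors (d [^] (0::nat))" by (auto simp: divisors_def)
    then show ?case by blast
  next
    case absorb
    then show ?case using faceD(3)[OF F] by simp
  next
    case (gen g)
    show ?case
    proof
      assume "g \<in> F"
      then have g: "g \<in> gens" using gen by simp
      then obtain \<beta> where "d = g \<otimes> mon \<beta>" unfolding d_def using mon_split \<delta> by blast
      then have "g \<in> divisors (d [^] (1::nat))"
        using mon_closed gens_carrier[OF g] d(1) by (auto simp: divisors_def)
      then show "\<exists>n::nat. g \<in> divisors (d [^] n)" by blast
    qed
  next
    case (mult x y)
    show ?case
    proof
      assume "x \<otimes> y \<in> F"
      then obtain n m :: nat where "x \<in> divisors (d [^] n)" "y \<in> divisors (d [^] m)"
        using mult faceD(4)[OF F, of x y] by auto
      then obtain a b where ab: "a \<in> carrier M" "b \<in> carrier M" "x \<otimes> a = d [^] n" "y \<otimes> b = d [^] m"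
        by (auto simp: divisors_def)
      have "(x \<otimes> y) \<otimes> (a \<otimes> b) = (x \<otimes> a) \<otimes> (y \<otimes> b)"
        using mult ab(1,2) by (simp add: m_ac)
      also have "\<dots> = d [^] (n + m)"
        using ab d by (simp add: nat_pow_mult)
      finally show "\<exists>n::nat. x \<otimes> y \<in> divisors (d [^] n)"
        using mult ab by (auto simp: divisors_def)
    qed
  qed
  obtain m :: nat and h where h: "h \<in> carrier M" "c \<otimes> h = d [^] m"
    using div[OF cc] c(1) by (auto simp: divisors_def)
  have step: "d \<otimes> d [^] m = d [^] m"
    unfolding h(2)[symmetric] using c(2) cc h(1) d(1) by (simp add: m_assoc[symmetric] d_def)
  have abs: "d [^] n \<otimes> d [^] m = d [^] m" for n :: nat
  proof (induction n)
    case (Suc n)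
    then show ?case using d(1) step by (simp add: m_assoc)
  qed (use d in simp)
  let ?e = "d [^] m"
  have e: "?e \<in> carrier M" "?e \<otimes> ?e = ?e" using d abs by auto
  have eF: "?e \<in> F"
  proof -
    have "d [^] n \<in> F" for n :: nat
      using d faceD[OF F] by (induction n) auto
    then show ?thesis .
  qed
  have "F = divisors ?e"
  proof (intro equalityI subsetI)
    fix x assume x: "x \<in> F"
    then have xc: "x \<in> carrier M" using faceD(1)[OF F] by auto
    then obtain n :: nat where "x \<in> divisors (d [^] n)"
      using div x by blast
    then obtain y where y: "y \<in> carrier M" "x \<otimes> y = d [^] n"
      by (auto simp: divisors_def)
    have "x \<otimes> (y \<otimes> ?e) = ?e"
      using y abs[of n] xc e(1) by (simp add: m_assoc[symmetric])
    then show "x \<in> divisors ?e" using xc y(1) e(1) by (auto simp: divisors_def)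
  next
    fix x assume "x \<in> divisors ?e"
    then obtain y where "x \<in> carrier M" "y \<in> carrier M" "x \<otimes> y = ?e" by (auto simp: divisors_def)
    then show "x \<in> F" using eF faceD(4)[OF F] by metis
  qed
  then show ?thesis using e by (auto simp: idems_def)
qed

text \<open>The other alternative would give \<open>f (mon \<delta>) = f (mon \<epsilon>)\<close>.
  The left side contains a generator killed by \<open>f\<close>, the right side contains none, a
  contradiction.\<close>

lemma weight_of_boundary:
  assumes f: "f \<in> closed_stratum F" "supp f \<noteq> F"
  shows "\<exists>v. weight F v \<and> (\<exists>g\<in>gens. v g > 0) \<and> (\<forall>g\<in>gens. g \<in> supp f \<longrightarrow> v g = 0)"
proof -
  have fX: "f \<in> X" and f0: "\<And>x. x \<in> carrier M - F \<Longrightarrow> f x = 0"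
    and fc: "\<And>x y c. \<lbrakk>x \<in> F; y \<in> F; c \<in> F; x \<otimes> c = y \<otimes> c\<rbrakk> \<Longrightarrow> f x = f y"
    using f(1) by (auto simp: closed_stratum_def)
  note G = face_supp[OF fX]
  let ?J = "gens - supp f"
  have J: "?J \<noteq> {}"
  proof
    assume "?J = {}"
    then have "F \<subseteq> supp f" using face_subsetI[OF F G] by auto
    moreover have "supp f \<subseteq> F" using f0 by (auto simp: supp_def)
    ultimately show False using f(2) by simp
  qed
  have "\<not> (\<exists>\<delta> \<epsilon> c. c \<in> F \<and> mon \<delta> \<otimes> c = mon \<epsilon> \<otimes> c \<and> (\<forall>j\<in>?J. \<delta> j \<ge> 1 \<and> \<epsilon> j = 0))"
  proof
    assume "\<exists>\<delta> \<epsilon> c. c \<in> F \<and> mon \<delta> \<otimes> c = mon \<epsilon> \<otimes> c \<and> (\<forall>j\<in>?J. \<delta> j \<ge> 1 \<and> \<epsilon> j = 0)"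
    then obtain \<delta> \<epsilon> c where c: "c \<in> F" "mon \<delta> \<otimes> c = mon \<epsilon> \<otimes> c" "\<forall>j\<in>?J. \<delta> j \<ge> 1 \<and> \<epsilon> j = 0"
      by blast
    have "f (mon \<delta>) = f (mon \<epsilon>)" using fc[OF mon_in_F mon_in_F c(1,2)] .
    moreover have "mon \<delta> \<notin> supp f" using mon_in_face[OF G] J c(3) by blast
    moreover have "mon \<epsilon> \<in> supp f" using mon_in_face[OF G] c(3) by force
    ultimately show False using mon_closed by (auto simp: supp_def)
  qed
  then have "\<exists>v. weight F v \<and> (\<exists>g\<in>gens. v g > 0) \<and> (\<forall>g\<in>gens - ?J. v g = 0)"
    using weight_or_relation[of ?J] by blast
  then show ?thesis by blast
qed

text \<open>A weight suited to a boundary point depends only on its support, so one choice per face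
  yields a finite family.\<close>

lemma boundary_weights:
  assumes nonidem: "\<not> (\<exists>e\<in>idems. F = divisors e)"
  obtains V where "finite V" "V \<noteq> {}" "\<And>v. v \<in> V \<Longrightarrow> weight F v" "\<And>v. v \<in> V \<Longrightarrow> \<exists>g\<in>gens. v g > 0"
    "\<And>f. \<lbrakk>f \<in> closed_stratum F; supp f \<noteq> F\<rbrakk> \<Longrightarrow> \<exists>v\<in>V. \<forall>g\<in>gens. v g > 0 \<longrightarrow> f g = 0"
proof -
  have "\<not> (\<exists>\<delta> \<epsilon> c. c \<in> F \<and> mon \<delta> \<otimes> c = mon \<epsilon> \<otimes> c \<and> (\<forall>j\<in>gens. \<delta> j \<ge> 1 \<and> \<epsilon> j = 0))"
  proof
    assume "\<exists>\<delta> \<epsilon> c. c \<in> F \<and> mon \<delta> \<otimes> c = mon \<epsilon> \<otimes> c \<and> (\<forall>j\<in>gens. \<delta> j \<ge> 1 \<and> \<epsilon> j = 0)"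
    then obtain \<delta> \<epsilon> c where c: "c \<in> F" "mon \<delta> \<otimes> c = mon \<epsilon> \<otimes> c" "\<forall>j\<in>gens. \<delta> j \<ge> 1 \<and> \<epsilon> j = 0"
      by blast
    have "mon \<epsilon> = \<one>" using c(3) by (intro mon_zero) blast
    then have "mon \<delta> \<otimes> c = c" using c faceD(1)[OF F] by auto
    then show False using idem_face_of_relation[OF c(1)] c(3) nonidem by blast
  qed
  \<comment> \<open>Keeps the family nonempty, as taking \<open>Min\<close> over it requires, even
    when there are no boundary points. Here it matters that \<open>F\<close> is not the face of an
    idempotent.\<close>
  then obtain v0 where v0: "weight F v0" "\<exists>g\<in>gens. v0 g > 0"
    using weight_or_relation[of gens] by blast
  let ?P = "\<lambda>G v. weight F v \<and> (\<exists>g\<in>gens. v g > 0) \<and> (\<forall>g\<in>gens. g \<in> G \<longrightarrow> v g = 0)"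
  let ?\<G> = "{G. face G \<and> (\<exists>v. ?P G v)}"
  define v where "v G = (SOME v. ?P G v)" for G
  have v: "?P G (v G)" if "G \<in> ?\<G>" for G
    using that someI_ex[of "?P G"] unfolding v_def by blast
  let ?V = "insert v0 (v ` ?\<G>)"
  show ?thesis
  proof (rule that[of ?V])
    show "finite ?V" using finite_faces by auto
    show "weight F w" if "w \<in> ?V" for w using that v v0 by blast
    show "\<exists>g\<in>gens. w g > 0" if "w \<in> ?V" for w using that v v0 by blast
    fix f assume f: "f \<in> closed_stratum F" "supp f \<noteq> F"
    have fX: "f \<in> X" using f(1) by (simp add: closed_stratum_def)
    have G: "supp f \<in> ?\<G>" using weight_of_boundary[OF f] face_supp[OF fX] by blast
    have "\<forall>g\<in>gens. v (supp f) g > 0 \<longrightarrow> f g = 0"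
      using v[OF G] gens_carrier by (force simp: supp_def)
    then show "\<exists>w\<in>?V. \<forall>g\<in>gens. w g > 0 \<longrightarrow> f g = 0" using G by blast
  qed simp
qed

end

end

section \<open>Retracting the real spectrum onto sign characters\<close>

lemma deformation_imp_homotopy_equivalent:
  fixes W :: "'b::topological_space set"
  assumes cont: "continuous_on ({0..1} \<times> W) K"
    and W: "\<And>t f. \<lbrakk>t \<in> {0..1::real}; f \<in> W\<rbrakk> \<Longrightarrow> K (t, f) \<in> W"
    and K0: "\<And>f. f \<in> W \<Longrightarrow> K (0, f) = f" and K1: "\<And>f. f \<in> W \<Longrightarrow> K (1, f) \<in> A"
    and A: "A \<subseteq> W" "\<And>f. f \<in> A \<Longrightarrow> K (1, f) = f"
  shows "top_of_set W homotopy_equivalent_space top_of_set A"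
proof (rule deformation_retract_imp_homotopy_equivalent_space)
  let ?r = "\<lambda>f. K (1, f)"
  have "homotopic_with (\<lambda>x. True) (top_of_set W) (top_of_set W) id ?r"
    by (subst homotopic_with) (use cont W K0 in \<open>auto intro!: exI[of _ K]\<close>)
  then show "homotopic_with (\<lambda>x. True) (top_of_set W) (top_of_set W) ?r id"
    by (rule homotopic_with_symD)
  have "continuous_on W ?r"
    by (rule continuous_on_compose2[OF cont]) (auto intro!: continuous_intros)
  then show "retraction_maps (top_of_set W) (top_of_set A) ?r id"
    using K1 A by (auto simp: retraction_maps_def continuous_on_id)
qed

text \<open>The power \<open>(1 - r)\<^sup>s\<close> with the convention \<open>0\<^sup>0 = 1\<close>, whereas \<open>0 powr 0 = 0\<close>.\<close>

definition attenuate :: "real \<Rightarrow> real \<Rightarrow> real" where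
  "attenuate r s = (if s = 0 then 1 else (1 - r) powr s)"

lemma attenuate_simps [simp]: "attenuate 0 s = 1" "attenuate r 0 = 1" "s \<noteq> 0 \<Longrightarrow> attenuate 1 s = 0"
  by (simp_all add: attenuate_def)

lemma attenuate_add:
  assumes "s \<ge> 0" "t \<ge> 0"
  shows "attenuate r (s + t) = attenuate r s * attenuate r t"
  using assms by (auto simp: attenuate_def powr_add)

lemma attenuate_bounds: "\<lbrakk>r \<in> {0..1}; s \<ge> 0\<rbrakk> \<Longrightarrow> attenuate r s \<in> {0..1}"
  by (auto simp: attenuate_def powr_le1)

text \<open>At \<open>r = 1\<close> the base is 0, where powers with positive exponent are still
  continuous; this is the point that represents infinite attenuation.\<close>

lemma continuous_on_attenuate:
  assumes "s \<ge> 0"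
  shows "continuous_on {0..1} (\<lambda>r. attenuate r s)"
proof (cases "s = 0")
  case False
  then have "continuous_on {0..1} (\<lambda>r. (1 - r) powr s)"
    using assms by (intro continuous_on_powr' continuous_intros) auto
  then show ?thesis using False by (simp add: attenuate_def)
qed simp

lemma continuous_on_Min_image:
  fixes d :: "'v \<Rightarrow> 'b::topological_space \<Rightarrow> real"
  assumes "finite V" "V \<noteq> {}" "\<And>v. v \<in> V \<Longrightarrow> continuous_on S (d v)"
  shows "continuous_on S (\<lambda>x. Min ((\<lambda>v. d v x) ` V))"
  using assms
proof (induction V rule: finite_ne_induct)
  case (insert a V)
  then have "continuous_on S (\<lambda>x. min (d a x) (Min ((\<lambda>v. d v x) ` V)))"
    by (intro continuous_on_min) auto
  then show ?case using insert by simp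
qed simp

lemma continuous_on_coordinate: "continuous_on S (\<lambda>f. f x)"
  by (rule continuous_on_product_then_coordinatewise[OF continuous_on_id])

section \<open>Deformation of a closed stratum onto its boundary\<close>

context fg_binoid
begin

definition weight_family :: "'a set \<Rightarrow> ('a \<Rightarrow> real) set \<Rightarrow> bool" where
  "weight_family F V \<longleftrightarrow> finite V \<and> V \<noteq> {} \<and> (\<forall>v\<in>V. weight F v \<and> (\<exists>g\<in>gens F. v g > 0)) \<and>
     (\<forall>f\<in>closed_stratum F. supp f \<noteq> F \<longrightarrow> (\<exists>v\<in>V. \<forall>g\<in>gens F. v g > 0 \<longrightarrow> f g = 0))"

context
  fixes F V
  assumes F: "face F" and fam: "weight_family F V"
begin

lemma V: "finite V" "V \<noteq> {}" "v \<in> V \<Longrightarrow> weight F v"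
  and V_pos: "v \<in> V \<Longrightarrow> \<exists>g\<in>gens F. v g > 0"
  and V_bd: "\<lbrakk>f \<in> closed_stratum F; supp f \<noteq> F\<rbrakk> \<Longrightarrow> \<exists>v\<in>V. \<forall>g\<in>gens F. v g > 0 \<longrightarrow> f g = 0"
  using fam unfolding weight_family_def by blast+

text \<open>\<open>wdist v f\<close> measures the distance of \<open>f\<close> from the part of the boundary of the stratum
  on which \<open>v\<close> may be used for an infinite attenuation. Attenuating along all \<open>v\<close> at the relative
  rates \<open>rate v f\<close>, the nearest boundary part is reached at time \<open>1\<close>, while boundary points stay.\<close>

definition wdist :: "('a \<Rightarrow> real) \<Rightarrow> ('a \<Rightarrow> real) \<Rightarrow> real" where
  "wdist v f = (\<Sum>g\<in>{g \<in> gens F. v g > 0}. \<bar>f g\<bar>)"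

definition rate :: "('a \<Rightarrow> real) \<Rightarrow> ('a \<Rightarrow> real) \<Rightarrow> real" where
  "rate v f = Min ((\<lambda>v. wdist v f) ` V) / wdist v f"

definition push :: "real \<times> ('a \<Rightarrow> real) \<Rightarrow> 'a \<Rightarrow> real" where
  "push = (\<lambda>(t, f). \<lambda>x\<in>carrier M. if x \<in> F then f x * (\<Prod>v\<in>V. attenuate (t * rate v f) (v x)) else 0)"

lemma wdist_nonneg: "wdist v f \<ge> 0"
  unfolding wdist_def by (rule sum_nonneg) simp

lemma wdist_zero_iff: "wdist v f = 0 \<longleftrightarrow> (\<forall>g\<in>gens F. v g > 0 \<longrightarrow> f g = 0)"
  unfolding wdist_def by (subst sum_nonneg_eq_0_iff) auto

lemma Min_wdist: "v \<in> V \<Longrightarrow> Min ((\<lambda>v. wdist v f) ` V) \<le> wdist v f"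
    "Min ((\<lambda>v. wdist v f) ` V) \<in> (\<lambda>v. wdist v f) ` V"
  using V by (auto intro: Min_in)

lemma Min_wdist_nonneg: "Min ((\<lambda>v. wdist v f) ` V) \<ge> 0"
  using Min_wdist(2)[of f] wdist_nonneg by force

lemma rate_bounds: "v \<in> V \<Longrightarrow> rate v f \<in> {0..1}"
  using Min_wdist(1)[of v f] Min_wdist_nonneg[of f] wdist_nonneg[of v f]
  by (cases "wdist v f = 0") (simp_all add: rate_def divide_le_eq_1)

lemma scaled_rate_bounds: "\<lbrakk>v \<in> V; t \<in> {0..1}\<rbrakk> \<Longrightarrow> t * rate v f \<in> {0..1}"
  using rate_bounds[of v f] by (auto simp: mult_le_one)

lemma weight_one: "v \<in> V \<Longrightarrow> v \<one> = 0"
proof -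
  assume "v \<in> V"
  then have "v (\<one> \<otimes> \<one>) = v \<one> + v \<one>"
    using V(3) faceD(2)[OF F] unfolding weight_def by blast
  then show ?thesis by simp
qed

lemma weight_nonneg: "\<lbrakk>v \<in> V; x \<in> F\<rbrakk> \<Longrightarrow> v x \<ge> 0"
  and weight_mult: "\<lbrakk>v \<in> V; x \<in> F; y \<in> F\<rbrakk> \<Longrightarrow> v (x \<otimes> y) = v x + v y"
  using V(3) unfolding weight_def by blast+

text \<open>A product of positive weight has a factor of positive weight, so vanishing spreads from
  the generators. This controls \<open>push\<close> where \<open>rate v\<close> may be
  discontinuous.\<close>

lemma wdist_zero_vanish:
  assumes v: "v \<in> V" and f: "f \<in> X" and d: "wdist v f = 0" and x: "x \<in> F" "v x > 0"
  shows "f x = 0"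
proof -
  have "x \<in> carrier M" using x faceD(1)[OF F] by blast
  then have "x \<in> F \<longrightarrow> v x > 0 \<longrightarrow> f x = 0"
  proof (induction rule: carrier_induct)
    case one
    show ?case using weight_one[OF v] by simp
  next
    case absorb
    show ?case using binoid_hom_realD(2)[OF f] by simp
  next
    case (gen g)
    then show ?case using d by (simp add: wdist_zero_iff)
  next
    case (mult x y)
    show ?case
    proof (intro impI)
      assume xy: "x \<otimes> y \<in> F" "v (x \<otimes> y) > 0"
      then have "x \<in> F" "y \<in> F" using faceD(4)[OF F mult(1,2)] by auto
      then have "v x > 0 \<or> v y > 0"
        using xy(2) weight_mult[OF v] weight_nonneg[OF v, of x] weight_nonneg[OF v, of y] by force
      then show "f (x \<otimes> y) = 0"
        using mult \<open>x \<in> F\<close> \<open>y \<in> F\<close> binoid_hom_realD(3)[OF f mult(1,2)] by auto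
    qed
  qed
  then show ?thesis using x by blast
qed

text \<open>All attenuation factors lie between 0 and 1. The bound replaces continuity of the rates
  at points where \<open>f x\<close> is 0.\<close>

lemma push_le:
  assumes "t \<in> {0..1}" "x \<in> carrier M"
  shows "\<bar>push (t, f) x\<bar> \<le> \<bar>f x\<bar>"
proof -
  have "(\<Prod>v\<in>V. attenuate (t * rate v f) (v x)) \<in> {0..1}" if "x \<in> F"
    using attenuate_bounds[OF scaled_rate_bounds[OF _ assms(1)] weight_nonneg[OF _ that]]
    by (auto intro!: prod_nonneg prod_le_1)
  then show ?thesis
    using assms by (auto simp: push_def abs_mult intro!: mult_left_le)
qed

text \<open>Additivity of the weights makes the attenuation factor multiplicative on
  \<open>F\<close>, and a product outside a face has a factor outside it.\<close>

lemma push_hom: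
  assumes f: "f \<in> X" "\<And>x. x \<in> carrier M - F \<Longrightarrow> f x = 0" and t: "t \<in> {0..1}"
  shows "push (t, f) \<in> X"
  unfolding binoid_hom_real_iff
proof (intro conjI ballI)
  show "push (t, f) \<in> extensional (carrier M)" by (simp add: push_def)
  have "(\<Prod>v\<in>V. attenuate (t * rate v f) (v \<one>)) = 1"
    by (rule prod.neutral) (simp add: weight_one)
  then show "push (t, f) \<one> = 1"
    using faceD(2)[OF F] binoid_hom_realD(1)[OF f(1)] by (simp add: push_def)
  show "push (t, f) (absorb M) = 0"
    using faceD(3)[OF F] by (simp add: push_def absorb_closed)
  fix x y assume xy: "x \<in> carrier M" "y \<in> carrier M"
  show "push (t, f) (x \<otimes> y) = push (t, f) x * push (t, f) y"
  proof (cases "x \<otimes> y \<in> F")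
    case True
    then have x: "x \<in> F" "y \<in> F" using faceD(4)[OF F xy] by auto
    have "(\<Prod>v\<in>V. attenuate (t * rate v f) (v (x \<otimes> y))) =
      (\<Prod>v\<in>V. attenuate (t * rate v f) (v x) * attenuate (t * rate v f) (v y))"
      by (intro prod.cong refl) (simp add: weight_mult[OF _ x] attenuate_add weight_nonneg x)
    then show ?thesis
      using True x xy binoid_hom_realD(3)[OF f(1) xy] by (simp add: push_def prod.distrib)
  next
    case False
    then show ?thesis using faceD(4)[OF F xy] xy by (auto simp: push_def)
  qed
qed

lemma push_supp:
  assumes "t \<in> {0..1}"
  shows "supp (push (t, f)) \<subseteq> F \<inter> supp f"
  by (auto simp: supp_def push_def split: if_splits)

lemma push_0:
  assumes f: "f \<in> closed_stratum F"
  shows "push (0, f) = f"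
proof
  fix x
  show "push (0, f) x = f x"
    using f binoid_hom_realD(4)[of f M x] by (auto simp: push_def closed_stratum_def)
qed

lemma push_boundary:
  assumes f: "f \<in> closed_stratum F" "supp f \<noteq> F"
  shows "push (t, f) = f"
proof -
  obtain v where v: "v \<in> V" "wdist v f = 0"
    using V_bd[OF f] wdist_zero_iff by blast
  have "Min ((\<lambda>v. wdist v f) ` V) = 0"
  proof (rule antisym)
    show "Min ((\<lambda>v. wdist v f) ` V) \<le> 0"
      using Min_wdist(1)[OF v(1), of f] v(2) by simp
    show "0 \<le> Min ((\<lambda>v. wdist v f) ` V)" by (rule Min_wdist_nonneg)
  qed
  \<comment> \<open>The common numerator of all rates is 0, so the point does not move at any time;
    for a vanishing denominator this uses \<open>0 / 0 = 0\<close>.\<close>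
  then have "rate v f = 0" for v
    by (simp add: rate_def)
  then have "push (t, f) = push (0, f)"
    unfolding push_def by (simp cong: if_cong)
  then show ?thesis using push_0[OF f(1)] by simp
qed

text \<open>A weight of minimal distance has rate 1, and its attenuation at time 1 kills a generator
  of positive weight.\<close>

lemma push_1_supp:
  assumes f: "f \<in> closed_stratum F"
  shows "supp (push (1, f)) \<noteq> F"
proof (cases "supp f = F")
  case False
  then show ?thesis using push_boundary[OF f] by simp
next
  case True
  obtain v where v: "v \<in> V" "Min ((\<lambda>v. wdist v f) ` V) = wdist v f"
    using Min_wdist(2)[of f] by auto
  obtain g where g: "g \<in> gens F" "v g > 0" using V_pos[OF v(1)] by blast
  have "f g \<noteq> 0" using True g by (auto simp: supp_def)
  then have "wdist v f \<noteq> 0" using g wdist_zero_iff by blast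
  then have "rate v f = 1" using v(2) by (simp add: rate_def)
  then have "(\<Prod>v\<in>V. attenuate (1 * rate v f) (v g)) = 0"
    using v(1) g(2) V(1) by (intro prod_zero bexI[of _ v]) auto
  then have "push (1, f) g = 0"
    using g es_carrier by (auto simp: push_def)
  then show ?thesis using g by (auto simp: supp_def)
qed

text \<open>At a point with \<open>f0 x = 0\<close>, the bound \<open>push_le\<close> squeezes the
  value to 0. If \<open>f0 x\<close> is nonzero, every \<open>v\<close> with \<open>v x > 0\<close>
  has nonzero distance, hence a continuous rate, and every \<open>v\<close> with
  \<open>v x = 0\<close> contributes the constant factor 1.\<close>

lemma continuous_on_push: "continuous_on ({0..1} \<times> closed_stratum F) push"
proof (rule continuous_on_coordinatewise_then_product)
  fix x
  let ?S = "{0..1::real} \<times> closed_stratum F"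
  have coord: "continuous_on ?S (\<lambda>p. snd p y)" for y
    by (rule continuous_on_compose2[OF continuous_on_coordinate[of UNIV] continuous_on_snd[OF continuous_on_id]]) simp
  have cd: "continuous_on ?S (\<lambda>p. wdist v (snd p))" for v
    unfolding wdist_def by (intro continuous_intros coord)
  have cm: "continuous_on ?S (\<lambda>p. Min ((\<lambda>v. wdist v (snd p)) ` V))"
    using V cd by (intro continuous_on_Min_image)
  show "continuous_on ?S (\<lambda>p. push p x)"
  proof (cases "x \<in> F")
    case False
    then have "push p x = (if x \<in> carrier M then 0 else undefined)" for p
      by (auto simp: push_def case_prod_beta)
    then show ?thesis by simp
  next
    case True
    then have x: "x \<in> carrier M" using faceD(1)[OF F] by blast
    show ?thesis
      unfolding continuous_on_def
    proof
      fix p0 assume p0: "p0 \<in> ?S"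
      obtain t0 f0 where tf: "p0 = (t0, f0)" "t0 \<in> {0..1}" "f0 \<in> closed_stratum F" using p0 by auto
      have f0X: "f0 \<in> X" using tf by (simp add: closed_stratum_def)
      have lim: "(h \<longlongrightarrow> h p0) (at p0 within ?S)" if "continuous_on ?S h" for h :: "_ \<Rightarrow> real"
        using that p0 unfolding continuous_on_def by blast
      have S: "\<forall>\<^sub>F p in at p0 within ?S. p \<in> ?S"
        by (simp add: eventually_at_topological) blast
      show "((\<lambda>p. push p x) \<longlongrightarrow> push p0 x) (at p0 within ?S)"
      proof (cases "f0 x = 0")
        case zero: True
        have "((\<lambda>p. push p x) \<longlongrightarrow> 0) (at p0 within ?S)"
        proof (rule Lim_null_comparison)
          show "\<forall>\<^sub>F p in at p0 within ?S. norm (push p x) \<le> \<bar>snd p x\<bar>"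
            using S by eventually_elim (use push_le x in auto)
          show "((\<lambda>p. \<bar>snd p x\<bar>) \<longlongrightarrow> 0) (at p0 within ?S)"
            using tendsto_rabs_zero[of "\<lambda>p. snd p x"] lim[OF coord[of x]] zero tf by simp
        qed
        moreover have "push p0 x = 0" using zero x by (simp add: tf push_def)
        ultimately show ?thesis by simp
      next
        case False
        have "((\<lambda>p. attenuate (fst p * rate v (snd p)) (v x)) \<longlongrightarrow>
            attenuate (fst p0 * rate v (snd p0)) (v x)) (at p0 within ?S)" if v: "v \<in> V" for v
        proof (cases "v x = 0")
          case True
          then show ?thesis by simp
        next
          case nz: False
          then have "v x > 0" using weight_nonneg[OF v True] by simp
          then have "wdist v (snd p0) \<noteq> 0"
            using wdist_zero_vanish[OF v f0X _ True] False tf by auto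
          then have "((\<lambda>p. fst p * rate v (snd p)) \<longlongrightarrow> fst p0 * rate v (snd p0)) (at p0 within ?S)"
            unfolding rate_def
            by (intro tendsto_mult tendsto_divide lim[OF cd] lim[OF cm] tendsto_fst tendsto_ident_at)
          then show ?thesis
            by (rule continuous_on_tendsto_compose[OF continuous_on_attenuate[OF weight_nonneg[OF v True]]])
              (use scaled_rate_bounds[OF v] tf S in \<open>auto elim!: eventually_mono\<close>)
        qed
        then have "((\<lambda>p. snd p x * (\<Prod>v\<in>V. attenuate (fst p * rate v (snd p)) (v x))) \<longlongrightarrow>
            snd p0 x * (\<Prod>v\<in>V. attenuate (fst p0 * rate v (snd p0)) (v x))) (at p0 within ?S)"
          by (intro tendsto_mult tendsto_prod lim[OF coord])
        then show ?thesis
          using True x by (simp add: push_def case_prod_beta)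
      qed
    qed
  qed
qed

end

section \<open>Removing the strata of non-idempotent faces\<close>

definition idem_faces :: "'a set set" where
  "idem_faces = divisors ` (idems - {absorb M})"

definition strata :: "'a set set \<Rightarrow> ('a \<Rightarrow> real) set" where
  "strata \<A> = {f \<in> X. supp f \<in> \<A>}"

lemma idem_facesI:
  assumes "face F" "e \<in> idems" "F = divisors e"
  shows "F \<in> idem_faces"
proof -
  have "e \<in> divisors e" using assms(2) by (auto simp: idems_def divisors_def)
  then have "e \<noteq> absorb M" using faceD(3)[OF assms(1)] assms(3) by auto
  then show ?thesis using assms by (auto simp: idem_faces_def)
qed

text \<open>The value \<open>f c\<close> is nonzero on the support and can be cancelled in the
  reals.\<close>

lemma stratum_in_closed:
  assumes "f \<in> X" "supp f = F"
  shows "f \<in> closed_stratum F"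
proof -
  have eq: "f x = f y" if "x \<in> F" "y \<in> F" "c \<in> F" "x \<otimes> c = y \<otimes> c" for x y c
  proof -
    have "x \<in> carrier M" "y \<in> carrier M" "c \<in> carrier M" "f c \<noteq> 0"
      using that assms(2) by (auto simp: supp_def)
    then show ?thesis
      using that(4) binoid_hom_realD(3)[OF assms(1)] by (metis mult_cancel_right)
  qed
  show ?thesis
    unfolding closed_stratum_def
  proof (intro CollectI conjI ballI impI)
    show "f x = 0" if "x \<in> carrier M - F" for x
      using that assms(2) by (auto simp: supp_def)
  qed (rule assms(1), rule eq)
qed

lemma closed_stratum_supp: "f \<in> closed_stratum F \<Longrightarrow> supp f \<subseteq> F"
  unfolding closed_stratum_def supp_def by blast

lemma closed_stratum_closedin:
  assumes "closed_stratum F \<subseteq> W" "W \<subseteq> X"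
  shows "closedin (top_of_set W) (closed_stratum F)"
proof -
  let ?C = "(\<Inter>x\<in>carrier M - F. {f :: 'a \<Rightarrow> real. f x = 0}) \<inter>
    (\<Inter>(x, y)\<in>{(x, y). x \<in> F \<and> y \<in> F \<and> (\<exists>c\<in>F. x \<otimes> c = y \<otimes> c)}. {f. f x = f y})"
  have "closed ?C"
    by (intro closed_Int closed_INT ballI, auto intro!: closed_Collect_eq continuous_on_coordinate)
  then have "closedin (top_of_set W) (W \<inter> ?C)"
    by (rule closedin_closed_Int)
  moreover have "closed_stratum F = W \<inter> ?C"
  proof (intro equalityI subsetI)
    show "f \<in> W \<inter> ?C" if "f \<in> closed_stratum F" for f
      using that assms(1) unfolding closed_stratum_def by blast
    show "f \<in> closed_stratum F" if "f \<in> W \<inter> ?C" for f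
      unfolding closed_stratum_def
    proof (intro CollectI conjI ballI impI)
      note 1 = INT_D[OF IntD1[OF IntD2[OF that]]] and 2 = INT_D[OF IntD2[OF IntD2[OF that]]]
      show "f \<in> X" using IntD1[OF that] assms(2) by (rule subsetD[rotated])
      show "f x = 0" if "x \<in> carrier M - F" for x
        using 1[OF that] by simp
      fix x y c assume "x \<in> F" "y \<in> F" "c \<in> F" "x \<otimes> c = y \<otimes> c"
      then show "f x = f y" using 2[of "(x, y)"] by auto
    qed
  qed
  ultimately show ?thesis by (simp only:)
qed

text \<open>\<open>push\<close> on \<open>closed_stratum F\<close> and the identity on the other
  strata are glued along closed sets. Downward closure of \<open>\<F>\<close> keeps the pushed
  points inside, and maximality of \<open>F\<close> makes its stratum open.\<close>

lemma strata_remove_maximal: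
  assumes \<F>: "\<And>F. F \<in> \<F> \<Longrightarrow> face F \<and> F \<notin> idem_faces"
    and down: "\<And>F G. \<lbrakk>F \<in> \<F>; face G; G \<notin> idem_faces; G \<subseteq> F\<rbrakk> \<Longrightarrow> G \<in> \<F>"
    and F: "F \<in> \<F>" and max: "\<And>G. \<lbrakk>G \<in> \<F>; F \<subseteq> G\<rbrakk> \<Longrightarrow> G = F"
  shows "top_of_set (strata (\<F> \<union> idem_faces)) homotopy_equivalent_space
    top_of_set (strata (\<F> - {F} \<union> idem_faces))"
proof -
  have face: "face F" and nonidem: "F \<notin> idem_faces" using \<F>[OF F] by auto
  have "\<not> (\<exists>e\<in>idems. F = divisors e)"
    using idem_facesI[OF face] nonidem by blast
  then obtain V where V: "weight_family F V"
  proof (rule boundary_weights[OF face])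
    fix V
    assume V: "finite V" "V \<noteq> {}" "\<And>v. v \<in> V \<Longrightarrow> weight F v" "\<And>v. v \<in> V \<Longrightarrow> \<exists>g\<in>gens F. v g > 0"
      "\<And>f. \<lbrakk>f \<in> closed_stratum F; supp f \<noteq> F\<rbrakk> \<Longrightarrow> \<exists>v\<in>V. \<forall>g\<in>gens F. v g > 0 \<longrightarrow> f g = 0"
    have "weight_family F V"
      unfolding weight_family_def using V by (intro conjI ballI impI)
    then show ?thesis by (rule that)
  qed
  let ?W = "strata (\<F> \<union> idem_faces)" and ?A = "strata (\<F> - {F} \<union> idem_faces)"
  let ?Y = "closed_stratum F"
  let ?K = "\<lambda>p. if snd p \<in> ?Y then push F V p else snd p"
  have AW: "?A \<subseteq> ?W" by (auto simp: strata_def)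
  have WX: "?W \<subseteq> X" by (auto simp: strata_def)
  have lower: "f \<in> ?W" if "f \<in> X" "supp f \<subseteq> F" for f
    using down[OF F face_supp[OF that(1)] _ that(2)] that(1) by (auto simp: strata_def)
  have YW: "?Y \<subseteq> ?W"
    using lower closed_stratum_supp by (auto simp: closed_stratum_def)
  have AY: "supp f \<noteq> F" if "f \<in> ?A" for f
    using that nonidem by (auto simp: strata_def)
  have WA: "f \<in> ?A" if "f \<in> ?W" "supp f \<noteq> F" for f
    using that by (auto simp: strata_def)
  have cover: "?W = ?Y \<union> ?A"
    using YW AW WA WX stratum_in_closed by blast
  have "closedin (top_of_set ?W) ?A"
  proof -
    \<comment> \<open>Maximality excludes larger faces only within \<open>\<F>\<close>; faces of
      idempotents \<open>e\<close> outside \<open>F\<close> may still contain \<open>F\<close>. On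
      their strata \<open>f e = 1\<close>, which \<open>f e < 1\<close> rules out. Finiteness of
      \<open>idems\<close> keeps \<open>Nb\<close> open.\<close>
    define Nb where "Nb = (\<Inter>g\<in>gens F. {f :: 'a \<Rightarrow> real. f g \<noteq> 0}) \<inter> (\<Inter>e\<in>idems - F. {f. f e < 1})"
    have "open Nb"
      unfolding Nb_def
      by (intro open_Int open_INT ballI open_Collect_neq open_Collect_less continuous_on_coordinate
          continuous_on_const) (use finite_idems in auto)
    then have "closedin (top_of_set ?W) (?W - ?W \<inter> Nb)"
      by (intro closedin_diff) (auto intro: openin_open_Int)
    moreover have Nb_iff: "f \<in> Nb \<longleftrightarrow> supp f = F" if f: "f \<in> ?W" for f
    proof
      have fX: "f \<in> X" using f WX by blast
      note G = face_supp[OF fX]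
      assume fNb: "f \<in> Nb"
      have sub: "F \<subseteq> supp f"
        by (rule face_subsetI[OF face G]) (use fNb es_carrier in \<open>auto simp: Nb_def supp_def\<close>)
      have e: "e \<in> F" if "e \<in> idems" "e \<in> supp f" for e
        using fNb that idem_value[OF fX that(1)] by (force simp: Nb_def supp_def)
      show "supp f = F"
      proof (cases "supp f \<in> idem_faces")
        case True
        then obtain e where e': "e \<in> idems" "supp f = divisors e" by (auto simp: idem_faces_def)
        then have "e \<in> F" using e by (auto simp: idems_def divisors_def)
        then have "divisors e \<subseteq> F"
          using faceD(4)[OF face] by (auto simp: divisors_def)
        then show ?thesis using sub e' by blast
      next
        case False
        then show ?thesis using f max sub by (auto simp: strata_def)
      qed
    next
      assume "supp f = F"
      then show "f \<in> Nb"
        using idems_closed by (auto simp: Nb_def supp_def)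
    qed
    moreover have "?W - ?W \<inter> Nb = ?A"
    proof (intro equalityI subsetI)
      show "f \<in> ?A" if "f \<in> ?W - ?W \<inter> Nb" for f
        using that Nb_iff[of f] WA[of f] by simp
      show "f \<in> ?W - ?W \<inter> Nb" if "f \<in> ?A" for f
        using subsetD[OF AW that] AY[OF that] Nb_iff[of f] by simp
    qed
    ultimately show ?thesis by simp
  qed
  then have "closedin (top_of_set ({0..1::real} \<times> ?W)) ({0..1} \<times> ?A)"
    by (intro closedin_Times) auto
  moreover have "closedin (top_of_set ({0..1::real} \<times> ?W)) ({0..1} \<times> ?Y)"
    by (intro closedin_Times closed_stratum_closedin YW WX) auto
  moreover have eq: "{0..1::real} \<times> ?W = {0..1} \<times> ?Y \<union> {0..1} \<times> ?A"
    using cover by blast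
  moreover have "push F V p = snd p" if "snd p \<in> ?Y" "snd p \<in> ?A" for p
    using push_boundary[OF face V that(1) AY[OF that(2)], of "fst p"] by simp
  ultimately have cont: "continuous_on ({0..1} \<times> ?W) ?K"
    unfolding eq
    by (intro continuous_on_cases_local continuous_on_push[OF face V] continuous_on_snd continuous_on_id)
      auto
  have YX: "f \<in> X" "\<And>x. x \<in> carrier M - F \<Longrightarrow> f x = 0" if "f \<in> ?Y" for f
    using that by (auto simp: closed_stratum_def)
  have push_W: "push F V (t, f) \<in> ?W" if "t \<in> {0..1}" "f \<in> ?Y" for t f
    using lower push_hom[OF face V YX[OF that(2)] that(1)] push_supp[OF face V that(1)] by blast
  show ?thesis
  proof (rule deformation_imp_homotopy_equivalent[OF cont])
    show "?K (t, f) \<in> ?W" if "t \<in> {0..1}" "f \<in> ?W" for t f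
      using push_W that by simp
    show "?K (0, f) = f" if "f \<in> ?W" for f
      using push_0[OF face V] by simp
    show "?K (1, f) \<in> ?A" if "f \<in> ?W" for f
      using push_W[of 1 f] push_1_supp[OF face V, of f] WA that cover by auto
    show "?K (1, f) = f" if "f \<in> ?A" for f
      using push_boundary[OF face V _ AY[OF that]] by simp
  qed (rule AW)
qed

lemma X_homotopy_equivalent_idem_strata:
  "top_of_set X homotopy_equivalent_space top_of_set (strata idem_faces)"
proof -
  have *: "top_of_set (strata (\<F> \<union> idem_faces)) homotopy_equivalent_space top_of_set (strata idem_faces)"
    if "finite \<F>" "\<And>F. F \<in> \<F> \<Longrightarrow> face F \<and> F \<notin> idem_faces"
      "\<And>F G. \<lbrakk>F \<in> \<F>; face G; G \<notin> idem_faces; G \<subseteq> F\<rbrakk> \<Longrightarrow> G \<in> \<F>" for \<F>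
    using that
  proof (induction "card \<F>" arbitrary: \<F>)
    case 0
    then show ?case by (simp add: homotopy_equivalent_space_refl)
  next
    case (Suc n)
    then have "\<F> \<noteq> {}" by auto
    then obtain F where F: "F \<in> \<F>" "\<And>G. \<lbrakk>G \<in> \<F>; F \<subseteq> G\<rbrakk> \<Longrightarrow> G = F"
      using finite_has_maximal[OF Suc.prems(1)] by metis
    have "top_of_set (strata (\<F> - {F} \<union> idem_faces)) homotopy_equivalent_space top_of_set (strata idem_faces)"
    proof (rule Suc.hyps(1))
      show "n = card (\<F> - {F})" using Suc.hyps(2) Suc.prems(1) F(1) by simp
      show "finite (\<F> - {F})" using Suc.prems(1) by simp
      show "face G \<and> G \<notin> idem_faces" if "G \<in> \<F> - {F}" for G
        using Suc.prems(2) that by blast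
      \<comment> \<open>Removing a maximal face preserves downward closure: \<open>H = F\<close>
        would put \<open>F\<close> below \<open>G\<close> and force \<open>G = F\<close>.\<close>
      show "H \<in> \<F> - {F}" if "G \<in> \<F> - {F}" "face H" "H \<notin> idem_faces" "H \<subseteq> G" for G H
        using Suc.prems(3)[of G H] F(2)[of G] that by blast
    qed
    moreover have "top_of_set (strata (\<F> \<union> idem_faces)) homotopy_equivalent_space
        top_of_set (strata (\<F> - {F} \<union> idem_faces))"
      by (rule strata_remove_maximal[OF Suc.prems(2,3) F])
    from this calculation show ?case
      by (rule homotopy_eqv_trans)
  qed
  let ?\<F> = "{F. face F \<and> F \<notin> idem_faces}"
  have "strata (?\<F> \<union> idem_faces) = X"
    unfolding strata_def using face_supp by blast
  moreover have "finite ?\<F>"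
    by (rule finite_subset[OF _ finite_faces]) blast
  then have "top_of_set (strata (?\<F> \<union> idem_faces)) homotopy_equivalent_space top_of_set (strata idem_faces)"
    by (rule *) blast+
  ultimately show ?thesis by simp
qed

text \<open>On these strata, nonvanishing at \<open>x\<close> is expressed by finitely many closed
  conditions \<open>f e = 1\<close>, so it is both an open and a closed condition.\<close>

lemma idem_strata_supp_iff:
  assumes f: "f \<in> strata idem_faces" and x: "x \<in> carrier M"
  shows "f x \<noteq> 0 \<longleftrightarrow> (\<exists>e\<in>{e \<in> idems. x \<in> divisors e}. f e = 1)"
proof
  have fX: "f \<in> X" using f by (simp add: strata_def)
  obtain e where e: "e \<in> idems" "supp f = divisors e"
    using f by (auto simp: strata_def idem_faces_def)
  have "e \<in> divisors e" using e by (auto simp: idems_def divisors_def)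
  then have "f e = 1" using e idem_value[OF fX e(1)] by (auto simp: supp_def)
  then show "\<exists>e\<in>{e \<in> idems. x \<in> divisors e}. f e = 1" if "f x \<noteq> 0"
    using that x e by (auto simp: supp_def)
next
  assume "\<exists>e\<in>{e \<in> idems. x \<in> divisors e}. f e = 1"
  then obtain e y where e: "f e = 1" "y \<in> carrier M" "x \<otimes> y = e" by (auto simp: divisors_def)
  have "f \<in> X" using f by (simp add: strata_def)
  from binoid_hom_realD(3)[OF this x e(2)] show "f x \<noteq> 0"
    using e by auto
qed

definition all_sign_chars :: "('a \<Rightarrow> real) set" where
  "all_sign_chars = \<Union> (sign_chars ` idem_faces)"

text \<open>Raising absolute values to the power \<open>1 - t\<close> is multiplicative and ends at
  the sign. Near zeros this would not be continuous at \<open>t = 1\<close>; it is, because the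
  points where \<open>f x\<close> vanishes and those where it does not form two disjoint closed
  sets.\<close>

lemma idem_strata_homotopy_equivalent:
  "top_of_set (strata idem_faces) homotopy_equivalent_space top_of_set all_sign_chars"
proof -
  let ?Z = "strata idem_faces"
  let ?K = "\<lambda>p. \<lambda>x\<in>carrier M. if snd p x = 0 then 0 else sgn (snd p x) * \<bar>snd p x\<bar> powr (1 - fst p)"
  have ZX: "f \<in> X" if "f \<in> ?Z" for f using that by (simp add: strata_def)
  have cont: "continuous_on ({0..1} \<times> ?Z) ?K"
  proof (rule continuous_on_coordinatewise_then_product)
    fix x
    show "continuous_on ({0..1} \<times> ?Z) (\<lambda>p. ?K p x)"
    proof (cases "x \<in> carrier M")
      case True
      let ?Null = "{f \<in> ?Z. f x = 0}" and ?Nonnull = "{f \<in> ?Z. f x \<noteq> 0}"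
      have Z0: "closedin (top_of_set ?Z) ?Null"
      proof -
        have "closed {f :: 'a \<Rightarrow> real. f x = 0}"
          by (intro closed_Collect_eq continuous_on_coordinate continuous_on_const)
        then have "closedin (top_of_set ?Z) (?Z \<inter> {f. f x = 0})"
          by (rule closedin_closed_Int)
        moreover have "?Z \<inter> {f. f x = 0} = ?Null" by blast
        ultimately show ?thesis by simp
      qed
      have "closed (\<Union>e\<in>{e \<in> idems. x \<in> divisors e}. {f :: 'a \<Rightarrow> real. f e = 1})"
        by (intro closed_UN ballI closed_Collect_eq continuous_on_coordinate continuous_on_const)
          (use finite_idems in auto)
      then have "closedin (top_of_set ?Z) (?Z \<inter> (\<Union>e\<in>{e \<in> idems. x \<in> divisors e}. {f. f e = 1}))"
        by (rule closedin_closed_Int)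
      moreover have "?Z \<inter> (\<Union>e\<in>{e \<in> idems. x \<in> divisors e}. {f. f e = 1}) = ?Nonnull"
      proof (rule Set.set_eqI)
        fix f
        show "f \<in> ?Z \<inter> (\<Union>e\<in>{e \<in> idems. x \<in> divisors e}. {f. f e = 1}) \<longleftrightarrow> f \<in> ?Nonnull"
          by (cases "f \<in> ?Z") (use idem_strata_supp_iff[OF _ True, of f] in simp_all)
      qed
      ultimately have Z1: "closedin (top_of_set ?Z) ?Nonnull" by simp
      have eq: "{0..1::real} \<times> ?Z = {0..1} \<times> ?Null \<union> {0..1} \<times> ?Nonnull" by auto
      have coord: "continuous_on S (\<lambda>p :: real \<times> ('a \<Rightarrow> real). snd p x)" for S
        by (rule continuous_on_compose2[OF continuous_on_coordinate[of UNIV] continuous_on_snd[OF continuous_on_id]])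
          simp
      have "continuous_on ({0..1} \<times> ?Null \<union> {0..1} \<times> ?Nonnull)
        (\<lambda>p. if snd p x = 0 then 0 else sgn (snd p x) * \<bar>snd p x\<bar> powr (1 - fst p))"
      proof (rule continuous_on_cases_local)
        show "closedin (top_of_set ({0..1} \<times> ?Null \<union> {0..1} \<times> ?Nonnull)) ({0..1::real} \<times> ?Null)"
          unfolding eq[symmetric] by (intro closedin_Times Z0) auto
        show "closedin (top_of_set ({0..1} \<times> ?Null \<union> {0..1} \<times> ?Nonnull)) ({0..1::real} \<times> ?Nonnull)"
          unfolding eq[symmetric] by (intro closedin_Times Z1) auto
        show "continuous_on ({0..1} \<times> ?Nonnull) (\<lambda>p. sgn (snd p x) * \<bar>snd p x\<bar> powr (1 - fst p))"
          by (intro continuous_intros coord) auto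
      qed auto
      then show ?thesis using True unfolding eq[symmetric] by simp
    qed simp
  qed
  have supp_K: "supp (?K (t, f)) = supp f" for t f
    by (auto simp: supp_def sgn_if)
  have hom_K: "?K (t, f) \<in> X" if "f \<in> X" for t f
    unfolding binoid_hom_real_iff
    using binoid_hom_realD(1-3)[OF that]
    by (auto simp: absorb_closed sgn_mult abs_mult powr_mult)
  show ?thesis
  proof (rule deformation_imp_homotopy_equivalent[OF cont])
    show "?K (t, f) \<in> ?Z" if "f \<in> ?Z" for t f
      using that hom_K supp_K by (simp add: strata_def)
    show "?K (0, f) = f" if "f \<in> ?Z" for f
    proof
      show "?K (0, f) x = f x" for x
        using binoid_hom_realD(4)[OF ZX[OF that], of x] by (simp add: sgn_mult_abs abs_mult_sgn mult.commute)
    qed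
    show "?K (1, f) \<in> all_sign_chars" if f: "f \<in> ?Z" for f
    proof -
      have "?K (1, f) \<in> sign_chars (supp f)"
        using hom_K[OF ZX[OF f]] supp_K[of 1 f] unfolding sign_chars_def
        by (auto simp: supp_def sgn_if)
      then show ?thesis using f by (auto simp: all_sign_chars_def strata_def)
    qed
    show "all_sign_chars \<subseteq> ?Z"
      by (auto simp: all_sign_chars_def sign_chars_def strata_def)
    show "?K (1, f) = f" if f: "f \<in> all_sign_chars" for f
    proof
      have "f \<in> X" using f by (auto simp: all_sign_chars_def sign_chars_def)
      then show "?K (1, f) x = f x" for x
        using f binoid_hom_realD(4)[of f M x]
        by (auto simp: all_sign_chars_def sign_chars_def supp_def)
    qed
  qed
qed

lemma sign_chars_disjoint:
  "F \<noteq> G \<Longrightarrow> sign_chars F \<inter> sign_chars G = {}"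
  by (auto simp: sign_chars_def)

lemma finite_Adm: "finite (Adm M)"
proof (rule finite_subset)
  show "Adm M \<subseteq> Pow idems"
  proof
    fix r assume "r \<in> Adm M"
    then show "r \<in> Pow idems" using Adm_iff[of r] by simp
  qed
qed (simp add: finite_idems)

text \<open>Sign characters of different faces have different supports. The sum over nonzero
  idempotents is reindexed along \<open>e \<mapsto> idems - divisors e\<close>, a bijection onto
  \<open>Adm M\<close>.\<close>

lemma card_all_sign_chars:
  "finite all_sign_chars" "card all_sign_chars = (\<Sum>r\<in>Adm M. 2 ^ adm_rank M r)"
proof -
  let ?I = "idems - {absorb M}"
  have fin: "finite ?I" using finite_idems by simp
  have all: "all_sign_chars = (\<Union>e\<in>?I. sign_chars (divisors e))"
    by (simp add: all_sign_chars_def idem_faces_def)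
  show "finite all_sign_chars"
    unfolding all using fin card_sign_chars(1) by auto
  have inj: "inj_on (\<lambda>e. idems - divisors e) ?I"
  proof (rule inj_onI)
    fix e g assume eg: "e \<in> ?I" "g \<in> ?I" "idems - divisors e = idems - divisors g"
    then have "e \<in> divisors g" "g \<in> divisors e"
      by (auto simp: idems_def divisors_def set_eq_iff)
    then have "e \<otimes> g = g" "g \<otimes> e = e"
      using idem_divisors_iff eg idems_closed by auto
    then show "e = g" using m_comm[of e g] eg idems_closed by auto
  qed
  have Adm: "Adm M = (\<lambda>e. idems - divisors e) ` ?I"
  proof (intro equalityI subsetI)
    fix r assume "r \<in> Adm M"
    then obtain e where "e \<in> idems" "e \<noteq> absorb M" "r = idems - divisors e" by (rule Adm_idem)
    then show "r \<in> (\<lambda>e. idems - divisors e) ` ?I" by blast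
  qed (use idem_Adm in auto)
  have "card all_sign_chars = (\<Sum>e\<in>?I. card (sign_chars (divisors e)))"
    unfolding all
  proof (rule card_UN_disjoint[OF fin])
    show "\<forall>e\<in>?I. finite (sign_chars (divisors e))" using card_sign_chars(1) by auto
    show "\<forall>e\<in>?I. \<forall>g\<in>?I. e \<noteq> g \<longrightarrow> sign_chars (divisors e) \<inter> sign_chars (divisors g) = {}"
    proof (intro ballI impI)
      fix e g assume "e \<in> ?I" "g \<in> ?I" "e \<noteq> g"
      then have "divisors e \<noteq> divisors g" using divisors_inj[of e g] by auto
      then show "sign_chars (divisors e) \<inter> sign_chars (divisors g) = {}" by (rule sign_chars_disjoint)
    qed
  qed
  also have "\<dots> = (\<Sum>e\<in>?I. 2 ^ adm_rank M (idems - divisors e))"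
    using card_sign_chars(2) by (intro sum.cong) auto
  also have "\<dots> = (\<Sum>r\<in>Adm M. 2 ^ adm_rank M r)"
    unfolding Adm by (simp add: sum.reindex[OF inj])
  finally show "card all_sign_chars = (\<Sum>r\<in>Adm M. 2 ^ adm_rank M r)" .
qed

end

section \<open>The real spectrum as a space of functions\<close>

lemma finite_function_set_discrete:
  fixes S :: "('a \<Rightarrow> real) set"
  assumes "finite S"
  shows "top_of_set S = discrete_topology S"
proof -
  have "t1_space (euclidean :: ('a \<Rightarrow> real) topology)"
    unfolding euclidean_product_topology[symmetric] t1_space_product_topology
    by (auto intro: Hausdorff_imp_t1_space)
  then show ?thesis
    using subtopology_eq_discrete_topology_finite[of euclidean S] assms by simp
qed

text \<open>Evaluation at every element of the carrier is continuous, and off the carrier all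
  homomorphisms are \<open>undefined\<close>. So the topology is that of pointwise convergence, in
  which the deformations above are continuous.\<close>

lemma RSpec_eq_top_of_set:
  assumes "generated_by M es"
  shows "RSpec M es = top_of_set (binoid_hom M real_binoid)"
proof -
  let ?X = "binoid_hom M real_binoid"
  let ?ev = "\<lambda>f. \<lambda>i\<in>{..<length es}. f (es ! i)"
  have "continuous_map (RSpec M es) (top_of_set ?X) (\<lambda>f. f)"
  proof (subst continuous_map_in_subtopology, intro conjI)
    have "continuous_map (RSpec M es) euclidean (\<lambda>f. f x)" for x
    proof (cases "x \<in> carrier M")
      case False
      have "continuous_map (RSpec M es) euclidean (\<lambda>f. undefined)" by simp
      then show ?thesis
        by (rule continuous_map_eq)
          (use False in \<open>auto simp: topspace_RSpec binoid_hom_def extensional_def\<close>)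
    qed (rule continuous_map_RSpec_eval[OF assms])
    then show "continuous_map (RSpec M es) euclidean (\<lambda>f. f)"
      unfolding euclidean_product_topology[symmetric] continuous_map_componentwise_UNIV by blast
  qed (simp add: topspace_RSpec)
  moreover have "continuous_map (top_of_set ?X) (RSpec M es) (\<lambda>f. f)"
    unfolding RSpec_def
  proof (rule continuous_map_pullback')
    have "continuous_map (top_of_set ?X) (powertop_real {..<length es}) ?ev"
      unfolding continuous_map_componentwise
      by (auto intro!: continuous_on_coordinate)
    then show "continuous_map (top_of_set ?X) (powertop_real {..<length es}) (?ev \<circ> (\<lambda>f. f))"
      by (simp add: comp_def)
  qed auto
  ultimately have "homeomorphic_map (RSpec M es) (top_of_set ?X) (\<lambda>f. f)"
    by (subst homeomorphic_map_maps) (auto simp: homeomorphic_maps_def)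
  then have "homeomorphic_map (RSpec M es) (top_of_set ?X) id"
    by (simp only: id_def)
  then show ?thesis by simp
qed

section \<open>Elementary abelian 2-groups and discrete spaces\<close>

lemma (in elementary_binoid) generate_generated_by:
  assumes gen: "generated_by T gs" and gs: "set gs \<subseteq> carrier E"
  shows "generate E (set gs) = carrier E"
proof
  interpret E: comm_group E by (rule comm_group_E)
  show "generate E (set gs) \<subseteq> carrier E"
    by (rule E.generate_incl[OF gs])
  have zero: "absorb T \<otimes> y = absorb T" "y \<otimes> absorb T = absorb T" if "y \<in> carrier T" for y
    using that absorb_mult m_comm absorb_closed by auto
  have span: "binoid_span T (set gs) = carrier T"
    using gen by (simp add: generated_by_def)
  have "x \<noteq> absorb T \<longrightarrow> x \<in> generate E (set gs)" if "x \<in> binoid_span T (set gs)" for x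
    using that
  proof induction
    case one
    then show ?case using generate.one[of E "set gs"] by simp
  next
    case (mult x y)
    then have "x \<in> carrier T" "y \<in> carrier T" using span by auto
    then show ?case
      using mult.IH zero generate.eng[of x E "set gs" y] by (cases "x = absorb T \<or> y = absorb T") auto
  qed (auto intro: generate.incl)
  then show "carrier E \<subseteq> generate E (set gs)"
    using span by auto
qed

lemma elementary_adjoin_zero:
  assumes "comm_group G" "\<And>x. x \<in> carrier G \<Longrightarrow> x \<otimes>\<^bsub>G\<^esub> x = \<one>\<^bsub>G\<^esub>"
  shows "elementary_binoid (adjoin_zero G)"
proof -
  interpret G: comm_group G by fact
  interpret comm_binoid "adjoin_zero G"
    by (rule comm_binoidI)
      (auto simp: adjoin_zero_def G.m_ac split: option.splits)
  show ?thesis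
    by unfold_locales (use assms(2) in \<open>auto simp: adjoin_zero_def\<close>)
qed

lemma elementary_C2_power: "elementary_binoid (C2_power n)"
  unfolding C2_power_def
proof (rule elementary_adjoin_zero)
  show "comm_group (product_group {..<n} (\<lambda>_. integer_mod_group 2))"
    by (rule group.group_comm_groupI) (auto simp: add.commute intro!: restrict_ext)
  show "x \<otimes>\<^bsub>product_group {..<n} (\<lambda>_. integer_mod_group 2)\<^esub> x = \<one>\<^bsub>product_group {..<n} (\<lambda>_. integer_mod_group 2)\<^esub>"
    for x :: "nat \<Rightarrow> int"
    by (auto simp: product_group_def integer_mod_group_def intro!: restrict_ext)
qed

lemma elementary_C2: "elementary_binoid C2"
  unfolding C2_def
proof (rule elementary_adjoin_zero)
  show "comm_group (integer_mod_group 2)"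
    by (rule group.group_comm_groupI) (auto simp: add.commute)
qed auto

lemma characters_C2_power:
  "finite (binoid_hom (C2_power n) real_binoid)" "card (binoid_hom (C2_power n) real_binoid) = 2 ^ n"
proof -
  interpret elementary_binoid "C2_power n" by (rule elementary_C2_power)
  interpret E: comm_group E by (rule comm_group_E)
  let ?e = "\<lambda>i. \<lambda>j\<in>{..<n}. if j = i then 1 else (0::int)" and ?S = "set (C2_power_gens n)"
  have S: "?S = (\<lambda>i. Some (?e i)) ` {..<n}"
    by (auto simp: C2_power_gens_def)
  have inj: "inj_on (\<lambda>i. Some (?e i)) {..<n}"
  proof (rule inj_onI)
    fix i j assume i: "i \<in> {..<n}" and eq: "Some (?e i) = Some (?e j)"
    show "i = j" using arg_cong[OF eq, of "\<lambda>x. the x i"] i by (simp split: if_splits)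
  qed
  have "absorb (C2_power n) = None"
    by (simp add: C2_power_def adjoin_zero_def)
  then have sub: "?S \<subseteq> carrier E"
    using generated_by_C2_power[of n] by (auto simp: generated_by_def S)
  have mult: "Some a \<otimes>\<^bsub>C2_power n\<^esub> Some b = Some (\<lambda>i\<in>{..<n}. (a i + b i) mod 2)" for a b
    by (simp add: C2_power_def adjoin_zero_def product_group_def integer_mod_group_def)
  have one_eq: "\<one>\<^bsub>C2_power n\<^esub> = Some (\<lambda>i\<in>{..<n}. 0)"
    by (simp add: C2_power_def adjoin_zero_def product_group_def integer_mod_group_def)
  have indep: "s \<notin> generate E (?S - {s})" if "s \<in> ?S" for s
  proof
    obtain i where i: "i < n" "s = Some (?e i)" using \<open>s \<in> ?S\<close> S by auto
    \<comment> \<open>The standard generators other than \<open>s\<close>, and all products of them,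
      vanish in coordinate \<open>i\<close>, where \<open>s\<close> is 1.\<close>
    have "\<exists>v. x = Some v \<and> v i = 0" if "x \<in> generate E (?S - {s})" for x
      using that
    proof induction
      case one
      then show ?case using \<open>i < n\<close> by (simp add: one_eq)
    next
      case (incl h)
      then show ?case using i S by auto
    next
      case (inv h)
      then have "inv\<^bsub>E\<^esub> h = h" using sub by (intro inv_E) auto
      then show ?case using inv i S by auto
    next
      case (eng x y)
      then show ?case using i(1) mult by auto
    qed
    moreover assume "s \<in> generate E (?S - {s})"
    ultimately show False using i by fastforce
  qed
  note C = card_characters[OF _ sub generate_generated_by[OF generated_by_C2_power sub] indep]
  have "card ?S = n"
    unfolding S using card_image[OF inj] by simp
  then show "finite (binoid_hom (C2_power n) real_binoid)"
    "card (binoid_hom (C2_power n) real_binoid) = 2 ^ n"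
    using C by simp_all
qed

lemma characters_C2: "finite (binoid_hom C2 real_binoid)" "card (binoid_hom C2 real_binoid) = 2"
proof -
  interpret elementary_binoid C2 by (rule elementary_C2)
  interpret E: comm_group E by (rule comm_group_E)
  let ?S = "set C2_gens"
  have "absorb C2 = None"
    by (simp add: C2_def adjoin_zero_def)
  then have sub: "?S \<subseteq> carrier E"
    using generated_by_C2 by (auto simp: generated_by_def C2_gens_def)
  have "\<one>\<^bsub>C2\<^esub> = Some 0"
    by (simp add: C2_def adjoin_zero_def)
  then have indep: "s \<notin> generate E (?S - {s})" if "s \<in> ?S" for s
    using that E.generate_empty by (simp add: C2_gens_def)
  note C = card_characters[OF _ sub generate_generated_by[OF generated_by_C2 sub] indep]
  show "finite (binoid_hom C2 real_binoid)" "card (binoid_hom C2 real_binoid) = 2"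
    using C by (simp_all add: C2_gens_def)
qed

lemma RSpec_finite_discrete:
  assumes "generated_by M es" "finite (binoid_hom M real_binoid)"
  shows "RSpec M es = discrete_topology (binoid_hom M real_binoid)"
  using RSpec_eq_top_of_set[OF assms(1)] finite_function_set_discrete[OF assms(2)] by simp

lemma product_discrete_topology:
  assumes "finite I" "finite D"
  shows "product_topology (\<lambda>_. discrete_topology D) I = discrete_topology (I \<rightarrow>\<^sub>E D)"
  by (rule finite_t1_space_imp_discrete_topology)
    (use assms in \<open>auto simp: t1_space_product_topology finite_PiE intro: Hausdorff_imp_t1_space\<close>)

lemma sum_discrete_topology:
  "sum_topology (\<lambda>i. discrete_topology (D i)) I = discrete_topology (Sigma I D)"
  by (auto simp: topology_eq openin_sum_topology)

lemma discrete_homotopy_equivalent: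
  assumes "finite A" "finite B" "card A = card B"
  shows "discrete_topology A homotopy_equivalent_space discrete_topology B"
proof -
  obtain h where "bij_betw h A B"
    using finite_same_card_bij[OF assms] by blast
  then have "homeomorphic_map (discrete_topology A) (discrete_topology B) h"
    by (auto simp: bij_betw_def homeomorphic_map_def quotient_map_def)
  then show ?thesis
    by (intro homeomorphic_imp_homotopy_equivalent_space homeomorphic_map_imp_homeomorphic_space)
qed

lemma groupoid_discrete: "groupoid (discrete_groupoid k)"
  by unfold_locales (auto simp: discrete_groupoid_def split: if_splits)

text \<open>The comparison of two apexes evaluates universal properties only at the apexes
  themselves; this is why \<open>P\<close> is tested against groupoids of the types of
  \<open>adm_coproduct M\<close> and of \<open>P\<close>.\<close>

theorem corollary3p0p2:
  fixes M :: "'a binoid" and es :: "'a list"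
  assumes "comm_binoid M" and "generated_by M es"
  shows "RSpec M es homotopy_equivalent_space
      sum_topology (\<lambda>r. RSpec (C2_power (adm_rank M r)) (C2_power_gens (adm_rank M r))) (Adm M) \<and>
    sum_topology (\<lambda>r. RSpec (C2_power (adm_rank M r)) (C2_power_gens (adm_rank M r))) (Adm M)
      homotopy_equivalent_space
      sum_topology (\<lambda>r. product_topology (\<lambda>_. RSpec C2 C2_gens) {..<adm_rank M r}) (Adm M) \<and>
    groupoid_equivalent (fundamental_groupoid (RSpec M es)) (adm_coproduct M) \<and>
    groupoid_cocone (Adm M) (adm_discrete M) (adm_coproduct M) coproduct_incl \<and>
    (\<forall>H :: ('h, 'k) groupoid. groupoid H \<longrightarrow>
      coproduct_for (Adm M) (adm_discrete M) (adm_coproduct M) coproduct_incl H \<and>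
      two_coproduct_for (Adm M) (adm_discrete M) (adm_coproduct M) coproduct_incl H) \<and>
    (\<forall>(P :: ('p, 'q) groupoid) J.
      groupoid_cocone (Adm M) (adm_discrete M) P J \<and>
      (\<forall>H :: ('a set \<times> nat, 'a set \<times> nat) groupoid. groupoid H \<longrightarrow>
        two_coproduct_for (Adm M) (adm_discrete M) P J H) \<and>
      (\<forall>H :: ('p, 'q) groupoid. groupoid H \<longrightarrow>
        two_coproduct_for (Adm M) (adm_discrete M) P J H) \<longrightarrow>
      groupoid_equivalent (adm_coproduct M) P)"
proof -
  interpret comm_binoid M by fact
  interpret fg_binoid M es by unfold_locales fact
  let ?n = "adm_rank M" and ?C = "adm_coproduct M"
  let ?D = "\<lambda>r. binoid_hom (C2_power (?n r)) real_binoid"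
    and ?D' = "\<lambda>r. {..<?n r} \<rightarrow>\<^sub>E binoid_hom C2 real_binoid"
  have RSpec_M: "RSpec M es = top_of_set X"
    by (rule RSpec_eq_top_of_set[OF gen])
  have "top_of_set X homotopy_equivalent_space top_of_set all_sign_chars"
    using X_homotopy_equivalent_idem_strata idem_strata_homotopy_equivalent by (rule homotopy_eqv_trans)
  then have X: "top_of_set X homotopy_equivalent_space discrete_topology all_sign_chars"
    by (simp add: finite_function_set_discrete[OF card_all_sign_chars(1)])
  have D: "sum_topology (\<lambda>r. RSpec (C2_power (?n r)) (C2_power_gens (?n r))) (Adm M)
      = discrete_topology (Sigma (Adm M) ?D)"
    by (simp add: RSpec_finite_discrete[OF generated_by_C2_power characters_C2_power(1)]
        sum_discrete_topology)
  have D': "sum_topology (\<lambda>r. product_topology (\<lambda>_. RSpec C2 C2_gens) {..<?n r}) (Adm M)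
      = discrete_topology (Sigma (Adm M) ?D')"
    by (simp add: RSpec_finite_discrete[OF generated_by_C2 characters_C2(1)]
        product_discrete_topology characters_C2(1) sum_discrete_topology)
  have fin: "finite (Sigma (Adm M) ?D)" "finite (Sigma (Adm M) ?D')"
    using finite_Adm characters_C2_power(1) characters_C2(1) by (auto intro!: finite_SigmaI finite_PiE)
  \<comment> \<open>After the retraction all three spaces are finite and discrete up to homotopy, so
    comparing cardinalities is all that remains.\<close>
  have card: "card (Sigma (Adm M) ?D) = (\<Sum>r\<in>Adm M. 2 ^ ?n r)"
      "card (Sigma (Adm M) ?D') = (\<Sum>r\<in>Adm M. 2 ^ ?n r)"
    using finite_Adm characters_C2_power characters_C2 by (simp_all add: card_PiE finite_PiE)
  have 1: "RSpec M es homotopy_equivalent_space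
      sum_topology (\<lambda>r. RSpec (C2_power (?n r)) (C2_power_gens (?n r))) (Adm M)"
    unfolding D RSpec_M
    by (rule homotopy_eqv_trans[OF X discrete_homotopy_equivalent])
      (simp_all only: card_all_sign_chars fin card)
  have 2: "sum_topology (\<lambda>r. RSpec (C2_power (?n r)) (C2_power_gens (?n r))) (Adm M)
      homotopy_equivalent_space
      sum_topology (\<lambda>r. product_topology (\<lambda>_. RSpec C2 C2_gens) {..<?n r}) (Adm M)"
    unfolding D D' by (rule discrete_homotopy_equivalent) (simp_all only: fin card)
  have G: "groupoid (adm_discrete M r)" for r
    unfolding adm_discrete_def by (rule groupoid_discrete)
  have cocone: "groupoid_cocone (Adm M) (adm_discrete M) ?C coproduct_incl"
    unfolding adm_coproduct_def by (rule groupoid_cocone_coproduct) (rule G)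
  then have C: "groupoid ?C" by (simp add: groupoid_cocone_def)
  have coprod: "coproduct_for (Adm M) (adm_discrete M) ?C coproduct_incl H" for H :: "('x, 'y) groupoid"
    unfolding adm_coproduct_def by (rule coproduct_for_groupoid_coproduct)
  have two: "two_coproduct_for (Adm M) (adm_discrete M) ?C coproduct_incl H"
    if "groupoid H" for H :: "('x, 'y) groupoid"
    using that coprod by (rule two_coproduct_for_of_coproduct_for)
  have 3: "groupoid_equivalent (fundamental_groupoid (RSpec M es)) ?C"
  proof -
    have Obj: "Obj ?C = Sigma (Adm M) (\<lambda>r. {..<2 ^ ?n r})"
      by (simp add: adm_coproduct_def groupoid_coproduct_def adm_discrete_def discrete_groupoid_def)
    \<comment> \<open>The identity of a point in the discrete groupoid is the point itself, so
      objects and arrows of the coproduct are the same pairs.\<close>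
    have Hom: "Hom ?C x y = (if x = y then {x} else {})" for x y
      by (auto simp: adm_coproduct_def groupoid_coproduct_def adm_discrete_def discrete_groupoid_def
          prod_eq_iff)
    have "finite (Obj ?C)" "card (Obj ?C) = (\<Sum>r\<in>Adm M. 2 ^ ?n r)"
      unfolding Obj using finite_Adm by simp_all
    \<comment> \<open>An arbitrary bijection is enough, since neither side has arrows between
      different components.\<close>
    then obtain \<phi> where \<phi>: "bij_betw \<phi> all_sign_chars (Obj ?C)"
      using finite_same_card_bij[OF card_all_sign_chars(1), of "Obj ?C"] card_all_sign_chars(2) by auto
    show ?thesis
      unfolding RSpec_M
    proof (rule fundamental_groupoid_equivalent_discrete[OF X C _ _ \<phi>])
      show "thin ?C" by (simp add: thin_def Hom)
      show "x = y" if "Hom ?C x y \<noteq> {}" for x y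
        using that Hom by metis
    qed
  qed
  have 4: "groupoid_equivalent ?C P"
    if "groupoid_cocone (Adm M) (adm_discrete M) P J"
      "\<forall>H :: ('a set \<times> nat, 'a set \<times> nat) groupoid. groupoid H \<longrightarrow>
        two_coproduct_for (Adm M) (adm_discrete M) P J H"
      "\<forall>H :: ('p, 'q) groupoid. groupoid H \<longrightarrow> two_coproduct_for (Adm M) (adm_discrete M) P J H"
    for P :: "('p, 'q) groupoid" and J
  proof -
    have P: "groupoid P" using that(1) by (simp add: groupoid_cocone_def)
    show ?thesis
      using two_coproduct_unique[OF cocone two[OF P] two[OF C] that(1)] that(2,3) P C by blast
  qed
  show ?thesis
    using 1 2 3 cocone coprod two 4 by blast
qed

end
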